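(* Assume LSH for $\mathrm{2SAT}_3$. Then for every fixed $\varepsilon\in(0,1/2)$ there is no deterministic algorithm that solves $(\mathrm{Search\mbox{-}1NFA}, m_{nfa})$ in polynomial time using $O(n^{1/2-\varepsilon})$ space, where $n=m_{nfa}(y)$ for the input instance $y$.
   Context: Turing machines are multi-tape with a read-only input tape; space counts work tapes only. A polylogarithmic function is $\ell(n)=p(\log n)$ for a polynomial $p$. $\mathrm{2SAT}_3$: instances are 2CNF formulas in which each variable $v$ has at most 3 occurrences in total of the literals $v,\overline v$; question: is it satisfiable? $m_{vbl}(x)$ = number of variables. LSH for $\mathrm{2SAT}_3$: for every $\varepsilon\in(0,1)$ and every polylogarithmic $\ell$, no deterministic TM solves $\mathrm{2SAT}_3$ simultaneously in polynomial time using at most $m_{vbl}(x)^\varepsilon\ell(|x|)$ space on every instance $x$. $\mathrm{Search\mbox{-}1NFA}$: an instance is $y=(M,1^n)$ where $M=(Q,\Sigma,\delta,q_0,F)$ is a one-way nondeterministic finite automaton with no $\lambda$-moves and $n\in\mathbb{N}$; a solution is a string $x$ of length $n$ accepted by $M$, i.e., $M$ reading $x$ can enter a final state in $F$ before or on reading the last symbol of $x$. Size parameter $m_{nfa}(y)=|Q||\Sigma|n$. An algorithm solves the search problem if on every instance it outputs a solution when one exists and outputs a designated symbol $\bot$ otherwise. *)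

theory Defs
  imports Complex_Main "HOL-Library.Landau_Symbols" "HOL-Computational_Algebra.Polynomial"
begin

section \<open>Deterministic multi-tape Turing machines\<close>

text \<open>
  A machine has a two-way read-only input tape with endmarkers, finitely many work tapes that are
  infinite to the right, and a write-only output tape.  The types \<open>'i\<close> and \<open>'o\<close> are the input and
  output alphabets; they are finite in all uses below.  States and work symbols are natural numbers
  taken from finite sets, and the work symbol 0 is the blank.
\<close>

datatype dir = MoveL | Stay | MoveR

fun move :: "dir \<Rightarrow> nat \<Rightarrow> nat" where
  "move MoveL p = p - 1"  (* moving left from cell 0 has no effect *)
| "move Stay p = p"
| "move MoveR p = Suc p"

datatype 'i input_cell = LeftEnd | Letter 'i | RightEnd

text \<open>
  A transition maps the state, the scanned input cell and the list of scanned work symbols to the new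
  state, the move of the input head, a (written symbol, head move) pair for each work tape, and
  possibly one symbol to be appended to the output.
\<close>

record ('i, 'o) tm =
  work_tapes :: nat
  states :: "nat set"
  start_state :: nat
  halt_states :: "nat set"
  work_symbols :: "nat set"
  transition :: "nat \<Rightarrow> 'i input_cell \<Rightarrow> nat list \<Rightarrow> nat \<times> dir \<times> (nat \<times> dir) list \<times> 'o option"

definition wf_tm :: "('i, 'o) tm \<Rightarrow> bool" where
  "wf_tm M \<longleftrightarrow>
     finite (states M) \<and> start_state M \<in> states M \<and> halt_states M \<subseteq> states M \<and>
     finite (work_symbols M) \<and> 0 \<in> work_symbols M \<and>
     (\<forall>q \<in> states M. \<forall>c ss. length ss = work_tapes M \<and> set ss \<subseteq> work_symbols M \<longrightarrow>
        (case transition M q c ss of (q', d, acts, z) \<Rightarrow>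
           q' \<in> states M \<and> length acts = work_tapes M \<and> fst ` set acts \<subseteq> work_symbols M))"

record 'o config =
  cur_state :: nat
  input_head :: nat
  tapes :: "((nat \<Rightarrow> nat) \<times> nat) list"  (* contents and head position of each work tape *)
  out_tape :: "'o list"

definition initial_config :: "('i, 'o) tm \<Rightarrow> 'o config" where
  "initial_config M =
     \<lparr>cur_state = start_state M, input_head = 0,
      tapes = replicate (work_tapes M) (\<lambda>_. 0, 0), out_tape = []\<rparr>"

definition input_at :: "'i list \<Rightarrow> nat \<Rightarrow> 'i input_cell" where
  "input_at x p = (if p = 0 then LeftEnd else if p \<le> length x then Letter (x ! (p - 1)) else RightEnd)"

definition act_on_tape :: "(nat \<Rightarrow> nat) \<times> nat \<Rightarrow> nat \<times> dir \<Rightarrow> (nat \<Rightarrow> nat) \<times> nat" where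
  "act_on_tape tp a = ((fst tp)(snd tp := fst a), move (snd a) (snd tp))"

text \<open>
  The input head is confined to the positions 0 (left endmarker) to \<open>length x + 1\<close> (right endmarker):
  otherwise its position would be an unbounded counter that is not charged as space.
\<close>

definition step :: "('i, 'o) tm \<Rightarrow> 'i list \<Rightarrow> 'o config \<Rightarrow> 'o config" where
  "step M x c =
     (if cur_state c \<in> halt_states M then c
      else (case transition M (cur_state c) (input_at x (input_head c))
                   (map (\<lambda>tp. fst tp (snd tp)) (tapes c)) of
        (q, d, acts, z) \<Rightarrow>
          \<lparr>cur_state = q,
           input_head = min (length x + 1) (move d (input_head c)),
           tapes = map2 act_on_tape (tapes c) acts,
           out_tape = out_tape c @ (case z of None \<Rightarrow> [] | Some b \<Rightarrow> [b])\<rparr>))"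

definition run :: "('i, 'o) tm \<Rightarrow> 'i list \<Rightarrow> nat \<Rightarrow> 'o config" where
  "run M x t = (step M x ^^ t) (initial_config M)"

definition halted_at :: "('i, 'o) tm \<Rightarrow> 'i list \<Rightarrow> nat \<Rightarrow> bool" where
  "halted_at M x t \<longleftrightarrow> cur_state (run M x t) \<in> halt_states M"

definition computes :: "('i, 'o) tm \<Rightarrow> 'i list \<Rightarrow> 'o list \<Rightarrow> bool" where
  "computes M x w \<longleftrightarrow> (\<exists>t. halted_at M x t \<and> out_tape (run M x t) = w)"

definition poly_time_on :: "('i, 'o) tm \<Rightarrow> 'i list set \<Rightarrow> bool" where
  "poly_time_on M X \<longleftrightarrow> (\<exists>p :: nat poly. \<forall>x \<in> X. \<exists>t \<le> poly p (length x). halted_at M x t)"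

text \<open>
  Space is the total number of work tape cells visited during the run.  The set of visited cells is
  finite whenever the run halts; space is only ever used for such runs.
\<close>

definition visited_cells :: "('i, 'o) tm \<Rightarrow> 'i list \<Rightarrow> (nat \<times> nat) set" where
  "visited_cells M x = {(i, snd (tapes (run M x t) ! i)) | i t. i < work_tapes M}"

definition space_used :: "('i, 'o) tm \<Rightarrow> 'i list \<Rightarrow> nat" where
  "space_used M x = card (visited_cells M x)"


section \<open>The problem 2SAT3 and its linear space hypothesis\<close>

datatype literal = Pos (var: nat) | Neg (var: nat)

type_synonym cnf = "literal list list"

fun lit_true :: "(nat \<Rightarrow> bool) \<Rightarrow> literal \<Rightarrow> bool" where
  "lit_true \<sigma> (Pos v) = \<sigma> v"
| "lit_true \<sigma> (Neg v) = (\<not> \<sigma> v)"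

definition satisfiable :: "cnf \<Rightarrow> bool" where
  "satisfiable \<phi> \<longleftrightarrow> (\<exists>\<sigma>. \<forall>C \<in> set \<phi>. \<exists>l \<in> set C. lit_true \<sigma> l)"

text \<open>
  A 2CNF formula is a nonempty conjunction of clauses of one or two literals.  The formula without
  clauses is excluded because it has no variables, so that a space bound proportional to
  \<open>m_vbl \<phi> powr \<epsilon>\<close> would be 0 there and could not be met by any machine that has a work tape.
\<close>

definition two_cnf :: "cnf \<Rightarrow> bool" where
  "two_cnf \<phi> \<longleftrightarrow> \<phi> \<noteq> [] \<and> (\<forall>C \<in> set \<phi>. length C \<in> {1, 2})"

definition two_sat3_instances :: "cnf set" where
  "two_sat3_instances =
     {\<phi>. two_cnf \<phi> \<and> (\<forall>v. length (filter (\<lambda>l. var l = v) (concat \<phi>)) \<le> 3)}"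

definition m_vbl :: "cnf \<Rightarrow> nat" where
  "m_vbl \<phi> = card (var ` set (concat \<phi>))"

text \<open>Variables are written in binary, least significant bit first.\<close>

datatype cnf_sym = PosSign | NegSign | Digit bool | EndClause

fun binary :: "nat \<Rightarrow> bool list" where
  "binary n = (if n = 0 then [] else odd n # binary (n div 2))"

declare binary.simps [simp del]

fun encode_literal :: "literal \<Rightarrow> cnf_sym list" where
  "encode_literal (Pos v) = PosSign # map Digit (binary v)"
| "encode_literal (Neg v) = NegSign # map Digit (binary v)"

definition encode_cnf :: "cnf \<Rightarrow> cnf_sym list" where
  "encode_cnf \<phi> = concat (map (\<lambda>C. concat (map encode_literal C) @ [EndClause]) \<phi>)"

definition solves_2SAT3 :: "(cnf_sym, bool) tm \<Rightarrow> bool" where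
  "solves_2SAT3 M \<longleftrightarrow> (\<forall>\<phi> \<in> two_sat3_instances. computes M (encode_cnf \<phi>) [satisfiable \<phi>])"

definition polylogarithmic :: "(nat \<Rightarrow> real) \<Rightarrow> bool" where
  "polylogarithmic f \<longleftrightarrow> (\<exists>p :: real poly. \<forall>n. f n = poly p (log 2 (real n)))"

definition LSH_2SAT3 :: bool where
  "LSH_2SAT3 \<longleftrightarrow>
     (\<forall>\<epsilon> :: real. \<forall>f. 0 < \<epsilon> \<and> \<epsilon> < 1 \<and> polylogarithmic f \<longrightarrow>
        \<not> (\<exists>M :: (cnf_sym, bool) tm.
             wf_tm M \<and> solves_2SAT3 M \<and> poly_time_on M (encode_cnf ` two_sat3_instances) \<and>
             (\<forall>\<phi> \<in> two_sat3_instances.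
                real (space_used M (encode_cnf \<phi>))
                  \<le> real (m_vbl \<phi>) powr \<epsilon> * f (length (encode_cnf \<phi>)))))"


section \<open>The search problem for one-way nondeterministic finite automata\<close>

text \<open>
  States and letters are numbered consecutively: \<open>Q = {..<num_states A}\<close>, \<open>\<Sigma> = {..<num_letters A}\<close>.
\<close>

record nfa =
  num_states :: nat
  num_letters :: nat
  delta :: "nat \<Rightarrow> nat \<Rightarrow> nat set"
  initial :: nat
  final :: "nat set"

definition wf_nfa :: "nfa \<Rightarrow> bool" where
  "wf_nfa A \<longleftrightarrow>
     num_letters A > 0 \<and> initial A < num_states A \<and> final A \<subseteq> {..<num_states A} \<and>
     (\<forall>q < num_states A. \<forall>a < num_letters A. delta A q a \<subseteq> {..<num_states A})"

definition reachable :: "nfa \<Rightarrow> nat list \<Rightarrow> nat set" where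
  "reachable A w = fold (\<lambda>a S. \<Union>q \<in> S. delta A q a) w {initial A}"

text \<open>
  Acceptance means that a final state can be entered after reading some prefix of the input; the
  automaton need not be able to continue from there.
\<close>

definition accepts :: "nfa \<Rightarrow> nat list \<Rightarrow> bool" where
  "accepts A w \<longleftrightarrow> (\<exists>i \<le> length w. reachable A (take i w) \<inter> final A \<noteq> {})"

type_synonym search_instance = "nfa \<times> nat"

definition search_1nfa_instances :: "search_instance set" where
  "search_1nfa_instances = {(A, n). wf_nfa A}"

fun is_solution :: "search_instance \<Rightarrow> nat list \<Rightarrow> bool" where
  "is_solution (A, n) w \<longleftrightarrow> length w = n \<and> set w \<subseteq> {..<num_letters A} \<and> accepts A w"

fun m_nfa :: "search_instance \<Rightarrow> nat" where
  "m_nfa (A, n) = num_states A * num_letters A * n"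

text \<open>
  An instance is written as the unary numbers of states and letters, the transition relation as a
  table of bits indexed by (state, letter, successor) in lexicographic order, the initial state in
  unary, the final states as a bit vector, and the word length in unary.
\<close>

datatype nfa_sym = Bit bool | Hash

definition unary :: "nat \<Rightarrow> nfa_sym list" where
  "unary k = replicate k (Bit True)"

fun encode_search :: "search_instance \<Rightarrow> nfa_sym list" where
  "encode_search (A, n) =
     unary (num_states A) @ [Hash] @
     unary (num_letters A) @ [Hash] @
     [Bit (q' \<in> delta A q a).
        q \<leftarrow> [0..<num_states A], a \<leftarrow> [0..<num_letters A], q' \<leftarrow> [0..<num_states A]] @ [Hash] @
     unary (initial A) @ [Hash] @
     [Bit (q \<in> final A). q \<leftarrow> [0..<num_states A]] @ [Hash] @
     unary n"

text \<open>
  The alphabet of the automaton is part of the instance, so a solution is written on the output tape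
  letter by letter, each letter in unary and followed by a terminator.
\<close>

datatype out_sym = Bot | Stroke | EndLetter

definition encode_word :: "nat list \<Rightarrow> out_sym list" where
  "encode_word w = concat (map (\<lambda>a. replicate a Stroke @ [EndLetter]) w)"

definition solves_search_1nfa :: "(nfa_sym, out_sym) tm \<Rightarrow> bool" where
  "solves_search_1nfa M \<longleftrightarrow>
     (\<forall>y \<in> search_1nfa_instances.
        if \<exists>w. is_solution y w
        then \<exists>w. is_solution y w \<and> computes M (encode_search y) (encode_word w)
        else computes M (encode_search y) [Bot])"

text \<open>The limit with respect to which space bounds in terms of \<open>m_nfa\<close> are asymptotic.\<close>

definition m_nfa_at_top :: "search_instance filter" where
  "m_nfa_at_top = inf (filtercomap m_nfa at_top) (principal search_1nfa_instances)"

end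

theory Submission imports Defs begin

text \<open>
  Unsatisfiability of a 2CNF formula means that some literal implies its negation and conversely in the
  implication graph.  The vertices of this graph are represented by the two slots (first and last
  literal) of the clauses, and 2SAT3 has at most three clauses per variable, so reachability from a
  slot to its negation is a search instance with \<open>2 * length \<phi>\<close> states, one letter and words of length
  \<open>2 * length \<phi>\<close>: its size parameter is quadratic in the number of variables.  A search machine running
  in space \<open>m_nfa powr (1 / 2 - \<epsilon>)\<close> therefore decides 2SAT3 in space \<open>m_vbl powr (1 - 2 * \<epsilon>)\<close> up to the
  counters, provided that the automaton is never written down: whenever the simulated machine reads an
  input symbol, the encoding of the automaton is generated from its beginning, and only the symbol at
  the position of the simulated input head is kept.  The reduction is programmed in a small language
  of while programs over Turing machine tapes, which is compiled to a Turing machine.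
\<close>

section \<open>While programs and their compilation to Turing machines\<close>

text \<open>Slots serve as states because variable names are arbitrary binary numbers, whereas the
  states of an automaton are consecutive numbers; a slot is addressed by a clause counter and one
  bit. Unsatisfiability takes two complementary slots each of which reaches the negation of its
  literal, hence two queries per pair. Of an answer only the presence of \<open>Bot\<close> matters,
  so solutions are never stored. The tapes of the simulated machine dominate the space; they are
  erased and reused from query to query, while everything else sits in registers or in counters of
  logarithmic length. Time is treated generously: every symbol of either input is found again from
  the left end, which costs polynomial factors only. A last obstacle is that the assumed space bound
  is asymptotic while the refuted one must hold on every formula; small queries are covered by the
  time bound.\<close>

record 'o store =
  ihd :: nat
  tps :: "nat \<Rightarrow> (nat \<Rightarrow> nat) \<times> nat"
  outp :: "'o list"

type_synonym 'o act = "dir \<times> (nat \<Rightarrow> (nat \<times> dir) option) \<times> 'o option"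

datatype ('i, 'o) cmd =
    Skip
  | Prim "'i input_cell \<Rightarrow> (nat \<Rightarrow> nat) \<Rightarrow> 'o act"
  | Seq "('i, 'o) cmd" "('i, 'o) cmd"
  | If "'i input_cell \<Rightarrow> (nat \<Rightarrow> nat) \<Rightarrow> bool" "('i, 'o) cmd" "('i, 'o) cmd"
  | While "'i input_cell \<Rightarrow> (nat \<Rightarrow> nat) \<Rightarrow> bool" "('i, 'o) cmd"

definition idle :: "'o act" where
  "idle = (Stay, (\<lambda>_. None), None)"

text \<open>A finished first half \<open>Skip\<close> of \<open>Seq\<close> is discarded by an idle
  step of its own, and a loop unfolds into a \<open>Seq\<close>. Thus every successor is built from
  subprograms of the original program, which keeps the control states finite in number.\<close>

fun next_cmd :: "'i input_cell \<Rightarrow> (nat \<Rightarrow> nat) \<Rightarrow> ('i, 'o) cmd \<Rightarrow> ('i, 'o) cmd \<times> 'o act" where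
  "next_cmd z sc Skip = (Skip, idle)"
| "next_cmd z sc (Prim f) = (Skip, f z sc)"
| "next_cmd z sc (Seq c d) =
     (if c = Skip then (d, idle) else (let (c', a) = next_cmd z sc c in (Seq c' d, a)))"
| "next_cmd z sc (If b c d) = (if b z sc then c else d, idle)"
| "next_cmd z sc (While b c) = (if b z sc then Seq c (While b c) else Skip, idle)"

text \<open>The control states of the machine compiled from a program are its continuations, that is, what
  may remain to be executed.\<close>

fun conts :: "('i, 'o) cmd \<Rightarrow> ('i, 'o) cmd set" where
  "conts Skip = {Skip}"
| "conts (Prim f) = {Prim f, Skip}"
| "conts (Seq c d) = (\<lambda>c'. Seq c' d) ` conts c \<union> conts d"
| "conts (If b c d) = {If b c d} \<union> conts c \<union> conts d"
| "conts (While b c) = {While b c, Skip} \<union> (\<lambda>c'. Seq c' (While b c)) ` conts c"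

lemma finite_conts: "finite (conts c)"
  by (induction c) auto

lemma self_in_conts: "c \<in> conts c"
  by (induction c) auto

lemma Skip_in_conts: "Skip \<in> conts c"
  by (induction c) auto

lemma next_cmd_in_conts: "d \<in> conts c \<Longrightarrow> fst (next_cmd z sc d) \<in> conts c"
proof (induction c arbitrary: d)
  case (Seq c1 c2)
  then show ?case by (auto simp: self_in_conts case_prod_beta Let_def)
next
  case (While b c)
  then show ?case
    by (auto simp: self_in_conts Skip_in_conts case_prod_beta Let_def split: if_split_asm)
qed (auto simp: self_in_conts)

text \<open>Makes every program compile to a well-formed machine, whatever its primitive functions
  yield. The correctness lemmas ensure \<open>v < K\<close>, where it is the identity.\<close>

definition clip :: "nat \<Rightarrow> nat \<Rightarrow> nat" where
  "clip K v = (if v < K then v else 0)"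

definition scan :: "nat \<Rightarrow> 'o store \<Rightarrow> nat \<Rightarrow> nat" where
  "scan k s i = (if i < k then fst (tps s i) (snd (tps s i)) else 0)"

definition act_store :: "nat \<Rightarrow> 'i list \<Rightarrow> 'o act \<Rightarrow> 'o store \<Rightarrow> 'o store" where
  "act_store K x a s = (case a of (d, w, z) \<Rightarrow>
     \<lparr>ihd = min (length x + 1) (move d (ihd s)),
      tps = (\<lambda>i. case w i of None \<Rightarrow> tps s i
                 | Some (v, e) \<Rightarrow> act_on_tape (tps s i) (clip K v, e)),
      outp = outp s @ (case z of None \<Rightarrow> [] | Some b \<Rightarrow> [b])\<rparr>)"

definition heads_le :: "nat \<Rightarrow> nat \<Rightarrow> 'o store \<Rightarrow> bool" where
  "heads_le k B s \<longleftrightarrow> (\<forall>i<k. snd (tps s i) \<le> B)"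

section \<open>Small steps and timed executions\<close>

definition small_step ::
  "nat \<Rightarrow> nat \<Rightarrow> 'i list \<Rightarrow> ('i, 'o) cmd \<times> 'o store \<Rightarrow> ('i, 'o) cmd \<times> 'o store" where
  "small_step K k x p = (case p of (c, s) \<Rightarrow>
     (case next_cmd (input_at x (ihd s)) (scan k s) c of (c', a) \<Rightarrow> (c', act_store K x a s)))"

text \<open>The time counts machine steps exactly: besides the primitive acts it charges one step
  for each test and one for each discarded \<open>Skip\<close> of a \<open>Seq\<close>, hence the 2
  per loop iteration. The conditions on heads in the base rules carry the space bound along the
  whole execution.\<close>

inductive exec ::
  "nat \<Rightarrow> nat \<Rightarrow> nat \<Rightarrow> 'i list \<Rightarrow> ('i, 'o) cmd \<Rightarrow> 'o store \<Rightarrow> nat \<Rightarrow> 'o store \<Rightarrow> bool"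
  for K k B x where
  Skip: "heads_le k B s \<Longrightarrow> exec K k B x Skip s 0 s"
| Prim: "heads_le k B s \<Longrightarrow> s' = act_store K x (f (input_at x (ihd s)) (scan k s)) s
    \<Longrightarrow> heads_le k B s' \<Longrightarrow> exec K k B x (Prim f) s 1 s'"
| Seq: "exec K k B x c s t s1 \<Longrightarrow> exec K k B x d s1 u s2 \<Longrightarrow>
    exec K k B x (Seq c d) s (Suc (t + u)) s2"
| IfT: "b (input_at x (ihd s)) (scan k s) \<Longrightarrow> exec K k B x c s t s1 \<Longrightarrow>
    exec K k B x (If b c d) s (Suc t) s1"
| IfF: "\<not> b (input_at x (ihd s)) (scan k s) \<Longrightarrow> exec K k B x d s t s1 \<Longrightarrow>
    exec K k B x (If b c d) s (Suc t) s1"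
| WhileF: "\<not> b (input_at x (ihd s)) (scan k s) \<Longrightarrow> heads_le k B s \<Longrightarrow>
    exec K k B x (While b c) s 1 s"
| WhileT: "b (input_at x (ihd s)) (scan k s) \<Longrightarrow> exec K k B x c s t s1 \<Longrightarrow>
    exec K k B x (While b c) s1 u s2 \<Longrightarrow> exec K k B x (While b c) s (t + u + 2) s2"

text \<open>That \<open>Skip\<close> is not reached before time \<open>t\<close> allows a trace of
  \<open>c\<close> to be replayed inside \<open>Seq c d\<close>, where a finished first half is
  treated differently.\<close>

definition traces ::
  "nat \<Rightarrow> nat \<Rightarrow> nat \<Rightarrow> 'i list \<Rightarrow> ('i, 'o) cmd \<Rightarrow> 'o store \<Rightarrow> nat \<Rightarrow> ('i, 'o) cmd \<Rightarrow> 'o store \<Rightarrow> bool"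
where
  "traces K k B x c s t d s' \<longleftrightarrow>
     (small_step K k x ^^ t) (c, s) = (d, s') \<and>
     (\<forall>u\<le>t. heads_le k B (snd ((small_step K k x ^^ u) (c, s)))) \<and>
     (\<forall>u<t. fst ((small_step K k x ^^ u) (c, s)) \<noteq> Skip)"

text \<open>Even an idle act confines the input head, hence the assumption on
  \<open>ihd s\<close>.\<close>

lemma small_step_idle:
  assumes "next_cmd (input_at x (ihd s)) (scan k s) c = (c', idle)" "ihd s \<le> length x + 1"
  shows "small_step K k x (c, s) = (c', s)"
  using assms by (simp add: small_step_def act_store_def idle_def)

lemma act_store_ihd: "ihd (act_store K x a s) \<le> length x + 1"
  by (simp add: act_store_def split: prod.splits)

lemma exec_ihd:
  "exec K k B x c s t s' \<Longrightarrow> ihd s \<le> length x + 1 \<Longrightarrow> ihd s' \<le> length x + 1"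
  by (induction rule: exec.induct) (auto simp: act_store_ihd simp del: One_nat_def)

lemma traces_0: "traces K k B x c s 0 c s \<longleftrightarrow> heads_le k B s"
  by (simp add: traces_def)

lemma traces_trans:
  assumes "traces K k B x c s t d s1" "traces K k B x d s1 u e s2"
  shows "traces K k B x c s (t + u) e s2"
proof -
  let ?f = "small_step K k x"
  have 1: "(?f ^^ (t + v)) (c, s) = (?f ^^ v) (d, s1)" for v
    using assms(1) by (simp add: traces_def funpow_add add.commute[of t])
  have 2: "(?f ^^ w) (c, s) = (?f ^^ (w - t)) (d, s1)" if "t \<le> w" for w
    using 1[of "w - t"] that by simp
  show ?thesis unfolding traces_def
  proof (intro conjI allI impI)
    show "(?f ^^ (t + u)) (c, s) = (e, s2)" using 1 assms(2) by (simp add: traces_def)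
    fix w
    show "heads_le k B (snd ((?f ^^ w) (c, s)))" if "w \<le> t + u"
      using that assms 2[of w] by (cases "w \<le> t") (auto simp: traces_def)
    show "fst ((?f ^^ w) (c, s)) \<noteq> Skip" if "w < t + u"
      using that assms 2[of w] by (cases "w < t") (auto simp: traces_def)
  qed
qed

lemma traces_step:
  assumes "small_step K k x (c, s) = (d, s')" "c \<noteq> Skip" "heads_le k B s" "heads_le k B s'"
  shows "traces K k B x c s 1 d s'"
  using assms by (auto simp: traces_def less_Suc_eq le_Suc_eq)

lemma small_step_Seq:
  assumes "c \<noteq> Skip"
  shows "small_step K k x (Seq c d, s) =
    (Seq (fst (small_step K k x (c, s))) d, snd (small_step K k x (c, s)))"
  using assms by (simp add: small_step_def split: prod.splits)

lemma traces_Seq: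
  assumes "traces K k B x c s t e s'"
  shows "traces K k B x (Seq c d) s t (Seq e d) s'"
proof -
  let ?f = "small_step K k x"
  have *: "(?f ^^ u) (Seq c d, s) = (Seq (fst ((?f ^^ u) (c, s))) d, snd ((?f ^^ u) (c, s)))"
    if "u \<le> t" for u using that
  proof (induction u)
    case (Suc u)
    then have "fst ((?f ^^ u) (c, s)) \<noteq> Skip" using assms by (simp add: traces_def)
    then show ?case
      using Suc small_step_Seq[of "fst ((?f ^^ u) (c, s))" K k x d "snd ((?f ^^ u) (c, s))"]
      by simp
  qed simp
  show ?thesis using assms * by (auto simp: traces_def)
qed

lemma exec_heads:
  "exec K k B x c s t s' \<Longrightarrow> heads_le k B s \<and> heads_le k B s'" by (induction rule: exec.induct) auto

lemma exec_traces:
  "exec K k B x c s t s' \<Longrightarrow> ihd s \<le> length x + 1 \<Longrightarrow> traces K k B x c s t Skip s'"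
proof (induction rule: exec.induct)
  case (Skip s)
  then show ?case by (simp add: traces_0)
next
  case (Prim s s' f)
  then show ?case by (intro traces_step) (auto simp: small_step_def)
next
  case (Seq c s t s1 d u s2)
  have "traces K k B x (Seq Skip d) s1 1 d s1"
    using Seq by (intro traces_step) (auto dest: exec_heads exec_ihd intro!: small_step_idle)
  moreover have "traces K k B x d s1 u Skip s2" using Seq exec_ihd by blast
  moreover have "traces K k B x (Seq c d) s t (Seq Skip d) s1" using Seq traces_Seq by blast
  ultimately show ?case using traces_trans[OF traces_trans] by fastforce
next
  case (IfT b s c t s1 d)
  have "traces K k B x (If b c d) s 1 c s"
    using IfT by (intro traces_step) (auto dest: exec_heads intro!: small_step_idle)
  then show ?case using IfT traces_trans by fastforce
next
  case (IfF b s d t s1 c)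
  have "traces K k B x (If b c d) s 1 d s"
    using IfF by (intro traces_step) (auto dest: exec_heads intro!: small_step_idle)
  then show ?case using IfF traces_trans by fastforce
next
  case (WhileF b s c)
  then show ?case by (intro traces_step) (auto intro!: small_step_idle)
next
  case (WhileT b s c t s1 u s2)
  have 1: "traces K k B x (While b c) s 1 (Seq c (While b c)) s"
    using WhileT by (intro traces_step) (auto dest: exec_heads intro!: small_step_idle)
  have 2: "traces K k B x (Seq Skip (While b c)) s1 1 (While b c) s1"
    using WhileT by (intro traces_step) (auto dest: exec_heads exec_ihd intro!: small_step_idle)
  have 3: "traces K k B x (Seq c (While b c)) s t (Seq Skip (While b c)) s1"
    using WhileT traces_Seq by blast
  have 4: "traces K k B x (While b c) s1 u Skip s2" using WhileT exec_ihd by blast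
  show ?case
    using traces_trans[OF traces_trans[OF traces_trans[OF 1 3] 2] 4] by (simp add: algebra_simps)
qed

section \<open>The compiled machine\<close>

definition cmd_code :: "('i, 'o) cmd \<Rightarrow> ('i, 'o) cmd \<Rightarrow> nat" where
  "cmd_code c = (SOME e. inj_on e (conts c))"

lemma inj_cmd_code: "inj_on (cmd_code c) (conts c)"
proof -
  have "\<exists>e :: _ \<Rightarrow> nat. inj_on e (conts c)" using finite_conts finite_imp_inj_to_nat_seg by blast
  then show ?thesis unfolding cmd_code_def by (rule someI_ex)
qed

text \<open>Every transition of a machine writes on all tapes, so a tape without an action gets its
  scanned symbol back.\<close>

definition compile :: "nat \<Rightarrow> nat \<Rightarrow> ('i, 'o) cmd \<Rightarrow> ('i, 'o) tm" where
  "compile K k c =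
     \<lparr>work_tapes = k,
      states = cmd_code c ` conts c,
      start_state = cmd_code c c,
      halt_states = {cmd_code c Skip},
      work_symbols = {..<K},
      transition = (\<lambda>q z ss.
        case next_cmd z (\<lambda>i. if i < k then ss ! i else 0) (inv_into (conts c) (cmd_code c) q) of
          (d, h, w, b) \<Rightarrow>
            (cmd_code c d, h,
             map (\<lambda>i. case w i of None \<Rightarrow> (ss ! i, Stay) | Some (v, e) \<Rightarrow> (clip K v, e)) [0..<k],
             b))\<rparr>"

lemma wf_compile:
  assumes "0 < K"
  shows "wf_tm (compile K k c)"
  unfolding wf_tm_def
proof (intro conjI ballI allI impI)
  fix q z ss
  assume q: "q \<in> states (compile K k c)"
    and ss: "length ss = work_tapes (compile K k c) \<and> set ss \<subseteq> work_symbols (compile K k c)"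
  obtain d h w b where n:
    "next_cmd z (\<lambda>i. if i < k then ss ! i else 0) (inv_into (conts c) (cmd_code c) q) = (d, h, w, b)"
    using prod_cases4 by blast
  have "inv_into (conts c) (cmd_code c) q \<in> conts c"
    using q by (simp add: compile_def inv_into_into)
  then have "d \<in> conts c" using next_cmd_in_conts n by (metis fst_conv)
  moreover have "ss ! i < K" if "i < k" for i
    using ss that nth_mem[of i ss] by (simp add: compile_def subset_iff)
  ultimately show "case transition (compile K k c) q z ss of (q', d, acts, z) \<Rightarrow>
      q' \<in> states (compile K k c) \<and> length acts = work_tapes (compile K k c) \<and>
      fst ` set acts \<subseteq> work_symbols (compile K k c)"
    using n assms by (force simp: compile_def clip_def split: option.splits)
qed (use assms in \<open>auto simp: compile_def finite_conts self_in_conts Skip_in_conts\<close>)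

definition config_of :: "nat \<Rightarrow> ('i, 'o) cmd \<Rightarrow> ('i, 'o) cmd \<times> 'o store \<Rightarrow> 'o config" where
  "config_of k c p =
     \<lparr>cur_state = cmd_code c (fst p), input_head = ihd (snd p),
      tapes = map (tps (snd p)) [0..<k], out_tape = outp (snd p)\<rparr>"

lemma step_compile:
  assumes "d \<in> conts c" "ihd s \<le> length x + 1"
  shows "step (compile K k c) x (config_of k c (d, s)) = config_of k c (small_step K k x (d, s))"
proof (cases "d = Skip")
  case True
  then show ?thesis using assms by (simp add: step_def config_of_def compile_def small_step_idle)
next
  case False
  obtain d' h w b where n:
    "next_cmd (input_at x (ihd s)) (scan k s) d = (d', h, w, b)" using prod_cases4 by blast
  let ?ss = "map (\<lambda>i. fst (tps s i) (snd (tps s i))) [0..<k]"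
  have sc: "(\<lambda>i. if i < k then ?ss ! i else 0) = scan k s" by (auto simp: scan_def fun_eq_iff)
  have ne: "cmd_code c d \<noteq> cmd_code c Skip"
    using False assms(1) inj_cmd_code Skip_in_conts by (metis inj_onD)
  have inv: "inv_into (conts c) (cmd_code c) (cmd_code c d) = d"
    using assms(1) inv_into_f_f[OF inj_cmd_code] by blast
  have "map2 act_on_tape (map (tps s) [0..<k])
      (map (\<lambda>i. case w i of None \<Rightarrow> (?ss ! i, Stay)
                       | Some (v, e) \<Rightarrow> (clip K v, e)) [0..<k])
    = map (\<lambda>i. case w i of None \<Rightarrow> tps s i | Some (v, e) \<Rightarrow> act_on_tape (tps s i) (clip K v, e)) [0..<k]"
    by (rule nth_equalityI) (auto simp: act_on_tape_def split: option.splits)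
  then show ?thesis unfolding step_def config_of_def using ne inv n sc
    by (simp add: compile_def small_step_def act_store_def o_def del: nth_map cong: if_cong)
qed

definition initial_store :: "'o store" where
  "initial_store = \<lparr>ihd = 0, tps = (\<lambda>_. (\<lambda>_. 0, 0)), outp = []\<rparr>"

lemma run_compile:
  "run (compile K k c) x t = config_of k c ((small_step K k x ^^ t) (c, initial_store))
   \<and> fst ((small_step K k x ^^ t) (c, initial_store)) \<in> conts c
   \<and> ihd (snd ((small_step K k x ^^ t) (c, initial_store :: 'o store))) \<le> length x + 1"
proof (induction t)
  case 0
  show ?case
    by (auto simp: run_def initial_config_def config_of_def compile_def initial_store_def
        self_in_conts map_replicate_const)
next
  case (Suc t)
  obtain d s where ds: "(small_step K k x ^^ t) (c, initial_store) = (d, s)" by fastforce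
  then have d: "d \<in> conts c" "ihd s \<le> length x + 1"
    and r: "run (compile K k c) x t = config_of k c (d, s)"
    using Suc by auto
  have "run (compile K k c) x (Suc t) = config_of k c (small_step K k x (d, s))"
    using step_compile[OF d] r by (simp add: run_def)
  moreover have "fst (small_step K k x (d, s)) \<in> conts c"
    using next_cmd_in_conts[OF d(1)] by (simp add: small_step_def case_prod_beta)
  moreover have "ihd (snd (small_step K k x (d, s))) \<le> length x + 1"
    using act_store_ihd[where x = x] by (simp add: small_step_def case_prod_beta)
  ultimately show ?case using ds by simp
qed

theorem compile_correct:
  assumes "exec K k B x c initial_store t s"
  shows "halted_at (compile K k c) x t"
    and "out_tape (run (compile K k c) x t) = outp s"
    and "space_used (compile K k c) x \<le> k * (B + 1)"
proof -
  let ?f = "small_step K k x"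
  have tr: "traces K k B x c initial_store t Skip s"
    using exec_traces[OF assms] by (simp add: initial_store_def)
  then have r: "run (compile K k c) x t = config_of k c (Skip, s)"
    using run_compile[of K k c x t] by (simp add: traces_def)
  then show "halted_at (compile K k c) x t" "out_tape (run (compile K k c) x t) = outp s"
    by (auto simp: halted_at_def config_of_def compile_def)
  have ihd: "ihd s \<le> length x + 1" using exec_ihd[OF assms] by (simp add: initial_store_def)
  \<comment> \<open>\<open>visited_cells\<close> ranges over all times, so the heads must also be
    bounded after halting, when the configuration no longer changes.\<close>
  have *: "heads_le k B (snd ((?f ^^ u) (c, initial_store)))" for u
  proof (cases "u \<le> t")
    case True
    then show ?thesis using tr by (simp add: traces_def)
  next
    case False
    have "(?f ^^ v) (Skip, s) = (Skip, s)" for v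
      by (induction v) (use ihd in \<open>auto intro!: small_step_idle\<close>)
    moreover have "(?f ^^ u) (c, initial_store) = (?f ^^ (u - t)) ((?f ^^ t) (c, initial_store))"
      using False by (metis comp_apply funpow_add le_add_diff_inverse2 nat_le_linear)
    ultimately have "(?f ^^ u) (c, initial_store) = (Skip, s)" using tr by (simp add: traces_def)
    then show ?thesis using exec_heads[OF assms] by simp
  qed
  have "visited_cells (compile K k c) x \<subseteq> {..<k} \<times> {..B}"
  proof
    fix p assume "p \<in> visited_cells (compile K k c) x"
    then obtain i u where "p = (i, snd (tapes (run (compile K k c) x u) ! i))" "i < k"
      by (auto simp: visited_cells_def compile_def)
    then show "p \<in> {..<k} \<times> {..B}"
      using *[of u] run_compile[of K k c x u] by (auto simp: config_of_def heads_le_def)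
  qed
  then have "card (visited_cells (compile K k c) x) \<le> card ({..<k} \<times> {..B})"
    by (intro card_mono) auto
  then show "space_used (compile K k c) x \<le> k * (B + 1)" by (simp add: space_used_def)
qed

section \<open>Binary counters\<close>

declare One_nat_def [simp del]

text \<open>Counters are written in bijective base 2, with digits 1 and 2 and the least significant digit
  first: numbers have unique representations, and a counter is 0 iff its first cell is blank.\<close>

fun digits_inc :: "nat list \<Rightarrow> nat list" where
  "digits_inc [] = [1]"
| "digits_inc (d # ds) = (if d = 1 then 2 # ds else 1 # digits_inc ds)"

fun digits_dec :: "nat list \<Rightarrow> nat list" where
  "digits_dec [] = []"
| "digits_dec (d # ds) = (if d = 2 then 1 # ds else if ds = [] then [] else 2 # digits_dec ds)"

primrec digits :: "nat \<Rightarrow> nat list" where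
  "digits 0 = []"
| "digits (Suc n) = digits_inc (digits n)"

lemma digits_inc_set: "set ds \<subseteq> {1, 2} \<Longrightarrow> set (digits_inc ds) \<subseteq> {1, 2}"
  by (induction ds) auto

lemma digits_set: "set (digits n) \<subseteq> {1, 2}"
  by (induction n) (simp_all add: digits_inc_set del: One_nat_def)

lemma digits_inc_not_Nil [simp]: "digits_inc ds \<noteq> []"
  by (cases ds) auto

lemma digits_dec_inc: "set ds \<subseteq> {1, 2} \<Longrightarrow> digits_dec (digits_inc ds) = ds"
  by (induction ds) auto

lemma digits_dec: "digits_dec (digits n) = digits (n - 1)"
  by (cases n) (simp_all add: digits_dec_inc digits_set del: One_nat_def)

lemma digits_eq_Nil [simp]: "digits n = [] \<longleftrightarrow> n = 0"
  by (cases n) auto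

text \<open>All digits are at least 1, so a numeral of length \<open>l\<close> has at least the
  value \<open>2 ^ l - 1\<close>. This is what makes counters logarithmic in length.\<close>

lemma two_power_length_digits: "2 ^ length (digits n) \<le> n + 1"
proof -
  define val :: "nat list \<Rightarrow> nat" where "val ds = foldr (\<lambda>d v. d + 2 * v) ds 0" for ds
  have inc: "set ds \<subseteq> {1, 2} \<Longrightarrow> val (digits_inc ds) = Suc (val ds)" for ds
    by (induction ds) (auto simp: val_def)
  have "val (digits n) = n"
    by (induction n) (simp add: val_def, simp add: inc digits_set del: One_nat_def)
  moreover have "set ds \<subseteq> {1, 2} \<Longrightarrow> 2 ^ length ds \<le> val ds + 1" for ds
    by (induction ds) (auto simp: val_def)
  ultimately show ?thesis using digits_set by metis
qed

text \<open>With \<open>m = 3\<close> this is a counter behind its left marker; with the empty list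
  it is a register, whose value sits in cell 0.\<close>

definition list_tape :: "nat \<Rightarrow> nat list \<Rightarrow> nat \<Rightarrow> nat" where
  "list_tape m xs p = (case p of 0 \<Rightarrow> m | Suc q \<Rightarrow> if q < length xs then xs ! q else 0)"

text \<open>The stretch over which a carry (\<open>d = 2\<close>) or a borrow (\<open>d = 1\<close>)
  propagates.\<close>

definition run_length :: "nat \<Rightarrow> nat list \<Rightarrow> nat" where
  "run_length d ds = length (takeWhile (\<lambda>e. e = d) ds)"

lemma run_length_simps [simp]:
  "run_length d [] = 0"
  "run_length d (e # es) = (if e = d then Suc (run_length d es) else 0)"
  by (simp_all add: run_length_def)

lemma run_length_le: "run_length d ds \<le> length ds"
  by (simp add: run_length_def length_takeWhile_le)

lemma nth_run_length: "i < run_length d ds \<Longrightarrow> ds ! i = d"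
proof (induction ds arbitrary: i)
  case (Cons e ds)
  then show ?case by (cases i) (auto split: if_splits)
qed simp

lemma nth_after_run_length: "run_length d ds < length ds \<Longrightarrow> ds ! run_length d ds \<noteq> d"
  by (induction ds) (auto split: if_splits)

lemma list_tape_simps [simp]:
  "list_tape m xs 0 = m"
  "list_tape m [] (Suc q) = 0"
  "list_tape m (y # ys) (Suc 0) = y"
  "list_tape m (y # ys) (Suc (Suc q)) = list_tape m ys (Suc q)" by (auto simp: list_tape_def)

lemma list_tape_Suc: "list_tape m xs (1 + q) = (if q < length xs then xs ! q else 0)"
  by (auto simp: list_tape_def split: nat.split)

text \<open>The carry turns leading 2s into 1s and is absorbed by the first 1, which becomes 2, or
  by the blank behind the numeral, which becomes 1.\<close>

lemma list_tape_inc: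
  assumes "set ds \<subseteq> {1, 2}"
  shows "list_tape m (digits_inc ds) (Suc q) =
    (if q < run_length 2 ds then 1
     else if q = run_length 2 ds then (if q < length ds then 2 else 1)
     else list_tape m ds (Suc q))" using assms
proof (induction ds arbitrary: q)
  case Nil
  then show ?case by (cases q) auto
next
  case (Cons d ds)
  then consider "d = 1" | "d = 2" by auto
  then show ?case
  proof cases
    case 1
    then show ?thesis by (cases q) simp_all
  next
    case 2
    show ?thesis
    proof (cases q)
      case (Suc q')
      then show ?thesis using Cons.IH[of q'] Cons.prems 2 by simp
    qed (simp add: 2)
  qed
qed

text \<open>The borrow turns leading 1s into 2s and is absorbed by the first 2. If there is none,
  the numeral loses a digit: \<open>l\<close> digits 1 become \<open>l - 1\<close> digits 2, so the
  last cell is blanked.\<close>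

lemma list_tape_dec:
  assumes "set ds \<subseteq> {1, 2}" "ds \<noteq> []"
  shows "list_tape m (digits_dec ds) (Suc q) =
    (if run_length 1 ds = length ds then (if Suc q < length ds then 2 else 0)
     else if q < run_length 1 ds then 2
     else if q = run_length 1 ds then 1
     else list_tape m ds (Suc q))" using assms
proof (induction ds arbitrary: q)
  case (Cons d ds)
  then consider "d = 2" | "d = 1" "ds = []" | "d = 1" "ds \<noteq> []" by auto
  then show ?case
  proof cases
    case 1
    then show ?thesis by (cases q) simp_all
  next
    case 2
    then show ?thesis by simp
  next
    case 3
    show ?thesis
    proof (cases q)
      case 0
      with 3 show ?thesis by (cases "run_length 1 ds = length ds") simp_all
    next
      case (Suc q')
      then show ?thesis using Cons.IH[of q'] Cons.prems 3 by simp
    qed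
  qed
qed simp

section \<open>Tape programs for counter arithmetic\<close>

definition put_symbol :: "nat \<Rightarrow> nat \<Rightarrow> dir \<Rightarrow> ('i, 'o) cmd" where
  "put_symbol r v d = Prim (\<lambda>z sc. (Stay, (\<lambda>i. if i = r then Some (v, d) else None), None))"

definition move_on :: "nat \<Rightarrow> dir \<Rightarrow> ('i, 'o) cmd" where
  "move_on r d = Prim (\<lambda>z sc. (Stay, (\<lambda>i. if i = r then Some (sc r, d) else None), None))"

abbreviation sweep :: "nat \<Rightarrow> nat \<Rightarrow> nat \<Rightarrow> ('i, 'o) cmd" where
  "sweep r u v \<equiv> While (\<lambda>z sc. sc r = u) (put_symbol r v MoveR)"

abbreviation to_marker :: "nat \<Rightarrow> ('i, 'o) cmd" where
  "to_marker r \<equiv> While (\<lambda>z sc. sc r \<noteq> 3) (move_on r MoveL)"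

definition put :: "'o store \<Rightarrow> nat \<Rightarrow> (nat \<Rightarrow> nat) \<times> nat \<Rightarrow> 'o store" where
  "put s r tp = s\<lparr>tps := (tps s)(r := tp)\<rparr>"

lemma put_simps [simp]:
  "ihd (put s r tp) = ihd s" "outp (put s r tp) = outp s" "tps (put s r tp) r = tp"
  "put (put s r tp) r tp' = put s r tp'" "put s r (tps s r) = s" by (simp_all add: put_def)

lemma scan_put [simp]: "r < k \<Longrightarrow> scan k (put s r (f, h)) r = f h"
  by (simp add: scan_def)

lemma heads_le_put: "heads_le k B s \<Longrightarrow> snd tp \<le> B \<Longrightarrow> heads_le k B (put s r tp)"
  by (simp add: heads_le_def put_def)

definition inc_cmd :: "nat \<Rightarrow> ('i, 'o) cmd" where
  "inc_cmd r =
     Seq (sweep r 2 1)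
    (Seq (If (\<lambda>z sc. sc r = 1) (put_symbol r 2 Stay) (put_symbol r 1 Stay))
    (Seq (to_marker r)
         (move_on r MoveR)))"

definition dec_cmd :: "nat \<Rightarrow> ('i, 'o) cmd" where
  "dec_cmd r =
     Seq (sweep r 1 2)
    (Seq (If (\<lambda>z sc. sc r = 2) (put_symbol r 1 Stay) (Seq (move_on r MoveL) (put_symbol r 0 Stay)))
    (Seq (to_marker r)
         (move_on r MoveR)))"

section \<open>Executions within a time bound\<close>

definition takes ::
  "nat \<Rightarrow> nat \<Rightarrow> nat \<Rightarrow> 'i list \<Rightarrow> nat \<Rightarrow> ('i, 'o) cmd \<Rightarrow> 'o store \<Rightarrow> 'o store \<Rightarrow> bool" where
  "takes K k B x T c s s' \<longleftrightarrow> (\<exists>t\<le>T. exec K k B x c s t s')"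

lemma takes_mono: "takes K k B x T c s s' \<Longrightarrow> T \<le> T' \<Longrightarrow> takes K k B x T' c s s'"
  unfolding takes_def by (meson order_trans)

lemma takes_Skip: "heads_le k B s \<Longrightarrow> takes K k B x T Skip s s"
  unfolding takes_def using exec.Skip by blast

lemma takes_Prim:
  "heads_le k B s \<Longrightarrow> s' = act_store K x (f (input_at x (ihd s)) (scan k s)) s
    \<Longrightarrow> heads_le k B s' \<Longrightarrow> 1 \<le> T \<Longrightarrow> takes K k B x T (Prim f) s s'"
  unfolding takes_def using exec.Prim by blast

lemma takes_Seq:
  "takes K k B x T c s s1 \<Longrightarrow> takes K k B x U d s1 s2 \<Longrightarrow> T + U + 1 \<le> V \<Longrightarrow>
    takes K k B x V (Seq c d) s s2"
proof -
  assume "takes K k B x T c s s1" "takes K k B x U d s1 s2" and V: "T + U + 1 \<le> V"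
  then obtain t u where "t \<le> T" "exec K k B x c s t s1" "u \<le> U" "exec K k B x d s1 u s2"
    by (auto simp: takes_def)
  then have "exec K k B x (Seq c d) s (Suc (t + u)) s2" "Suc (t + u) \<le> V"
    using V by (auto intro: exec.Seq)
  then show ?thesis unfolding takes_def by blast
qed

lemma takes_IfT:
  "b (input_at x (ihd s)) (scan k s) \<Longrightarrow> takes K k B x T c s s1 \<Longrightarrow> T + 1 \<le> V \<Longrightarrow>
    takes K k B x V (If b c d) s s1"
  unfolding takes_def using exec.IfT by (metis Suc_eq_plus1 Suc_le_mono le_trans)

lemma takes_IfF:
  "\<not> b (input_at x (ihd s)) (scan k s) \<Longrightarrow> takes K k B x T d s s1 \<Longrightarrow> T + 1 \<le> V \<Longrightarrow>
    takes K k B x V (If b c d) s s1"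
  unfolding takes_def using exec.IfF by (metis Suc_eq_plus1 Suc_le_mono le_trans)

text \<open>The sequence \<open>f\<close> lists the stores at the successive tests. The induction is
  on the number of iterations still to come, because \<open>exec\<close> peels a loop off at its
  front.\<close>

lemma takes_While:
  assumes "\<And>i. i < n \<Longrightarrow> b (input_at x (ihd (f i))) (scan k (f i))"
    and "\<And>i. i < n \<Longrightarrow> takes K k B x T c (f i) (f (Suc i))"
    and "\<not> b (input_at x (ihd (f n))) (scan k (f n))" "heads_le k B (f n)"
    and "n * (T + 2) + 1 \<le> V"
  shows "takes K k B x V (While b c) (f 0) (f n)"
proof -
  have "takes K k B x (m * (T + 2) + 1) (While b c) (f (n - m)) (f n)" if "m \<le> n" for m using that
  proof (induction m)
    case 0
    then show ?case using assms(3,4) exec.WhileF unfolding takes_def by fastforce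
  next
    case (Suc m)
    then have n: "n - Suc m < n" "Suc (n - Suc m) = n - m" by auto
    obtain t u where "t \<le> T" "exec K k B x c (f (n - Suc m)) t (f (n - m))"
      "u \<le> m * (T + 2) + 1" "exec K k B x (While b c) (f (n - m)) u (f n)"
      using Suc assms(2)[OF n(1)] n(2) unfolding takes_def by auto
    then have "exec K k B x (While b c) (f (n - Suc m)) (t + u + 2) (f n)"
      using assms(1)[OF n(1)] exec.WhileT by metis
    then show ?case
      unfolding takes_def using \<open>t \<le> T\<close> \<open>u \<le> _\<close> by (intro exI[of _ "t + u + 2"]) simp
  qed
  from this[of n] show ?thesis using assms(5) by (simp add: takes_mono)
qed

locale tape_cmds =
  fixes K k B :: nat and x :: "'i list"
  assumes K: "3 < K"
begin

abbreviation timed :: "nat \<Rightarrow> ('i, 'o) cmd \<Rightarrow> 'o store \<Rightarrow> 'o store \<Rightarrow> bool" where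
  "timed \<equiv> takes K k B x"

lemma takes_put_symbol:
  assumes "r < k" "heads_le k B s" "h \<le> B" "move d h \<le> B" "v < K" "ihd s \<le> length x + 1" "g = f(h := v)"
  shows "timed 1 (put_symbol r v d) (put s r (f, h)) (put s r (g, move d h))"
  unfolding put_symbol_def
proof (rule takes_Prim)
  show "put s r (g, move d h) = act_store K x
     (Stay, \<lambda>i. if i = r then Some (v, d) else None, None) (put s r (f, h))"
    using assms by (auto simp: act_store_def put_def act_on_tape_def clip_def fun_eq_iff)
qed (use assms in \<open>auto intro: heads_le_put\<close>)

lemma takes_move_on:
  assumes "r < k" "heads_le k B s" "h \<le> B" "move d h \<le> B" "f h < K" "ihd s \<le> length x + 1"
  shows "timed 1 (move_on r d) (put s r (f, h)) (put s r (f, move d h))"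
  unfolding move_on_def
proof (rule takes_Prim)
  show "put s r (f, move d h) = act_store K x
     (Stay, \<lambda>i. if i = r then Some (scan k (put s r (f, h)) r, d) else None, None) (put s r (f, h))"
    using assms by (auto simp: act_store_def put_def act_on_tape_def clip_def fun_eq_iff scan_def)
qed (use assms in \<open>auto intro: heads_le_put\<close>)

lemma takes_sweep:
  assumes "r < k" "heads_le k B s" "h + n \<le> B" "v < K" "ihd s \<le> length x + 1"
    and "\<And>i. i < n \<Longrightarrow> f (h + i) = u" "f (h + n) \<noteq> u"
    and g: "g = (\<lambda>p. if h \<le> p \<and> p < h + n then v else f p)"
  shows "timed (3 * n + 1) (sweep r u v)
    (put s r (f, h)) (put s r (g, h + n))"
proof -
  let ?s = "\<lambda>i. put s r (\<lambda>p. if h \<le> p \<and> p < h + i then v else f p, h + i)"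
  have "timed (3 * n + 1) (sweep r u v) (?s 0) (?s n)"
  proof (rule takes_While[where T = 1])
    show "timed 1 (put_symbol r v MoveR) (?s i) (?s (Suc i))" if "i < n" for i
    proof -
      have "(\<lambda>p. if h \<le> p \<and> p < h + Suc i then v else f p) =
          (\<lambda>p. if h \<le> p \<and> p < h + i then v else f p)(h + i := v)" by (auto simp: fun_eq_iff)
      from takes_put_symbol[OF assms(1,2) _ _ assms(4,5) this, of MoveR] show ?thesis
        using that assms by simp
    qed
  qed (use assms in \<open>auto intro: heads_le_put\<close>)
  moreover have "(\<lambda>p. if h \<le> p \<and> p < h then v else f p) = f" by (auto simp: fun_eq_iff)
  ultimately show ?thesis by (simp add: g)
qed

lemma takes_rewind:
  assumes "r < k" "heads_le k B s" "h \<le> B" "ihd s \<le> length x + 1"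
    and "f 0 = 3" "\<And>p. 0 < p \<Longrightarrow> p \<le> h \<Longrightarrow> f p < 3"
  shows "timed (3 * h + 1) (to_marker r)
    (put s r (f, h)) (put s r (f, 0))"
proof -
  let ?s = "\<lambda>i. put s r (f, h - i)"
  have "timed (3 * h + 1) (to_marker r) (?s 0) (?s h)"
  proof (rule takes_While[where T = 1])
    fix i assume i: "i < h"
    then have f: "f (h - i) < 3" using assms(6) by simp
    then show "scan k (?s i) r \<noteq> 3" using assms(1) by simp
    show "timed 1 (move_on r MoveL) (?s i) (?s (Suc i))"
      using takes_move_on[of r s "h - i" MoveL f] assms K f by (simp flip: Suc_eq_plus1)
  qed (use assms in \<open>auto intro: heads_le_put\<close>)
  then show ?thesis by simp
qed

lemma nth_digit:
  assumes "set ds \<subseteq> {1, 2}" "q < length ds"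
  shows "ds ! q = 1 \<or> ds ! q = 2"
  using assms nth_mem by blast

lemma list_tape_digits_lt:
  assumes "set ds \<subseteq> {1, 2}" "0 < p"
  shows "list_tape m ds p < 3"
proof (cases p)
  case (Suc q)
  then show ?thesis using assms nth_digit[of ds q] by (auto simp: list_tape_def)
qed (use assms in simp)

lemma takes_inc:
  assumes "r < k" "heads_le k B s" "length ds + 2 \<le> B" "ihd s \<le> length x + 1"
    and ds: "set ds \<subseteq> {1, 2}"
  shows "timed (6 * B + 20) (inc_cmd r) (put s r (list_tape 3 ds, 1))
    (put s r (list_tape 3 (digits_inc ds), 1))"
proof -
  let ?n = "run_length 2 ds"
  define f where "f p = (if 1 \<le> p \<and> p < 1 + ?n then 1 else list_tape 3 ds p)" for p
  define g where "g = list_tape 3 (digits_inc ds)"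
  have n: "?n \<le> length ds" by (rule run_length_le)
  have 1: "timed (3 * ?n + 1) (sweep r 2 1)
    (put s r (list_tape 3 ds, 1)) (put s r (f, 1 + ?n))"
  proof (rule takes_sweep)
    show "list_tape 3 ds (1 + i) = 2" if "i < ?n" for i
      using that n nth_run_length[of i 2 ds] by (simp add: list_tape_Suc)
    show "list_tape 3 ds (1 + ?n) \<noteq> 2"
      using nth_after_run_length[of 2 ds] by (simp add: list_tape_Suc)
    show "f = (\<lambda>p. if 1 \<le> p \<and> p < 1 + ?n then 1 else list_tape 3 ds p)"
      by (simp add: f_def fun_eq_iff)
  qed (use assms n K in auto)
  \<comment> \<open>The run of 2s is maximal, so the sweep stops on a 1 or on the blank behind the
    numeral.\<close>
  have f: "f (1 + ?n) = (if ?n < length ds then 1 else 0)"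
    using nth_after_run_length[of 2 ds] nth_digit[of ds ?n] ds by (auto simp: list_tape_Suc f_def)
  have g: "g = f(1 + ?n := if ?n < length ds then 2 else 1)"
  proof
    fix p show "g p = (f(1 + ?n := if ?n < length ds then 2 else 1)) p"
      by (cases p) (auto simp: list_tape_inc[OF ds] f_def g_def)
  qed
  have 2: "timed 2 (If (\<lambda>z sc. sc r = 1) (put_symbol r 2 Stay) (put_symbol r 1 Stay))
    (put s r (f, 1 + ?n)) (put s r (g, 1 + ?n))"
  proof (cases "?n < length ds")
    case True
    have "timed 1 (put_symbol r 2 Stay) (put s r (f, 1 + ?n)) (put s r (g, move Stay (1 + ?n)))"
      by (rule takes_put_symbol) (use assms n K True in \<open>auto simp: g\<close>)
    then show ?thesis using assms(1) f True by (intro takes_IfT[where T = 1]) simp_all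
  next
    case False
    have "timed 1 (put_symbol r 1 Stay) (put s r (f, 1 + ?n)) (put s r (g, move Stay (1 + ?n)))"
      by (rule takes_put_symbol) (use assms n K False in \<open>auto simp: g\<close>)
    then show ?thesis using assms(1) f False by (intro takes_IfF[where T = 1]) simp_all
  qed
  have 3: "timed (3 * (1 + ?n) + 1) (to_marker r)
     (put s r (g, 1 + ?n)) (put s r (g, 0))"
    using assms n list_tape_digits_lt[OF digits_inc_set[OF ds]]
    by (intro takes_rewind) (auto simp: g_def)
  have 4: "timed 1 (move_on r MoveR) (put s r (g, 0)) (put s r (g, 1))"
    using takes_move_on[of r s 0 MoveR g] assms K by (simp add: g_def One_nat_def)
  note 34 = takes_Seq[OF 3 4 order_refl]
  note 234 = takes_Seq[OF 2 34 order_refl]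
  show ?thesis unfolding inc_cmd_def g_def[symmetric]
    by (rule takes_Seq[OF 1 234]) (use n assms(3) in simp)
qed

lemma takes_dec:
  assumes "r < k" "heads_le k B s" "length ds + 2 \<le> B" "ihd s \<le> length x + 1"
    and ds: "set ds \<subseteq> {1, 2}" "ds \<noteq> []"
  shows "timed (6 * B + 20) (dec_cmd r) (put s r (list_tape 3 ds, 1))
    (put s r (list_tape 3 (digits_dec ds), 1))"
proof -
  let ?n = "run_length 1 ds"
  \<comment> \<open>Position of the head after the correction: on the 2 that was lowered, or, if all
    digits were 1, one cell back on the last digit, which has been erased.\<close>
  let ?h = "if ?n < length ds then 1 + ?n else ?n"
  define f where "f p = (if 1 \<le> p \<and> p < 1 + ?n then 2 else list_tape 3 ds p)" for p
  define g where "g = list_tape 3 (digits_dec ds)"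
  have n: "?n \<le> length ds" by (rule run_length_le)
  have n0: "0 < ?h" using ds n by (cases "?n < length ds") auto
  have 1: "timed (3 * ?n + 1) (sweep r 1 2)
    (put s r (list_tape 3 ds, 1)) (put s r (f, 1 + ?n))"
  proof (rule takes_sweep)
    show "list_tape 3 ds (1 + i) = 1" if "i < ?n" for i
      using that n nth_run_length[of i 1 ds] by (simp add: list_tape_Suc)
    show "list_tape 3 ds (1 + ?n) \<noteq> 1"
      using nth_after_run_length[of 1 ds] by (simp add: list_tape_Suc)
    show "f = (\<lambda>p. if 1 \<le> p \<and> p < 1 + ?n then 2 else list_tape 3 ds p)"
      by (simp add: f_def fun_eq_iff)
  qed (use assms n K in auto)
  have f: "f (1 + ?n) = (if ?n < length ds then 2 else 0)"
    using nth_after_run_length[of 1 ds] nth_digit[of ds ?n] ds by (auto simp: list_tape_Suc f_def)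
  have g: "g = f(?h := if ?n < length ds then 1 else 0)"
  proof
    fix p show "g p = (f(?h := if ?n < length ds then 1 else 0)) p"
      using n0 n by (cases p) (auto simp: list_tape_dec[OF ds] f_def g_def
        list_tape_Suc[of 3 ds, unfolded One_nat_def plus_nat.add_Suc plus_nat.add_0])
  qed
  have 2: "timed 4
      (If (\<lambda>z sc. sc r = 2) (put_symbol r 1 Stay) (Seq (move_on r MoveL) (put_symbol r 0 Stay)))
     (put s r (f, 1 + ?n)) (put s r (g, ?h))"
  proof (cases "?n < length ds")
    case True
    have "timed 1 (put_symbol r 1 Stay) (put s r (f, 1 + ?n)) (put s r (g, move Stay (1 + ?n)))"
      by (rule takes_put_symbol) (use assms n K True in \<open>auto simp: g\<close>)
    then show ?thesis using assms(1) f True by (intro takes_IfT[where T = 1]) simp_all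
  next
    case False
    have "timed 3 (Seq (move_on r MoveL) (put_symbol r 0 Stay))
       (put s r (f, 1 + ?n)) (put s r (g, ?n))"
    proof (rule takes_Seq[where T = 1 and U = 1])
      show "timed 1 (move_on r MoveL) (put s r (f, 1 + ?n)) (put s r (f, ?n))"
        using takes_move_on[of r s "1 + ?n" MoveL f] assms n K f False by (simp del: One_nat_def)
      show "timed 1 (put_symbol r 0 Stay) (put s r (f, ?n)) (put s r (g, ?n))"
        using takes_put_symbol[of r s "?n" Stay 0 g f] assms n K False by (simp add: g)
    qed simp
    then show ?thesis using assms(1) f False by (intro takes_IfF[where T = 3]) simp_all
  qed
  have 3: "timed (3 * ?h + 1) (to_marker r)
     (put s r (g, ?h)) (put s r (g, 0))"
  proof (rule takes_rewind)
    show "g p < 3" if "0 < p" for p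
      using list_tape_digits_lt[OF ds(1) that, of 3] unfolding g f_def by auto
  qed (use assms n in \<open>auto simp: g_def\<close>)
  have 4: "timed 1 (move_on r MoveR) (put s r (g, 0)) (put s r (g, 1))"
    using takes_move_on[of r s 0 MoveR g] assms K by (simp add: g_def One_nat_def)
  note 34 = takes_Seq[OF 3 4 order_refl]
  note 234 = takes_Seq[OF 2 34 order_refl]
  have "?h \<le> length ds + 1" using n by simp
  then show ?thesis unfolding dec_cmd_def g_def[symmetric]
    by (intro takes_Seq[OF 1 234]) (use n assms(3) in simp)
qed

end

section \<open>Counters, registers and simulated tapes\<close>

declare One_nat_def [simp]

record 'o ast =
  pos :: nat
  vl :: "nat \<Rightarrow> nat"
  mt :: "nat \<Rightarrow> (nat \<Rightarrow> nat) \<times> nat \<times> nat"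
  wr :: "'o list"

definition setv :: "nat \<Rightarrow> nat \<Rightarrow> 'o ast \<Rightarrow> 'o ast" where
  "setv r v a = a\<lparr>vl := (vl a)(r := v)\<rparr>"

lemma setv_simps [simp]:
  "pos (setv r v a) = pos a" "mt (setv r v a) = mt a" "wr (setv r v a) = wr a"
  "vl (setv r v a) i = (if i = r then v else vl a i)"
  "setv r v (setv r w a) = setv r v a"
  "setv r v (a\<lparr>pos := p\<rparr>) = (setv r v a)\<lparr>pos := p\<rparr>"
  "setv r v (a\<lparr>mt := q\<rparr>) = (setv r v a)\<lparr>mt := q\<rparr>"
  "setv r v (a\<lparr>wr := u\<rparr>) = (setv r v a)\<lparr>wr := u\<rparr>" by (simp_all add: setv_def)

lemma setv_id: "vl a r = v \<Longrightarrow> setv r v a = a"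
  by (auto simp: setv_def)

lemma setv_commute: "r \<noteq> r' \<Longrightarrow> setv r v (setv r' w a) = setv r' w (setv r v a)"
  by (simp add: setv_def fun_upd_twist)

text \<open>The triple consists of the contents of a tape, the head position and the number of cells visited so
  far.  Cell 0 of the real tape holds a left marker, and a symbol \<open>v\<close> is stored as \<open>v + 2\<close>,
  so that visited cells are never blank and the tape can be erased after a simulation.\<close>

definition mtape :: "(nat \<Rightarrow> nat) \<times> nat \<times> nat \<Rightarrow> (nat \<Rightarrow> nat) \<times> nat" where
  "mtape q = (case q of (f, h, m) \<Rightarrow>
     (\<lambda>p. case p of 0 \<Rightarrow> 1 | Suc i \<Rightarrow> if i < m then f i + 2 else 0, Suc h))"

definition nonzero :: "nat \<Rightarrow> 'i input_cell \<Rightarrow> (nat \<Rightarrow> nat) \<Rightarrow> bool" where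
  "nonzero r z sc \<longleftrightarrow> sc r \<noteq> 0"

text \<open>\<open>V\<close> counts down while \<open>T\<close> counts up, so the body sees the index in \<open>T\<close>, and no copy of the bound is
  needed: afterwards \<open>T\<close> is moved back to \<open>V\<close>.\<close>

definition for_cmd :: "nat \<Rightarrow> nat \<Rightarrow> ('i, 'o) cmd \<Rightarrow> ('i, 'o) cmd" where
  "for_cmd V T c =
     Seq (While (nonzero V) (Seq c (Seq (dec_cmd V) (inc_cmd T))))
         (While (nonzero T) (Seq (dec_cmd T) (inc_cmd V)))"

definition set_reg :: "nat \<Rightarrow> ('i input_cell \<Rightarrow> (nat \<Rightarrow> nat) \<Rightarrow> nat) \<Rightarrow> ('i, 'o) cmd" where
  "set_reg r g = Prim (\<lambda>z sc. (Stay, (\<lambda>i. if i = r then Some (g z sc, Stay) else None), None))"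

abbreviation assign :: "nat \<Rightarrow> nat \<Rightarrow> ('i, 'o) cmd" where
  "assign r v \<equiv> set_reg r (\<lambda>_ _. v)"

definition move_head :: "dir \<Rightarrow> ('i, 'o) cmd" where
  "move_head d = Prim (\<lambda>z sc. (d, (\<lambda>_. None), None))"

definition emit_out :: "('i input_cell \<Rightarrow> (nat \<Rightarrow> nat) \<Rightarrow> 'o) \<Rightarrow> ('i, 'o) cmd" where
  "emit_out g = Prim (\<lambda>z sc. (Stay, (\<lambda>_. None), Some (g z sc)))"

definition clear_cmd :: "nat \<Rightarrow> ('i, 'o) cmd" where
  "clear_cmd r = While (nonzero r) (dec_cmd r)"

text \<open>Tapes below \<open>nC\<close> are counters, those from \<open>nC\<close> up to
  \<open>nV\<close> registers, the others simulated tapes. \<open>N\<close> bounds the counter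
  values and \<open>B\<close> the head positions. \<open>Z\<close> bounds both the cost
  \<open>6 * B + 20\<close> of a counter operation and, via \<open>N\<close>, the number of
  iterations of a loop driven by a counter.\<close>

locale vm = tape_cmds K k B x for K k B and x :: "'i list" +
  fixes nC nV N Z :: nat
  assumes nC: "nC \<le> nV" and nV: "nV \<le> k"
    and digits_fit: "n \<le> N \<Longrightarrow> length (digits n) + 2 \<le> B"
    and Z: "6 * B + 20 \<le> Z" and NZ: "N \<le> Z"
begin

definition conc :: "'o ast \<Rightarrow> 'o store" where
  "conc a = \<lparr>ihd = pos a,
     tps = (\<lambda>i. if i < nC then (list_tape 3 (digits (vl a i)), 1)
             else if i < nV then (list_tape (vl a i) [], 0)
             else mtape (mt a (i - nV))),
     outp = wr a\<rparr>"

text \<open>The head may stand on the first unvisited cell, hence \<open>h \<le> m\<close>; the real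
  head is one cell further right, hence \<open>m < B\<close>. Unvisited cells contain the symbol 0,
  in agreement with a blank real cell.\<close>

definition mt_ok :: "(nat \<Rightarrow> nat) \<times> nat \<times> nat \<Rightarrow> bool" where
  "mt_ok q = (case q of (f, h, m) \<Rightarrow>
     h \<le> m \<and> m < B \<and> (\<forall>i<m. f i + 2 < K) \<and> (\<forall>i\<ge>m. f i = 0))"

definition ok :: "'o ast \<Rightarrow> bool" where
  "ok a \<longleftrightarrow> pos a \<le> length x + 1 \<and> (\<forall>i<nC. vl a i \<le> N) \<and>
     (\<forall>j<k - nV. mt_ok (mt a j))"

text \<open>Running times are bounded by powers of \<open>Z\<close>.  As \<open>Z\<close> exceeds every counter, composition and loops
  just increase the exponent.\<close>

definition does :: "nat \<Rightarrow> ('i, 'o) cmd \<Rightarrow> 'o ast \<Rightarrow> 'o ast \<Rightarrow> bool" where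
  "does j c a a' \<longleftrightarrow> (ok a \<longrightarrow> ok a' \<and> timed (Z ^ j) c (conc a) (conc a'))"

abbreviation cond :: "('i input_cell \<Rightarrow> (nat \<Rightarrow> nat) \<Rightarrow> bool) \<Rightarrow> 'o ast \<Rightarrow> bool" where
  "cond b a \<equiv> b (input_at x (pos a)) (scan k (conc a))"

lemma ihd_conc [simp]: "ihd (conc a) = pos a"
  by (simp add: conc_def)

lemma B2: "2 \<le> B"
  using digits_fit[of 0] by simp

lemma heads_le_conc: "ok a \<Longrightarrow> heads_le k B (conc a)"
proof -
  assume ok: "ok a"
  have "snd (tps (conc a) i) \<le> B" if "i < k" for i
  proof (cases "i < nV")
    case True
    then show ?thesis using B2 by (simp add: conc_def)
  next
    case False
    then have "mt_ok (mt a (i - nV))" using ok that by (auto simp: ok_def)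
    then have "fst (snd (mt a (i - nV))) < B" by (auto simp: mt_ok_def)
    then show ?thesis using False nC by (simp add: conc_def mtape_def Suc_le_eq case_prod_beta)
  qed
  then show ?thesis by (simp add: heads_le_def)
qed

lemma Z_ge: "20 \<le> Z"
  using Z by simp

lemma Z_power: "i \<le> j \<Longrightarrow> Z ^ i \<le> Z ^ j"
  using Z_ge by (intro power_increasing) auto

lemma does_mono: "does i c a a' \<Longrightarrow> i \<le> j \<Longrightarrow> does j c a a'"
  unfolding does_def using takes_mono Z_power by blast

lemma does_Skip: "does j Skip a a"
  unfolding does_def using takes_Skip heads_le_conc by blast

text \<open>As \<open>Z\<close> is at least 3, two runs of cost \<open>Z ^ (l - 1)\<close> and one
  extra step fit into \<open>Z ^ l\<close>.\<close>

lemma does_Seq: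
  assumes "does i c a b" "does j d b e" "i < l" "j < l"
  shows "does l (Seq c d) a e"
proof -
  have "does (l - 1) c a b" "does (l - 1) d b e"
    using does_mono[OF assms(1)] does_mono[OF assms(2)] assms(3,4) by simp_all
  moreover have "Z ^ (l - 1) + Z ^ (l - 1) + 1 \<le> Z ^ l"
  proof -
    have "Z ^ (l - 1) * 3 \<le> Z ^ (l - 1) * Z" using Z_ge by (intro mult_le_mono) auto
    moreover have "Z ^ (l - 1) * Z = Z ^ l" using assms(3) power_minus_mult[of l Z] by simp
    moreover have "0 < Z ^ (l - 1)" using Z_ge by simp
    ultimately show ?thesis by linarith
  qed
  ultimately show ?thesis unfolding does_def using takes_Seq by blast
qed

lemma power_Suc_bound: "i < l \<Longrightarrow> Z ^ i + 1 \<le> Z ^ l"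
proof -
  assume "i < l"
  then have "Z ^ i * 2 \<le> Z ^ Suc i" "Z ^ Suc i \<le> Z ^ l" "0 < Z ^ i"
    using Z_ge Z_power[of "Suc i" l] by auto
  then show ?thesis by linarith
qed

lemma does_IfT:
  assumes "cond b a" "does i c a a'" "i < l"
  shows "does l (If b c d) a a'"
  unfolding does_def
proof (intro impI conjI)
  assume ok: "ok a"
  show "ok a'" using ok assms(2) by (simp add: does_def)
  show "timed (Z ^ l) (If b c d) (conc a) (conc a')" using ok assms power_Suc_bound[OF assms(3)]
    by (intro takes_IfT[where T = "Z ^ i"]) (simp_all add: does_def)
qed

lemma does_IfF:
  assumes "\<not> cond b a" "does i d a a'" "i < l"
  shows "does l (If b c d) a a'"
  unfolding does_def
proof (intro impI conjI)
  assume ok: "ok a"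
  show "ok a'" using ok assms(2) by (simp add: does_def)
  show "timed (Z ^ l) (If b c d) (conc a) (conc a')" using ok assms power_Suc_bound[OF assms(3)]
    by (intro takes_IfF[where T = "Z ^ i"]) (simp_all add: does_def)
qed

lemma does_If:
  assumes "cond b a \<Longrightarrow> does i c a a'" "\<not> cond b a \<Longrightarrow> does i d a a'" "i < l"
  shows "does l (If b c d) a a'"
  using assms does_IfT does_IfF by blast

text \<open>One additional exponent pays for up to \<open>Z\<close> iterations, a second one for the
  constant overhead.\<close>

lemma does_While:
  assumes "\<And>i. i < n \<Longrightarrow> cond b (f i)"
    and "\<And>i. i < n \<Longrightarrow> does j c (f i) (f (Suc i))"
    and "\<not> cond b (f n)" "n \<le> Z" "j + 1 < l"
  shows "does l (While b c) (f 0) (f n)"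
  unfolding does_def
proof (intro impI)
  assume ok0: "ok (f 0)"
  have ok: "ok (f i)" if "i \<le> n" for i
    using that by (induction i) (use ok0 assms(2) in \<open>auto simp: does_def\<close>)
  have "timed (Z ^ l) (While b c) (conc (f 0)) (conc (f n))"
  proof (rule takes_While[where f = "\<lambda>i. conc (f i)" and T = "Z ^ j"])
    show "timed (Z ^ j) c (conc (f i)) (conc (f (Suc i)))" if "i < n" for i
      using assms(2)[OF that] ok[of i] that by (simp add: does_def)
    have "n * (Z ^ j + 2) + 1 \<le> Z * (Z ^ j + 2) + 1"
      using assms(4) by (intro add_mono mult_le_mono) auto
    also have "\<dots> \<le> Z ^ (j + 1) * 4"
    proof -
      have "Z * (Z ^ j + 2) + 1 = Z ^ (j + 1) + 2 * Z + 1" by (simp add: algebra_simps)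
      moreover have "Z \<le> Z ^ (j + 1)" "1 \<le> Z" using Z_power[of 1 "j + 1"] Z_ge by auto
      ultimately show ?thesis by linarith
    qed
    also have "\<dots> \<le> Z ^ (j + 1) * Z" using Z_ge by (intro mult_le_mono) auto
    also have "\<dots> \<le> Z ^ l"
      using Z_power[of "j + 2" l] assms(5) by (simp add: numeral_2_eq_2 algebra_simps)
    finally show "n * (Z ^ j + 2) + 1 \<le> Z ^ l" .
  qed (use assms ok heads_le_conc in auto)
  then show "ok (f n) \<and> timed (Z ^ l) (While b c) (conc (f 0)) (conc (f n))" using ok by simp
qed

section \<open>Counter, register and head operations on abstract states\<close>

lemma conc_setv_counter:
  assumes "r < nC"
  shows "conc (setv r v a) = put (conc a) r (list_tape 3 (digits v), 1)"
  using assms by (auto simp: conc_def put_def fun_eq_iff)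

lemma does_inc:
  assumes "r < nC" "vl a r < N"
  shows "does 1 (inc_cmd r) a (setv r (vl a r + 1) a)"
  unfolding does_def
proof (intro impI conjI)
  assume ok: "ok a"
  show "ok (setv r (vl a r + 1) a)" using ok assms by (auto simp: ok_def)
  have "conc a = put (conc a) r (list_tape 3 (digits (vl a r)), 1)"
    using conc_setv_counter[OF assms(1), of "vl a r" a] by (simp add: setv_id)
  moreover have "length (digits (vl a r)) + 2 \<le> B" using assms by (intro digits_fit) simp
  ultimately have "timed (6 * B + 20) (inc_cmd r) (conc a) (conc (setv r (vl a r + 1) a))"
    using takes_inc[of r "conc a" "digits (vl a r)"] assms nC nV ok heads_le_conc[OF ok] digits_set
      conc_setv_counter[OF assms(1), of "vl a r + 1" a] by (simp add: ok_def)
  then show "timed (Z ^ 1) (inc_cmd r) (conc a) (conc (setv r (vl a r + 1) a))"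
    using takes_mono Z by simp
qed

lemma does_dec:
  assumes "r < nC" "0 < vl a r"
  shows "does 1 (dec_cmd r) a (setv r (vl a r - 1) a)"
  unfolding does_def
proof (intro impI conjI)
  assume ok: "ok a"
  show "ok (setv r (vl a r - 1) a)" using ok assms by (fastforce simp: ok_def)
  have "conc a = put (conc a) r (list_tape 3 (digits (vl a r)), 1)"
    using conc_setv_counter[OF assms(1), of "vl a r" a] by (simp add: setv_id)
  moreover have "length (digits (vl a r)) + 2 \<le> B"
    using assms ok by (intro digits_fit) (simp add: ok_def)
  ultimately have "timed (6 * B + 20) (dec_cmd r) (conc a) (conc (setv r (vl a r - 1) a))"
    using takes_dec[of r "conc a" "digits (vl a r)"] assms nC nV ok heads_le_conc[OF ok] digits_set
      conc_setv_counter[OF assms(1), of "vl a r - 1" a] by (simp add: ok_def digits_dec)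
  then show "timed (Z ^ 1) (dec_cmd r) (conc a) (conc (setv r (vl a r - 1) a))"
    using takes_mono Z by simp
qed

lemma cond_nonzero: "r < nC \<Longrightarrow> nonzero r z (scan k (conc a)) \<longleftrightarrow> vl a r \<noteq> 0"
  using nC nV nth_digit[OF digits_set[of "vl a r"], of 0]
  by (auto simp: nonzero_def scan_def conc_def list_tape_def)

lemma scan_reg: "nC \<le> r \<Longrightarrow> r < nV \<Longrightarrow> scan k (conc a) r = vl a r"
  using nV by (auto simp: scan_def conc_def)

lemma does_Prim:
  assumes "ok a \<Longrightarrow> ok a'"
    and "ok a \<Longrightarrow> conc a' = act_store K x (f (input_at x (pos a)) (scan k (conc a))) (conc a)"
  shows "does j (Prim f) a a'"
    unfolding does_def
proof (intro impI conjI)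
  assume ok: "ok a"
  then show "ok a'" by (rule assms)
  then show "timed (Z ^ j) (Prim f) (conc a) (conc a')"
    using assms(2)[OF ok] heads_le_conc[OF ok] heads_le_conc[of a'] Z_power[of 0 j]
    by (intro takes_Prim) simp_all
qed

lemma does_set_reg:
  assumes "nC \<le> r" "r < nV" "g (input_at x (pos a)) (scan k (conc a)) = v" "v < K"
  shows "does j (set_reg r g) a (setv r v a)"
  unfolding set_reg_def
proof (rule does_Prim)
  assume ok: "ok a"
  then show "ok (setv r v a)" using assms by (auto simp: ok_def)
  have "(list_tape u [])(0 := v) = list_tape v []" for u
    by (auto simp: list_tape_def fun_eq_iff split: nat.split)
  then show "conc (setv r v a) = act_store K x (Stay, \<lambda>i. if i = r
      then Some (g (input_at x (pos a)) (scan k (conc a)), Stay) else None, None) (conc a)"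
    using assms ok
    by (auto simp: conc_def act_store_def act_on_tape_def clip_def fun_eq_iff ok_def)
qed

lemma does_move_head:
  "does j (move_head d) a (a\<lparr>pos := min (length x + 1) (move d (pos a))\<rparr>)" unfolding move_head_def
  by (rule does_Prim) (auto simp: ok_def conc_def act_store_def)

lemma does_emit_out:
  "does j (emit_out g) a (a\<lparr>wr := wr a @ [g (input_at x (pos a)) (scan k (conc a))]\<rparr>)"
  unfolding emit_out_def by (rule does_Prim) (auto simp: ok_def conc_def act_store_def)

lemma does_clear:
  assumes "r < nC"
  shows "does 3 (clear_cmd r) a (setv r 0 a)"
\<comment> \<open>Outside \<open>ok\<close> states the claim is vacuous; inside, \<open>ok\<close>
  bounds the number of iterations by \<open>N\<close>, hence by \<open>Z\<close>.\<close>
proof (cases "ok a")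
  case True
  have "does 3 (clear_cmd r) (setv r (vl a r - 0) a) (setv r (vl a r - vl a r) a)"
    unfolding clear_cmd_def
  proof (rule does_While[where j = 1])
    show "does 1 (dec_cmd r) (setv r (vl a r - i) a) (setv r (vl a r - Suc i) a)"
      if "i < vl a r" for i using does_dec[OF assms(1), of "setv r (vl a r - i) a"] that by simp
    show "vl a r \<le> Z" using True NZ assms by (meson ok_def order_trans)
  qed (use assms in \<open>auto simp: cond_nonzero\<close>)
  then show ?thesis by (simp add: setv_id)
qed (simp add: does_def)

text \<open>The states \<open>f i\<close> describe the effect of the body as if the loop left its
  counters alone, while the body really runs with \<open>V = n - i\<close> and \<open>T = i\<close>.
  Since both are restored in the end, the index of an outer loop can serve as the bound of an inner
  one, which is how a clause is located.\<close>

lemma does_for: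
  assumes VT: "V < nC" "T < nC" "V \<noteq> T" and n: "n \<le> N"
    and f: "\<And>i. i \<le> n \<Longrightarrow> vl (f i) V = n \<and> vl (f i) T = 0"
    and body: "\<And>i. i < n \<Longrightarrow> does j c (setv V (n - i) (setv T i (f i)))
                                     (setv V (n - i) (setv T i (f (Suc i))))"
    and l: "j + 4 < l" "2 < j"
  shows "does l (for_cmd V T c) (f 0) (f n)"
proof -
  let ?s = "\<lambda>i. setv V (n - i) (setv T i (f i))"
  let ?r = "\<lambda>i. setv V i (setv T (n - i) (f n))"
  have 1: "does (j + 4) (While (nonzero V) (Seq c (Seq (dec_cmd V) (inc_cmd T)))) (?s 0) (?s n)"
  proof (rule does_While[where j = "j + 2"])
    fix i assume i: "i < n"
    show "does (j + 2) (Seq c (Seq (dec_cmd V) (inc_cmd T))) (?s i) (?s (Suc i))"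
    proof (rule does_Seq[OF body[OF i]])
      let ?a = "setv V (n - i) (setv T i (f (Suc i)))"
      let ?b = "setv V (n - Suc i) (setv T i (f (Suc i)))"
      have "does 1 (dec_cmd V) ?a ?b" using does_dec[of V ?a] VT i by simp
      moreover have "does 1 (inc_cmd T) ?b (?s (Suc i))"
        using does_inc[of T ?b] VT i n by (simp add: setv_commute[of T V])
      ultimately show "does (j + 1) (Seq (dec_cmd V) (inc_cmd T)) ?a (?s (Suc i))"
        using l by (intro does_Seq[where i = 1 and j = 1]) simp_all
    qed (use l in auto)
  qed (use VT n NZ in \<open>auto simp: cond_nonzero\<close>)
  have 2: "does (j + 4) (While (nonzero T) (Seq (dec_cmd T) (inc_cmd V))) (?r 0) (?r n)"
  proof (rule does_While[where j = 2])
    fix i assume i: "i < n"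
    let ?b = "setv V i (setv T (n - Suc i) (f n))"
    have "does 1 (dec_cmd T) (?r i) ?b"
      using does_dec[of T "?r i"] VT i by (simp add: setv_commute[of T V])
    moreover have "does 1 (inc_cmd V) ?b (?r (Suc i))" using does_inc[of V ?b] VT i n by simp
    ultimately show "does 2 (Seq (dec_cmd T) (inc_cmd V)) (?r i) (?r (Suc i))"
      by (intro does_Seq[where i = 1 and j = 1]) simp_all
  qed (use VT n NZ l in \<open>auto simp: cond_nonzero\<close>)
  have "?s 0 = f 0" "?r n = f n" "?s n = ?r 0" using f[of 0] f[of n] by (auto simp: setv_id)
  then show ?thesis
    using does_Seq[of "j + 4" _ "?s 0" "?s n" "j + 4" _ "?r n" l] 1 2 l unfolding for_cmd_def by simp
qed

end

section \<open>Literals and their positions in an encoded formula\<close>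

fun neg_lit :: "literal \<Rightarrow> literal" where
  "neg_lit (Pos v) = Neg v"
| "neg_lit (Neg v) = Pos v"

definition clause_code :: "literal list \<Rightarrow> cnf_sym list" where
  "clause_code C = concat (map encode_literal C)"

text \<open>As input position 0 is the left endmarker, this is the cell just before clause
  \<open>c\<close>: the left endmarker itself for \<open>c = 0\<close>, otherwise the
  \<open>EndClause\<close> of the preceding clause.\<close>

definition clause_pos :: "cnf \<Rightarrow> nat \<Rightarrow> nat" where
  "clause_pos \<phi> c = length (encode_cnf (take c \<phi>))"

text \<open>A clause with a single literal has it in both slots and so acts like the disjunction of
  that literal with itself.\<close>

definition slot :: "cnf \<Rightarrow> nat \<Rightarrow> nat \<Rightarrow> literal" where
  "slot \<phi> c s = (if s = 0 then hd (\<phi> ! c) else last (\<phi> ! c))"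

text \<open>The last literal is located backwards from the end of its clause; in this way clauses of
  one and of two literals are treated alike.\<close>

definition slot_pos :: "cnf \<Rightarrow> nat \<Rightarrow> nat \<Rightarrow> nat" where
  "slot_pos \<phi> c s = (if s = 0 then clause_pos \<phi> c + 1
     else clause_pos \<phi> (Suc c) - length (encode_literal (slot \<phi> c s)))"

lemma encode_cnf_Cons: "encode_cnf (C # \<phi>) = clause_code C @ EndClause # encode_cnf \<phi>"
  by (simp add: encode_cnf_def clause_code_def)

lemma encode_cnf_append: "encode_cnf (\<phi> @ \<psi>) = encode_cnf \<phi> @ encode_cnf \<psi>"
  by (simp add: encode_cnf_def)

lemma encode_cnf_split:
  assumes "c < length \<phi>"
  shows "encode_cnf \<phi> =
    encode_cnf (take c \<phi>) @ clause_code (\<phi> ! c) @ EndClause # encode_cnf (drop (Suc c) \<phi>)"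
  by (subst id_take_nth_drop[OF assms]) (simp only: encode_cnf_append encode_cnf_Cons append_assoc)

lemma clause_pos_0 [simp]: "clause_pos \<phi> 0 = 0"
  by (simp add: clause_pos_def encode_cnf_def)

lemma clause_pos_Suc:
  assumes "c < length \<phi>"
  shows "clause_pos \<phi> (Suc c) = clause_pos \<phi> c + length (clause_code (\<phi> ! c)) + 1"
  using assms by (simp add: clause_pos_def take_Suc_conv_app_nth encode_cnf_append encode_cnf_def clause_code_def)

lemma clause_pos_le:
  assumes "c \<le> length \<phi>"
  shows "clause_pos \<phi> c \<le> length (encode_cnf \<phi>)"
proof -
  have "encode_cnf \<phi> = encode_cnf (take c \<phi>) @ encode_cnf (drop c \<phi>)"
    by (simp flip: encode_cnf_append)
  then show ?thesis by (simp add: clause_pos_def)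
qed

lemma length_le_encode_cnf: "length \<phi> \<le> length (encode_cnf \<phi>)"
  by (induction \<phi>) (auto simp: encode_cnf_Cons encode_cnf_def)

lemma EndClause_notin_literal: "EndClause \<notin> set (encode_literal l)"
  by (cases l) auto

lemma EndClause_notin_clause: "EndClause \<notin> set (clause_code C)"
  using EndClause_notin_literal by (auto simp: clause_code_def)

lemma input_at_append:
  "input_at (u @ v) (length u + 1 + i) = (if i < length v then Letter (v ! i) else RightEnd)"
  by (auto simp: input_at_def nth_append)

lemma input_at_clause:
  assumes "c < length \<phi>"
  shows "i < length (clause_code (\<phi> ! c)) \<Longrightarrow>
      input_at (encode_cnf \<phi>) (clause_pos \<phi> c + 1 + i) = Letter (clause_code (\<phi> ! c) ! i)"
    and "input_at (encode_cnf \<phi>) (clause_pos \<phi> (Suc c)) = Letter EndClause"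
proof -
  note s = encode_cnf_split[OF assms]
  show "input_at (encode_cnf \<phi>) (clause_pos \<phi> c + 1 + i) = Letter (clause_code (\<phi> ! c) ! i)"
    if "i < length (clause_code (\<phi> ! c))" using that unfolding clause_pos_def s[symmetric]
    by (subst s, subst input_at_append) (simp add: nth_append)
  have "clause_pos \<phi> (Suc c) = length (encode_cnf (take c \<phi>)) + 1 + length (clause_code (\<phi> ! c))"
    using clause_pos_Suc[OF assms] by (simp add: clause_pos_def)
  then show "input_at (encode_cnf \<phi>) (clause_pos \<phi> (Suc c)) = Letter EndClause"
    by (simp only:) (subst s, subst input_at_append, simp)
qed

lemma two_cnf_clause:
  assumes "two_cnf \<phi>" "c < length \<phi>"
  obtains l where "\<phi> ! c = [l]" | l l' where "\<phi> ! c = [l, l']"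
proof -
  have "length (\<phi> ! c) = 1 \<or> length (\<phi> ! c) = 2"
    using assms nth_mem[of c \<phi>] by (auto simp: two_cnf_def)
  then show ?thesis using that by (auto simp: length_Suc_conv numeral_2_eq_2)
qed

text \<open>Whatever follows a literal is not a digit, so its end can be recognized. Behind the last
  literal it is \<open>EndClause\<close>, from which that literal is found by going left.\<close>

lemma slot_split:
  assumes "two_cnf \<phi>" "c < length \<phi>"
  obtains u z v where "encode_cnf \<phi> = u @ encode_literal (slot \<phi> c s) @ z # v"
    "slot_pos \<phi> c s = length u + 1" "\<And>b. z \<noteq> Digit b" "s \<noteq> 0 \<Longrightarrow> z = EndClause"
    "s \<noteq> 0 \<Longrightarrow> clause_pos \<phi> (Suc c) = length u + length (encode_literal (slot \<phi> c s)) + 1"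
proof -
  note s = encode_cnf_split[OF assms(2)]
  note p = clause_pos_Suc[OF assms(2)]
  show ?thesis
  proof (rule two_cnf_clause[OF assms])
    fix l assume l: "\<phi> ! c = [l]"
    show ?thesis
      by (rule that[of "encode_cnf (take c \<phi>)" EndClause "encode_cnf (drop (Suc c) \<phi>)"])
        (use s p l in \<open>auto simp: slot_def slot_pos_def clause_code_def clause_pos_def\<close>)
  next
    fix l l' assume l: "\<phi> ! c = [l, l']"
    obtain z v where z: "encode_literal l' = z # v" "\<And>b. z \<noteq> Digit b" by (cases l') auto
    show ?thesis
    proof (cases "s = 0")
      case True
      show ?thesis
        by (rule that[of "encode_cnf (take c \<phi>)" z "v @ EndClause # encode_cnf (drop (Suc c) \<phi>)"])
          (use s p l z True in \<open>auto simp: slot_def slot_pos_def clause_code_def clause_pos_def\<close>)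
    next
      case False
      show ?thesis
        by (rule that[of "encode_cnf (take c \<phi>) @ encode_literal l" EndClause
              "encode_cnf (drop (Suc c) \<phi>)"])
          (use s p l False in \<open>auto simp: slot_def slot_pos_def clause_code_def clause_pos_def\<close>)
    qed
  qed
qed

section \<open>Keys of literals\<close>

lemma inj_binary: "binary m = binary n \<Longrightarrow> m = n"
proof (induction m arbitrary: n rule: less_induct)
  case (less m)
  have 0: "binary k = [] \<longleftrightarrow> k = 0" for k by (subst binary.simps) simp
  show ?case
  proof (cases "m = 0 \<or> n = 0")
    case True
    then show ?thesis using less.prems 0 by metis
  next
    case False
    then have "odd m = odd n" "binary (m div 2) = binary (n div 2)"
      using less.prems by (subst (asm) (1 2) binary.simps, simp)+
    then have "m div 2 = n div 2" "m mod 2 = n mod 2"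
      using less.IH[of "m div 2"] False by (auto simp: odd_iff_mod_2_eq_one)
    then show ?thesis by (metis div_mult_mod_eq)
  qed
qed

text \<open>Flipping the sign in one of two keys reduces complementarity of literals to equality of keys; the
  terminator 5 stands for whatever follows the digits.\<close>

definition lit_key :: "bool \<Rightarrow> literal \<Rightarrow> nat list" where
  "lit_key flip l =
     (case l of Pos _ \<Rightarrow> if flip then 2 else 1 | Neg _ \<Rightarrow> if flip then 1 else 2) #
     map (\<lambda>b. if b then 3 else 4) (binary (var l)) @ [5]"

lemma lit_key_eq_iff: "lit_key False l = lit_key True l' \<longleftrightarrow> l' = neg_lit l"
proof -
  have "inj (\<lambda>b. if b then 3 else (4 :: nat))" by (auto simp: inj_def)
  then have "map (\<lambda>b. if b then 3 else (4::nat)) (binary v) = map (\<lambda>b. if b then 3 else 4) (binary w)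
      \<longleftrightarrow> v = w" for v w using inj_binary by (auto dest: map_injective)
  then show ?thesis by (cases l; cases l') (auto simp: lit_key_def)
qed

text \<open>Take the first position \<open>m\<close> at which the lists differ or reach
  \<open>e\<close>. As \<open>e\<close> occurs only at their ends, neither list is exhausted before
  \<open>m\<close>, and agreement at \<open>m\<close> means that both end there. So a symbolwise
  comparison can stop at \<open>m\<close> and be decided by the last two symbols.\<close>

lemma terminated_lists_compare:
  assumes "e \<notin> set p" "e \<notin> set q"
  obtains m where "m < length (p @ [e])" "m < length (q @ [e])"
    "\<And>i. i < m \<Longrightarrow> (p @ [e]) ! i = (q @ [e]) ! i \<and> (p @ [e]) ! i \<noteq> e"
    "(p @ [e]) ! m \<noteq> (q @ [e]) ! m \<or> (p @ [e]) ! m = e"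
    "(p @ [e]) ! m = (q @ [e]) ! m \<longleftrightarrow> p = q" using assms
proof (induction p arbitrary: q thesis)
  case Nil
  show ?case by (rule Nil.prems(1)[of 0]) (use Nil in \<open>auto simp: nth_append\<close>)
next
  case (Cons d p)
  show ?case
  proof (cases q)
    case Nil
    show ?thesis by (rule Cons.prems(1)[of 0]) (use Cons Nil in auto)
  next
    case q: (Cons d' q')
    show ?thesis
    proof (cases "d = d'")
      case False
      show ?thesis by (rule Cons.prems(1)[of 0]) (use Cons q False in auto)
    next
      case True
      obtain m where m: "m < length (p @ [e])" "m < length (q' @ [e])"
        "\<And>i. i < m \<Longrightarrow> (p @ [e]) ! i = (q' @ [e]) ! i \<and> (p @ [e]) ! i \<noteq> e"
        "(p @ [e]) ! m \<noteq> (q' @ [e]) ! m \<or> (p @ [e]) ! m = e"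
        "(p @ [e]) ! m = (q' @ [e]) ! m \<longleftrightarrow> p = q'" using Cons.IH[of q'] Cons.prems(2,3) q by auto
      show ?thesis
      proof (rule Cons.prems(1)[of "Suc m"])
        fix i assume "i < Suc m"
        then show "((d # p) @ [e]) ! i = (q @ [e]) ! i \<and> ((d # p) @ [e]) ! i \<noteq> e"
          using m(3)[of "i - 1"] True q Cons.prems(2) by (cases i) auto
      qed (use m True q in auto)
    qed
  qed
qed

lemma lit_key_compare:
  obtains m where "m < length (lit_key f l)" "m < length (lit_key g l')"
    "\<And>i. i < m \<Longrightarrow> lit_key f l ! i = lit_key g l' ! i \<and> lit_key f l ! i \<noteq> 5"
    "lit_key f l ! m \<noteq> lit_key g l' ! m \<or> lit_key f l ! m = 5"
    "lit_key f l ! m = lit_key g l' ! m \<longleftrightarrow> lit_key f l = lit_key g l'"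
proof -
  have "\<exists>p. lit_key h k = p @ [5] \<and> 5 \<notin> set p" for h k by (rule exI[of _ "butlast (lit_key h k)"])
      (auto simp: lit_key_def butlast_append split: literal.splits if_splits)
  then obtain p q where "lit_key f l = p @ [5]" "lit_key g l' = q @ [5]" "5 \<notin> set p" "5 \<notin> set q"
    by metis
  then show ?thesis using terminated_lists_compare[of 5 p q] that by (metis append_same_eq)
qed

lemma lit_key_less: "i < length (lit_key f l) \<Longrightarrow> lit_key f l ! i < 6"
proof -
  assume "i < length (lit_key f l)"
  then have "lit_key f l ! i \<in> set (lit_key f l)" by (rule nth_mem)
  then show ?thesis by (auto simp: lit_key_def split: literal.splits if_splits)
qed

text \<open>Beyond the sign, everything that is not a digit counts as terminator, so the key is the
  same whether the next literal or \<open>EndClause\<close> follows.\<close>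

definition lit_code :: "bool \<Rightarrow> bool \<Rightarrow> cnf_sym input_cell \<Rightarrow> nat" where
  "lit_code flip tail z =
     (if tail then (case z of Letter (Digit b) \<Rightarrow> if b then 3 else 4 | _ \<Rightarrow> 5)
      else (case z of Letter PosSign \<Rightarrow> if flip then 2 else 1
                    | Letter NegSign \<Rightarrow> if flip then 1 else 2 | _ \<Rightarrow> 0))"

lemma length_lit_key: "length (lit_key f l) = length (encode_literal l) + 1"
  by (cases l) (auto simp: lit_key_def)

lemma lit_code_slot:
  assumes "two_cnf \<phi>" "c < length \<phi>" "b < length (lit_key f (slot \<phi> c s))"
  shows "lit_code f (b \<noteq> 0) (input_at (encode_cnf \<phi>) (slot_pos \<phi> c s + b))
    = lit_key f (slot \<phi> c s) ! b" (is ?A)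
    and "slot_pos \<phi> c s + b \<le> length (encode_cnf \<phi>)"
proof -
  let ?l = "slot \<phi> c s"
  obtain u z v where *: "encode_cnf \<phi> = u @ encode_literal ?l @ z # v"
    "slot_pos \<phi> c s = length u + 1" "\<And>b. z \<noteq> Digit b" using slot_split[OF assms(1,2)] by metis
  have b: "b \<le> length (encode_literal ?l)" using assms(3) by (simp add: length_lit_key)
  then show "slot_pos \<phi> c s + b \<le> length (encode_cnf \<phi>)" using * by simp
  have "input_at (encode_cnf \<phi>) (slot_pos \<phi> c s + b) = Letter ((encode_literal ?l @ z # v) ! b)"
    unfolding * input_at_append using b by simp
  also have "lit_code f (b \<noteq> 0) \<dots> = lit_key f ?l ! b"
  proof (cases "b = length (encode_literal ?l)")
    case True
    then show ?thesis
      using *(3) by (cases ?l; cases z) (auto simp: nth_append lit_key_def lit_code_def)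
  next
    case False
    then show ?thesis
      using b by (cases ?l; cases b) (auto simp: nth_append lit_key_def lit_code_def)
  qed
  finally show ?A .
qed

text \<open>Justifies the search to the left from the end of a clause: it crosses exactly the digits
  of the last literal and stops on its sign.\<close>

lemma input_at_last_literal:
  assumes "two_cnf \<phi>" "c < length \<phi>" "s \<noteq> 0"
  defines "n \<equiv> length (encode_literal (slot \<phi> c s)) - 1"
  shows "clause_pos \<phi> (Suc c) = slot_pos \<phi> c s + n + 1" "0 < slot_pos \<phi> c s"
    "\<And>i. i < n \<Longrightarrow> \<exists>b. input_at (encode_cnf \<phi>) (slot_pos \<phi> c s + n - i) = Letter (Digit b)"
    "\<And>b. input_at (encode_cnf \<phi>) (slot_pos \<phi> c s) \<noteq> Letter (Digit b)"
    "slot_pos \<phi> c s + n \<le> length (encode_cnf \<phi>)"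
proof -
  let ?l = "slot \<phi> c s"
  obtain u z v where *: "encode_cnf \<phi> = u @ encode_literal ?l @ z # v"
    "slot_pos \<phi> c s = length u + 1"
    "clause_pos \<phi> (Suc c) = length u + length (encode_literal ?l) + 1"
    using slot_split[OF assms(1,2)] assms(3) by metis
  have n: "length (encode_literal ?l) = Suc n" unfolding n_def by (cases ?l) auto
  show "clause_pos \<phi> (Suc c) = slot_pos \<phi> c s + n + 1" "0 < slot_pos \<phi> c s"
    "slot_pos \<phi> c s + n \<le> length (encode_cnf \<phi>)" using * n by simp_all
  have at: "input_at (encode_cnf \<phi>) (slot_pos \<phi> c s + i) = Letter (encode_literal ?l ! i)"
    if "i < Suc n" for i unfolding * input_at_append using that n by (simp add: nth_append)
  show "\<exists>b. input_at (encode_cnf \<phi>) (slot_pos \<phi> c s + n - i) = Letter (Digit b)" if "i < n" for i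
  proof -
    have "slot_pos \<phi> c s + n - i = slot_pos \<phi> c s + (n - i)" using that by simp
    then show ?thesis using at[of "n - i"] that n by (cases ?l; cases "n - i") auto
  qed
  show "input_at (encode_cnf \<phi>) (slot_pos \<phi> c s) \<noteq> Letter (Digit b)" for b
    using at[of 0] by (cases ?l) auto
qed

section \<open>Comparing literals\<close>

text \<open>
  Use of the tapes.  Counters: 0, 2, 4, 6 hold the number of clauses and drive loops over clauses, with
  the indices in 1, 3, 5, 7; 8 is temporary; 9 is an offset into a literal; 10 is the position of the
  simulated input head; 11 counts down to the symbol that is fetched.  Registers: 12 and 13 hold the two
  symbols compared, 14 the result of a comparison, 15 the fetched symbol, 16 the state of the simulated
  machine, 17 the last move of its input head, 18 whether it has written \<open>Bot\<close>, 19 whether a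
  contradiction has been found.  The tapes of the simulated machine start at 20.
\<close>

definition until_cmd :: "('i input_cell \<Rightarrow> bool) \<Rightarrow> dir \<Rightarrow> ('i, 'o) cmd" where
  "until_cmd b d = While (\<lambda>z sc. \<not> b z) (move_head d)"

definition next_clause :: "(cnf_sym, 'o) cmd" where
  "next_clause = Seq (move_head MoveR) (until_cmd (\<lambda>z. z = Letter EndClause) MoveR)"

definition seek :: "nat \<Rightarrow> nat \<Rightarrow> (cnf_sym, 'o) cmd" where
  "seek V s = Seq (for_cmd V 8 next_clause)
     (if s = 0 then move_head MoveR
      else Seq next_clause (Seq (move_head MoveL) (until_cmd (\<lambda>z. \<nexists>b. z = Letter (Digit b)) MoveL)))"

definition rewind :: "('i, 'o) cmd" where
  "rewind = until_cmd (\<lambda>z. z = LeftEnd) MoveL"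

text \<open>The single input head cannot stay at two literals at once, so for every symbol it is
  sent from the left end to the literal and returned; only the offset in counter 9 is
  remembered.\<close>

definition read_symbol :: "nat \<Rightarrow> nat \<Rightarrow> nat \<Rightarrow> bool \<Rightarrow> (cnf_sym, 'o) cmd" where
  "read_symbol V s r f = Seq (seek V s) (Seq (for_cmd 9 8 (move_head MoveR))
     (Seq (set_reg r (\<lambda>z sc. lit_code f (sc 9 \<noteq> 0) z)) rewind))"

definition compl_cmd :: "nat \<Rightarrow> nat \<Rightarrow> nat \<Rightarrow> nat \<Rightarrow> (cnf_sym, 'o) cmd" where
  "compl_cmd V s W t =
     Seq (While (\<lambda>z sc. sc 12 = sc 13 \<and> sc 12 \<noteq> 5)
            (Seq (read_symbol V s 12 False) (Seq (read_symbol W t 13 True) (inc_cmd 9))))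
    (Seq (set_reg 14 (\<lambda>z sc. if sc 12 = sc 13 then 1 else 0))
    (Seq (assign 12 0) (Seq (assign 13 0) (clear_cmd 9))))"

lemma ast_eqI:
  assumes "pos a = pos b" "\<And>i. vl a i = vl b i" "mt a = mt b" "wr a = wr b"
  shows "a = (b :: 'o ast)"
proof -
  have "vl a = vl b" using assms(2) by auto
  then show ?thesis using assms by (simp add: ast.equality)
qed

locale formula_vm = vm K k B x 12 20 N Z
  for K k B and x :: "cnf_sym list" and N Z +
  fixes \<phi> :: cnf
  assumes x: "x = encode_cnf \<phi>" and two: "two_cnf \<phi>" and xN: "length x + 2 \<le> N" and K6: "6 < K"
begin

lemma does_until:
  assumes "\<And>i. i < n \<Longrightarrow> \<not> b (input_at x (p i))" "b (input_at x (p n))" "n \<le> length x + 1"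
    and "\<And>i. i < n \<Longrightarrow> p (Suc i) = min (length x + 1) (move d (p i))" "pos a = p 0"
  shows "does 2 (until_cmd b d) a (a\<lparr>pos := p n\<rparr>)"
proof -
  have "does 2 (until_cmd b d) (a\<lparr>pos := p 0\<rparr>) (a\<lparr>pos := p n\<rparr>)" unfolding until_cmd_def
  proof (rule does_While[where j = 0])
    show "does 0 (move_head d) (a\<lparr>pos := p i\<rparr>) (a\<lparr>pos := p (Suc i)\<rparr>)" if "i < n" for i
      using does_move_head[of 0 d "a\<lparr>pos := p i\<rparr>"] assms(4)[OF that] by simp
  qed (use assms xN NZ in auto)
  moreover have "a\<lparr>pos := p 0\<rparr> = a" using assms(5) by simp
  ultimately show ?thesis by simp
qed

lemma does_next_clause:
  assumes "c < length \<phi>" "pos a = clause_pos \<phi> c"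
  shows "does 3 next_clause a (a\<lparr>pos := clause_pos \<phi> (Suc c)\<rparr>)"
proof -
  let ?n = "length (clause_code (\<phi> ! c))"
  note p = clause_pos_Suc[OF assms(1)]
  have le: "clause_pos \<phi> (Suc c) \<le> length x"
    using clause_pos_le[of "Suc c" \<phi>] assms(1) by (simp add: x)
  have 1: "does 2 (move_head MoveR) a (a\<lparr>pos := clause_pos \<phi> c + 1\<rparr>)"
    using does_move_head[of 2 MoveR a] assms(2) p le by (simp add: min_def)
  have 2: "does 2 (until_cmd (\<lambda>z. z = Letter EndClause) MoveR) (a\<lparr>pos := clause_pos \<phi> c + 1\<rparr>)
     (a\<lparr>pos := clause_pos \<phi> c + 1, pos := clause_pos \<phi> c + 1 + ?n\<rparr>)"
  proof (rule does_until[where p = "\<lambda>i. clause_pos \<phi> c + 1 + i"])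
    fix i assume i: "i < ?n"
    then have "clause_code (\<phi> ! c) ! i \<in> set (clause_code (\<phi> ! c))" by simp
    then show "input_at x (clause_pos \<phi> c + 1 + i) \<noteq> Letter EndClause"
      using input_at_clause(1)[OF assms(1) i] EndClause_notin_clause[of "\<phi> ! c"]
      unfolding x by (metis input_cell.inject)
    show "clause_pos \<phi> c + 1 + Suc i = min (length x + 1) (move MoveR (clause_pos \<phi> c + 1 + i))"
      using i p le by simp
  qed (use p le input_at_clause(2)[OF assms(1)] in \<open>auto simp: x\<close>)
  show ?thesis
    unfolding next_clause_def using does_Seq[OF 1 2, of 3] p by (simp add: algebra_simps)
qed

lemma length_le_N: "length \<phi> \<le> N"
  using length_le_encode_cnf[of \<phi>] xN by (simp add: x)

lemma does_seek:
  assumes "V < 12" "V \<noteq> 8" "pos a = 0" "vl a V = c" "vl a 8 = 0" "c < length \<phi>"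
  shows "does 9 (seek V s) a (a\<lparr>pos := slot_pos \<phi> c s\<rparr>)"
proof -
  let ?f = "\<lambda>i. a\<lparr>pos := clause_pos \<phi> i\<rparr>"
  have "does 8 (for_cmd V 8 next_clause) (?f 0) (?f c)"
  proof (rule does_for)
    fix i assume "i < c"
    then show "does 3 next_clause (setv V (c - i) (setv 8 i (?f i))) (setv V (c - i) (setv 8 i (?f (Suc i))))"
      using does_next_clause[of i "setv V (c - i) (setv 8 i (?f i))"] assms by simp
  qed (use assms length_le_N in auto)
  moreover have "?f 0 = a" using assms(3) by simp
  ultimately have 1: "does 8 (for_cmd V 8 next_clause) a (?f c)" by simp
  have 2: "does 8 (if s = 0 then move_head MoveR
      else Seq next_clause (Seq (move_head MoveL) (until_cmd (\<lambda>z. \<nexists>b. z = Letter (Digit b)) MoveL)))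
      (?f c) (a\<lparr>pos := slot_pos \<phi> c s\<rparr>)"
  proof (cases "s = 0")
    case True
    have "clause_pos \<phi> c + 1 \<le> length x"
      using clause_pos_le[of "Suc c" \<phi>] clause_pos_Suc[of c \<phi>] assms(6) by (simp add: x)
    then show ?thesis using does_move_head[of 8 MoveR "?f c"] True by (simp add: slot_pos_def)
  next
    case False
    let ?n = "length (encode_literal (slot \<phi> c s)) - 1"
    note last = input_at_last_literal[OF two assms(6) False, folded x]
    have 3: "does 3 next_clause (?f c) (?f (Suc c))"
      using does_next_clause[of c "?f c"] assms(6) by simp
    have 4: "does 2 (move_head MoveL) (?f (Suc c)) (a\<lparr>pos := slot_pos \<phi> c s + ?n\<rparr>)"
      using does_move_head[of 2 MoveL "?f (Suc c)"] last(1,5) by simp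
    have 5: "does 2 (until_cmd (\<lambda>z. \<nexists>b. z = Letter (Digit b)) MoveL) (a\<lparr>pos := slot_pos \<phi> c s + ?n\<rparr>)
       (a\<lparr>pos := slot_pos \<phi> c s + ?n, pos := slot_pos \<phi> c s + ?n - ?n\<rparr>)"
      by (rule does_until[where p = "\<lambda>i. slot_pos \<phi> c s + ?n - i"]) (use last in auto)
    show ?thesis using does_Seq[OF 3 does_Seq[OF 4 5, of 3], of 8] False by simp
  qed
  show ?thesis unfolding seek_def using does_Seq[OF 1 2] by simp
qed

lemma does_rewind: "does 2 rewind a (a\<lparr>pos := 0\<rparr>)"
proof (cases "ok a")
  case True
  have "does 2 rewind a (a\<lparr>pos := pos a - pos a\<rparr>)" unfolding rewind_def
    by (rule does_until[where p = "\<lambda>i. pos a - i"]) (use True in \<open>auto simp: input_at_def ok_def\<close>)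
  then show ?thesis by simp
qed (simp add: does_def)

lemma does_read_symbol:
  assumes V: "V < 12" "V \<noteq> 8" "V \<noteq> 9" and "pos a = 0" "vl a V = c" "vl a 8 = 0" "c < length \<phi>"
    and r: "12 \<le> r" "r < 20" and b: "vl a 9 = b" "b < length (lit_key f (slot \<phi> c s))"
  shows "does 13 (read_symbol V s r f) a (setv r (lit_key f (slot \<phi> c s) ! b) a)"
proof -
  let ?p = "slot_pos \<phi> c s"
  note slot = lit_code_slot[OF two assms(7) b(2), folded x]
  have 1: "does 9 (seek V s) a (a\<lparr>pos := ?p\<rparr>)" using assms by (intro does_seek) auto
  have "does 10 (for_cmd 9 8 (move_head MoveR)) (a\<lparr>pos := ?p + 0\<rparr>) (a\<lparr>pos := ?p + b\<rparr>)"
  proof (rule does_for[where j = 5])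
    fix i assume "i < b"
    then show "does 5 (move_head MoveR) (setv 9 (b - i) (setv 8 i (a\<lparr>pos := ?p + i\<rparr>)))
        (setv 9 (b - i) (setv 8 i (a\<lparr>pos := ?p + Suc i\<rparr>)))"
      using does_move_head[of 5 MoveR "setv 9 (b - i) (setv 8 i (a\<lparr>pos := ?p + i\<rparr>))"] slot(2)
      by simp
  qed (use assms slot xN in auto)
  then have 2: "does 10 (for_cmd 9 8 (move_head MoveR)) (a\<lparr>pos := ?p\<rparr>) (a\<lparr>pos := ?p + b\<rparr>)" by simp
  have sc: "scan k (conc (a\<lparr>pos := ?p + b\<rparr>)) 9 \<noteq> 0 \<longleftrightarrow> b \<noteq> 0"
    using cond_nonzero[of 9 z "a\<lparr>pos := ?p + b\<rparr>" for z] b(1) by (simp add: nonzero_def)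
  have 3: "does 2 (set_reg r (\<lambda>z sc. lit_code f (sc 9 \<noteq> 0) z)) (a\<lparr>pos := ?p + b\<rparr>)
      (setv r (lit_key f (slot \<phi> c s) ! b) (a\<lparr>pos := ?p + b\<rparr>))"
    using r slot(1) lit_key_less[OF b(2)] K6 by (intro does_set_reg) (simp_all add: sc del: neq0_conv)
  have 4: "does 2 rewind (setv r (lit_key f (slot \<phi> c s) ! b) (a\<lparr>pos := ?p + b\<rparr>))
      (setv r (lit_key f (slot \<phi> c s) ! b) a)"
  proof -
    have "(setv r (lit_key f (slot \<phi> c s) ! b) (a\<lparr>pos := ?p + b\<rparr>))\<lparr>pos := 0\<rparr>
        = setv r (lit_key f (slot \<phi> c s) ! b) a" by (rule ast_eqI) (use assms(4) in auto)
    then show ?thesis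
      using does_rewind[of "setv r (lit_key f (slot \<phi> c s) ! b) (a\<lparr>pos := ?p + b\<rparr>)"] by metis
  qed
  show ?thesis unfolding read_symbol_def
    using does_Seq[OF 1 does_Seq[OF 2 does_Seq[OF 3 4, of 3], of 12], of 13] by simp
qed

lemma does_compl:
  assumes V: "V < 12" "V \<noteq> 8" "V \<noteq> 9" "W < 12" "W \<noteq> 8" "W \<noteq> 9"
    and a: "pos a = 0" "vl a 8 = 0" "vl a 9 = 0" "vl a 12 = 0" "vl a 13 = 0"
    and c: "vl a V = c" "c < length \<phi>" "vl a W = d" "d < length \<phi>"
  shows "does 19 (compl_cmd V s W t) a
    (setv 14 (if slot \<phi> d t = neg_lit (slot \<phi> c s) then 1 else 0) a)"
proof -
  let ?u = "lit_key False (slot \<phi> c s)" and ?w = "lit_key True (slot \<phi> d t)"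
  obtain m where m: "m < length ?u" "m < length ?w"
    "\<And>i. i < m \<Longrightarrow> ?u ! i = ?w ! i \<and> ?u ! i \<noteq> 5"
    "?u ! m \<noteq> ?w ! m \<or> ?u ! m = 5"
    "?u ! m = ?w ! m \<longleftrightarrow> ?u = ?w"
    by (rule lit_key_compare[of False "slot \<phi> c s" True "slot \<phi> d t"]) blast
  \<comment> \<open>Before the first iteration nothing has been read and registers 12 and 13 are
    both 0, a value that occurs in no key; their equality lets the loop start.\<close>
  define f where "f i = (if i = 0 then a else setv 12 (?u ! (i - 1)) (setv 13 (?w ! (i - 1)) (setv 9 i a)))" for i
  have len: "length (lit_key g (slot \<phi> e s)) < N" if e: "e < length \<phi>" for g s e
  proof -
    obtain u z v where "encode_cnf \<phi> = u @ encode_literal (slot \<phi> e s) @ z # v"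
      using slot_split[OF two e] by metis
    then show ?thesis using xN by (simp add: x length_lit_key)
  qed
  have f: "pos (f i) = 0" "vl (f i) 8 = 0" "vl (f i) 9 = i" "vl (f i) V = c" "vl (f i) W = d" for i
    using assms by (auto simp: f_def)
  have 1: "does 17 (While (\<lambda>z sc. sc 12 = sc 13 \<and> sc 12 \<noteq> 5)
       (Seq (read_symbol V s 12 False) (Seq (read_symbol W t 13 True) (inc_cmd 9)))) (f 0) (f (Suc m))"
  proof (rule does_While[where j = 15])
    fix i assume i: "i < Suc m"
    show "scan k (conc (f i)) 12 = scan k (conc (f i)) 13 \<and> scan k (conc (f i)) 12 \<noteq> 5"
      using i m(3)[of "i - 1"] a by (cases i) (auto simp: scan_reg f_def)
    let ?a = "setv 12 (?u ! i) (f i)"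
    let ?b = "setv 13 (?w ! i) ?a"
    have 2: "does 13 (read_symbol V s 12 False) (f i) ?a"
      using V c f i m(1) by (intro does_read_symbol) auto
    have 3: "does 13 (read_symbol W t 13 True) ?a ?b"
      using V c f i m(2) by (intro does_read_symbol) auto
    have "i < N" using len[OF c(2), of False s] i m(1) by simp
    then have 4: "does 13 (inc_cmd 9) ?b (setv 9 (Suc i) ?b)"
      using does_mono[OF does_inc[of 9 ?b], of 13] f by simp
    have "setv 9 (Suc i) ?b = f (Suc i)" by (rule ast_eqI) (auto simp: f_def)
    then show "does 15 (Seq (read_symbol V s 12 False) (Seq (read_symbol W t 13 True) (inc_cmd 9)))
        (f i) (f (Suc i))" using does_Seq[OF 2 does_Seq[OF 3 4, of 14], of 15] by simp
  next
    show "\<not> (scan k (conc (f (Suc m))) 12 = scan k (conc (f (Suc m))) 13 \<and>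
        scan k (conc (f (Suc m))) 12 \<noteq> 5)" using m(4) by (auto simp: scan_reg f_def)
    show "Suc m \<le> Z" using len[OF c(2), of False s] m(1) NZ by simp
  qed simp
  let ?v = "if slot \<phi> d t = neg_lit (slot \<phi> c s) then 1 else (0 :: nat)"
  let ?a = "setv 14 ?v (f (Suc m))"
  let ?b = "setv 12 0 ?a"
  let ?c = "setv 13 0 ?b"
  have "?u ! m = ?w ! m \<longleftrightarrow> slot \<phi> d t = neg_lit (slot \<phi> c s)" using m(5) lit_key_eq_iff by simp
  then have 2: "does 3 (set_reg 14 (\<lambda>z sc. if sc 12 = sc 13 then 1 else 0)) (f (Suc m)) ?a"
    using K6 by (intro does_set_reg) (auto simp: scan_reg f_def)
  have 3: "does 3 (assign 12 0) ?a ?b" "does 3 (assign 13 0) ?b ?c"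
    using K6 by (auto intro!: does_set_reg)
  have 4: "does 3 (clear_cmd 9) ?c (setv 9 0 ?c)" by (rule does_clear) simp
  have "setv 9 0 ?c = setv 14 ?v a" by (rule ast_eqI) (use a in \<open>auto simp: f_def\<close>)
  then show ?thesis unfolding compl_cmd_def
    using does_Seq[OF 1 does_Seq[OF 2 does_Seq[OF 3(1) does_Seq[OF 3(2) 4, of 4], of 5], of 6], of 19]
    by (simp add: f_def)
qed

end

section \<open>Generating an automaton symbol by symbol\<close>

definition cell_code :: "nfa_sym input_cell \<Rightarrow> nat" where
  "cell_code z = (case z of LeftEnd \<Rightarrow> 0 | RightEnd \<Rightarrow> 1 | Letter Hash \<Rightarrow> 4
     | Letter (Bit b) \<Rightarrow> if b then 3 else 2)"

definition slot_of :: "cnf \<Rightarrow> nat \<Rightarrow> literal" where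
  "slot_of \<phi> q = slot \<phi> (q div 2) (q mod 2)"

definition mate_of :: "cnf \<Rightarrow> nat \<Rightarrow> literal" where
  "mate_of \<phi> q = slot \<phi> (q div 2) (1 - q mod 2)"

text \<open>If the mate of \<open>q'\<close> is the negation of the literal in \<open>q\<close>,
  then the clause of \<open>q'\<close> makes the literal in \<open>q\<close> imply that in
  \<open>q'\<close>. Transitions do not depend on the letter; final are the slots that carry the
  negation of the initial literal.\<close>

definition query_nfa :: "cnf \<Rightarrow> nat \<Rightarrow> nfa" where
  "query_nfa \<phi> q0 = \<lparr>num_states = 2 * length \<phi>, num_letters = 1,
     delta = (\<lambda>q a. {q'. q' < 2 * length \<phi> \<and> mate_of \<phi> q' = neg_lit (slot_of \<phi> q)}),
     initial = q0,
     final = {q. q < 2 * length \<phi> \<and> slot_of \<phi> q = neg_lit (slot_of \<phi> q0)}\<rparr>"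

text \<open>The word length equals the number of states, which exceeds the length of every shortest
  path.\<close>

definition query :: "cnf \<Rightarrow> nat \<Rightarrow> search_instance" where
  "query \<phi> q0 = (query_nfa \<phi> q0, 2 * length \<phi>)"

abbreviation query_code :: "cnf \<Rightarrow> nat \<Rightarrow> nfa_sym list" where
  "query_code \<phi> q0 \<equiv> encode_search (query \<phi> q0)"

definition bit_code :: "bool \<Rightarrow> nat" where
  "bit_code b = (if b then 3 else 2)"

lemma concat_map_double:
  "concat (map f [0..<2 * n]) = concat (map (\<lambda>i. f (2 * i) @ f (2 * i + 1)) [0..<n])"
  by (induction n) simp_all

lemma map_concat_map: "map f (concat (map g xs)) = concat (map (\<lambda>a. map f (g a)) xs)"
  by (induction xs) simp_all

lemma map_double: "map f [0..<2 * n] = concat (map (\<lambda>i. [f (2 * i), f (2 * i + 1)]) [0..<n])"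
  by (induction n) simp_all

text \<open>The codes of the left endmarker and of the encoded query, arranged in the order in which
  loops over clauses and slots produce them. \<open>1 - u\<close> selects the mate of target slot
  \<open>u\<close>.\<close>

definition query_codes :: "cnf \<Rightarrow> nat \<Rightarrow> nat \<Rightarrow> nat list" where
  "query_codes \<phi> c s = (let C = length \<phi> in
     [0] @ concat (map (\<lambda>_. [3, 3]) [0..<C]) @ [4, 3, 4] @
     concat (map (\<lambda>d. concat (map (\<lambda>t. concat (map (\<lambda>e. map (\<lambda>u.
        bit_code (slot \<phi> d t = neg_lit (slot \<phi> e (1 - u)))) [0, 1]) [0..<C])) [0, 1])) [0..<C]) @ [4] @
     (concat (map (\<lambda>_. [3, 3]) [0..<c]) @ (if s = 0 then [] else [3])) @ [4] @
     concat (map (\<lambda>d. map (\<lambda>t. bit_code (slot \<phi> d t = neg_lit (slot \<phi> c s))) [0, 1]) [0..<C]) @ [4] @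
     concat (map (\<lambda>_. [3, 3]) [0..<C]))"

lemma neg_lit_neg_lit [simp]: "neg_lit (neg_lit l) = l"
  by (cases l) auto

lemma query_codes_eq:
  assumes "s < 2"
  shows "query_codes \<phi> c s = 0 # map (\<lambda>a. cell_code (Letter a)) (query_code \<phi> (2 * c + s))"
proof -
  let ?f = "\<lambda>a. cell_code (Letter a)"
  have un: "map ?f (unary (2 * n)) = concat (map (\<lambda>_. [3, 3]) [0..<n])" for n
    using map_double[of "\<lambda>_. 3 :: nat" n] by (simp add: unary_def cell_code_def map_replicate_const)
  have un': "map ?f (unary (2 * c + s)) = concat (map (\<lambda>_. [3, 3]) [0..<c]) @ (if s = 0 then [] else [3])"
  proof -
    have "unary (2 * c + s) = unary (2 * c) @ unary s" by (simp add: unary_def replicate_add)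
    moreover have "map ?f (unary s) = (if s = 0 then [] else [3])"
      using assms by (cases s) (auto simp: unary_def cell_code_def)
    ultimately show ?thesis by (simp add: un)
  qed
  have sl: "slot_of \<phi> (2 * d) = slot \<phi> d 0" "slot_of \<phi> (Suc (2 * d)) = slot \<phi> d 1"
    "mate_of \<phi> (2 * d) = slot \<phi> d 1" "mate_of \<phi> (Suc (2 * d)) = slot \<phi> d 0" for d
    by (simp_all add: slot_of_def mate_of_def)
  have s0: "slot_of \<phi> (2 * c + s) = slot \<phi> c s" using assms by (simp add: slot_of_def)
  have bit: "cell_code (Letter (Bit b)) = bit_code b" for b
    by (simp add: cell_code_def bit_code_def)
  have N: "num_states (query_nfa \<phi> (2 * c + s)) = 2 * length \<phi>"
    "num_letters (query_nfa \<phi> (2 * c + s)) = 1" "initial (query_nfa \<phi> (2 * c + s)) = 2 * c + s"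
    by (simp_all add: query_nfa_def)
  have A: "map ?f [Bit (q' \<in> delta (query_nfa \<phi> (2 * c + s)) q a).
        q \<leftarrow> [0..<num_states (query_nfa \<phi> (2 * c + s))],
        a \<leftarrow> [0..<num_letters (query_nfa \<phi> (2 * c + s))],
        q' \<leftarrow> [0..<num_states (query_nfa \<phi> (2 * c + s))]]
     = concat (map (\<lambda>d. concat (map (\<lambda>t. concat (map (\<lambda>e. map (\<lambda>u.
        bit_code (slot \<phi> d t = neg_lit (slot \<phi> e (1 - u)))) [0, 1]) [0..<length \<phi>])) [0, 1])) [0..<length \<phi>])"
  proof -
    have "map ?f [Bit (q' \<in> delta (query_nfa \<phi> (2 * c + s)) q a). q' \<leftarrow> [0..<2 * length \<phi>]]
       = map (\<lambda>q'. bit_code (slot_of \<phi> q = neg_lit (mate_of \<phi> q'))) [0..<2 * length \<phi>]" for q a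
      by (auto simp: query_nfa_def bit intro!: arg_cong[where f = bit_code])
    then have "map ?f [Bit (q' \<in> delta (query_nfa \<phi> (2 * c + s)) q a). a \<leftarrow> [0..<1], q' \<leftarrow> [0..<2 * length \<phi>]]
       = map (\<lambda>q'. bit_code (slot_of \<phi> q = neg_lit (mate_of \<phi> q'))) [0..<2 * length \<phi>]" for q
      by simp
    then show ?thesis
      unfolding N by (subst map_concat_map) (simp only: concat_map_double, simp add: map_double sl)
  qed
  have F: "map ?f [Bit (q \<in> final (query_nfa \<phi> (2 * c + s))).
        q \<leftarrow> [0..<num_states (query_nfa \<phi> (2 * c + s))]]
     = concat (map (\<lambda>d. map (\<lambda>t. bit_code (slot \<phi> d t = neg_lit (slot \<phi> c s))) [0, 1]) [0..<length \<phi>])"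
  proof -
    have "map ?f [Bit (q \<in> final (query_nfa \<phi> (2 * c + s))). q \<leftarrow> [0..<2 * length \<phi>]]
       = map (\<lambda>q. bit_code (slot_of \<phi> q = neg_lit (slot \<phi> c s))) [0..<2 * length \<phi>]"
      by (auto simp: query_nfa_def bit s0[simplified])
    then show ?thesis unfolding N by (simp add: map_double sl)
  qed
  have H: "?f Hash = 4" "map ?f (unary 1) = [3]" by (simp_all add: cell_code_def unary_def)
  show ?thesis
    unfolding query_codes_def Let_def query_def encode_search.simps map_append list.map A F H
    by (simp only: N un un' H append_assoc append_Cons append_Nil)
qed

definition emit :: "nat \<Rightarrow> ('i, 'o) cmd" where
  "emit v = If (nonzero 11) (Seq (dec_cmd 11) (If (nonzero 11) Skip (assign 15 v))) Skip"

definition emit_bit :: "nat \<Rightarrow> nat \<Rightarrow> nat \<Rightarrow> nat \<Rightarrow> (cnf_sym, 'o) cmd" where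
  "emit_bit V s W t = Seq (compl_cmd V s W t)
     (Seq (If (\<lambda>z sc. sc 14 = 1) (emit 3) (emit 2)) (assign 14 0))"

text \<open>Counter 5 is the source clause and counter 7 the target clause of a transition. A table
  entry is determined by the mate of the target slot, so slot 1 is compared before slot 0. The
  initial state in unary is two strokes per clause before it and possibly one for the slot.\<close>

definition emit_query :: "nat \<Rightarrow> nat \<Rightarrow> (cnf_sym, 'o) cmd" where
  "emit_query V s =
     Seq (emit 0) (Seq (for_cmd 4 5 (Seq (emit 3) (emit 3)))
    (Seq (Seq (emit 4) (Seq (emit 3) (emit 4)))
    (Seq (for_cmd 4 5 (Seq
        (for_cmd 6 7 (Seq (emit_bit 7 1 5 0) (emit_bit 7 0 5 0)))
        (for_cmd 6 7 (Seq (emit_bit 7 1 5 1) (emit_bit 7 0 5 1)))))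
    (Seq (emit 4)
    (Seq (Seq (for_cmd V 8 (Seq (emit 3) (emit 3))) (if s = 0 then Skip else emit 3))
    (Seq (emit 4)
    (Seq (for_cmd 4 5 (Seq (emit_bit V s 5 0) (emit_bit V s 5 1)))
    (Seq (emit 4)
         (for_cmd 4 5 (Seq (emit 3) (emit 3)))))))))))"

text \<open>Counter 11 is set to one more than the head position because the left endmarker is the
  first symbol emitted. Register 15 is preset to 1, the code of the right endmarker, which is the
  correct symbol if the generated word ends before the countdown does.\<close>

definition fetch :: "nat \<Rightarrow> nat \<Rightarrow> (cnf_sym, 'o) cmd" where
  "fetch V s = Seq (for_cmd 10 8 (inc_cmd 11)) (Seq (inc_cmd 11) (Seq (assign 15 1)
     (Seq (emit_query V s) (clear_cmd 11))))"

text \<open>The symbols are emitted one after the other; the one at which counter 11 reaches 0 is kept in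
  register 15.\<close>

definition emitted :: "nat \<Rightarrow> 'o ast \<Rightarrow> 'o ast" where
  "emitted v a = (if vl a 11 = 0 then a else if vl a 11 = 1 then setv 15 v (setv 11 0 a)
     else setv 11 (vl a 11 - 1) a)"

lemma emitted_simps [simp]:
  "pos (emitted v a) = pos a" "mt (emitted v a) = mt a" "wr (emitted v a) = wr a"
  "i \<noteq> 11 \<Longrightarrow> i \<noteq> 15 \<Longrightarrow> vl (emitted v a) i = vl a i" by (auto simp: emitted_def)

lemma emitted_setv:
  "r \<noteq> 11 \<Longrightarrow> r \<noteq> 15 \<Longrightarrow> emitted v (setv r w a) = setv r w (emitted v a)"
  by (auto intro!: ast_eqI simp: emitted_def)

lemma fold_emitted_simps [simp]:
  "pos (fold emitted vs a) = pos a" "mt (fold emitted vs a) = mt a" "wr (fold emitted vs a) = wr a"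
  "i \<noteq> 11 \<Longrightarrow> i \<noteq> 15 \<Longrightarrow> vl (fold emitted vs a) i = vl a i" by (induction vs arbitrary: a) auto

lemma fold_emitted_setv:
  "r \<noteq> 11 \<Longrightarrow> r \<noteq> 15 \<Longrightarrow> fold emitted vs (setv r w a) = setv r w (fold emitted vs a)"
  by (induction vs arbitrary: a) (auto simp: emitted_setv)

text \<open>Emitting a word retains the symbol whose number, counted from 1, is in counter 11, if
  the word is long enough.\<close>

lemma fold_emitted:
  "fold emitted vs a = setv 11 (vl a 11 - length vs)
     (setv 15 (if 0 < vl a 11 \<and> vl a 11 \<le> length vs then vs ! (vl a 11 - 1) else vl a 15) a)"
proof (induction vs arbitrary: a)
  case Nil
  then show ?case by (auto intro!: ast_eqI)
next
  case (Cons v vs)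
  consider "vl a 11 = 0" | "vl a 11 = 1" | n where "vl a 11 = Suc (Suc n)"
    by (metis One_nat_def not0_implies_Suc)
  then show ?case
  proof cases
    case 1
    then have "emitted v a = a" by (simp add: emitted_def)
    then show ?thesis by (auto intro!: ast_eqI simp: Cons 1)
  next
    case 2
    then have "emitted v a = setv 15 v (setv 11 0 a)" by (simp add: emitted_def)
    then show ?thesis by (auto intro!: ast_eqI simp: Cons 2)
  next
    case 3
    then have "emitted v a = setv 11 (Suc n) a" by (simp add: emitted_def)
    then show ?thesis by (auto intro!: ast_eqI simp: Cons 3)
  qed
qed

section \<open>Correctness of the generated symbols\<close>

context formula_vm
begin

text \<open>\<open>g\<close> prescribes all counters and registers except 11 and 15, the only ones
  that emission changes. So emitted words compose by appending, regardless of how far the countdown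
  has got.\<close>

definition emits :: "(nat \<Rightarrow> nat) \<Rightarrow> nat \<Rightarrow> (cnf_sym, bool) cmd \<Rightarrow> nat list \<Rightarrow> bool" where
  "emits g j c vs \<longleftrightarrow> (\<forall>a :: bool ast. pos a = 0 \<and> (\<forall>i<20. i \<noteq> 11 \<and> i \<noteq> 15 \<longrightarrow> vl a i = g i)
     \<longrightarrow> does j c a (fold emitted vs a))"

lemma emits_Skip: "emits g j Skip []"
  by (simp add: emits_def does_Skip)

lemma emits_Seq:
  assumes "emits g i c vs" "emits g j d ws" "i < l" "j < l"
  shows "emits g l (Seq c d) (vs @ ws)"
  unfolding emits_def
proof (intro allI impI)
  fix a :: "bool ast"
  assume a: "pos a = 0 \<and> (\<forall>i<20. i \<noteq> 11 \<and> i \<noteq> 15 \<longrightarrow> vl a i = g i)"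
  then have "does i c a (fold emitted vs a)" using assms(1) by (simp add: emits_def)
  moreover have "does j d (fold emitted vs a) (fold emitted ws (fold emitted vs a))"
    using assms(2) a by (simp add: emits_def)
  ultimately show "does l (Seq c d) a (fold emitted (vs @ ws) a)"
    using assms(3,4) does_Seq by simp
qed

lemma does_emit:
  assumes "v < 6"
  shows "does 3 (emit v) a (emitted v a)"
    unfolding emit_def
  proof (rule does_If[where i = 2])
    assume "nonzero 11 (input_at x (pos a)) (scan k (conc a))"
    then have nz: "vl a 11 \<noteq> 0" by (simp add: cond_nonzero)
    let ?b = "setv 11 (vl a 11 - 1) a"
    have "does 1 (dec_cmd 11) a ?b" using nz by (intro does_dec) auto
    moreover have "does 1 (If (nonzero 11) Skip (assign 15 v)) ?b (emitted v a)"
    proof (rule does_If[where i = 0])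
      assume "nonzero 11 (input_at x (pos ?b)) (scan k (conc ?b))"
      then have "emitted v a = ?b" by (auto simp: cond_nonzero emitted_def)
      then show "does 0 Skip ?b (emitted v a)" by (simp add: does_Skip)
    next
      assume "\<not> nonzero 11 (input_at x (pos ?b)) (scan k (conc ?b))"
      then have "emitted v a = setv 15 v ?b" using nz by (auto simp: cond_nonzero emitted_def)
      then show "does 0 (assign 15 v) ?b (emitted v a)"
        using assms K6 by (auto intro!: does_set_reg)
    qed simp
    ultimately show "does 2 (Seq (dec_cmd 11) (If (nonzero 11) Skip (assign 15 v))) a (emitted v a)"
      by (rule does_Seq) auto
  next
    assume "\<not> nonzero 11 (input_at x (pos a)) (scan k (conc a))"
    then have "emitted v a = a" by (simp add: cond_nonzero emitted_def)
    then show "does 2 Skip a (emitted v a)" by (simp add: does_Skip)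
  qed simp

lemma emits_emit: "v < 6 \<Longrightarrow> emits g 3 (emit v) [v]"
  by (simp add: emits_def does_emit)

lemma emits_for:
  assumes VT: "V < 11" "T < 11" "V \<noteq> T" and n: "n \<le> N" "g V = n" "g T = 0"
    and body: "\<And>i. i < n \<Longrightarrow> emits (g(V := n - i, T := i)) j c (vs i)"
    and l: "j + 4 < l" "2 < j"
  shows "emits g l (for_cmd V T c) (concat (map vs [0..<n]))"
  unfolding emits_def
proof (intro allI impI)
  fix a :: "bool ast"
  assume a: "pos a = 0 \<and> (\<forall>i<20. i \<noteq> 11 \<and> i \<noteq> 15 \<longrightarrow> vl a i = g i)"
  let ?f = "\<lambda>i. fold emitted (concat (map vs [0..<i])) a"
  have "does l (for_cmd V T c) (?f 0) (?f n)"
  proof (rule does_for)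
    fix i assume i: "i < n"
    have "does j c (setv V (n - i) (setv T i (?f i))) (fold emitted (vs i) (setv V (n - i) (setv T i (?f i))))"
      using body[OF i] a VT by (auto simp: emits_def)
    then show "does j c (setv V (n - i) (setv T i (?f i))) (setv V (n - i) (setv T i (?f (Suc i))))"
      using VT by (simp add: fold_emitted_setv)
  qed (use assms a in auto)
  then show "does l (for_cmd V T c) a (fold emitted (concat (map vs [0..<n])) a)" by simp
qed

lemma emits_bit:
  assumes V: "V < 8" "W < 8"
    and g: "g 8 = 0" "g 9 = 0" "g 12 = 0" "g 13 = 0" "g 14 = 0"
    and c: "g V = c" "c < length \<phi>" "g W = d" "d < length \<phi>"
  shows "emits g 21 (emit_bit V s W t) [bit_code (slot \<phi> d t = neg_lit (slot \<phi> c s))]"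
  unfolding emits_def
proof (intro allI impI)
  fix a :: "bool ast"
  assume a: "pos a = 0 \<and> (\<forall>i<20. i \<noteq> 11 \<and> i \<noteq> 15 \<longrightarrow> vl a i = g i)"
  let ?b = "slot \<phi> d t = neg_lit (slot \<phi> c s)"
  let ?a = "setv 14 (if ?b then 1 else 0) a"
  let ?e = "emitted (bit_code ?b) ?a"
  have 1: "does 19 (compl_cmd V s W t) a ?a" using assms a by (intro does_compl) auto
  have 2: "does 4 (If (\<lambda>z sc. sc 14 = 1) (emit 3) (emit 2)) ?a ?e"
    by (rule does_If[where i = 3]) (auto simp: scan_reg bit_code_def intro!: does_emit)
  have 3: "does 4 (assign 14 0) ?e (setv 14 0 ?e)" using K6 by (intro does_set_reg) auto
  have "setv 14 0 ?e = fold emitted [bit_code ?b] a"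
    using a g by (auto simp: emitted_setv setv_id)
  then show "does 21 (emit_bit V s W t) a (fold emitted [bit_code ?b] a)"
    unfolding emit_bit_def using does_Seq[OF 1 does_Seq[OF 2 3, of 5], of 21] by simp
qed

lemma emits_query:
  assumes V: "V = 1 \<or> V = 3" "s < 2"
    and g: "g 8 = 0" "g 9 = 0" "g 12 = 0" "g 13 = 0" "g 14 = 0" "g 5 = 0" "g 7 = 0"
      "g 4 = length \<phi>" "g 6 = length \<phi>"
    and c: "g V = c" "c < length \<phi>"
  shows "emits g 60 (emit_query V s) (query_codes \<phi> c s)"
proof -
  let ?C = "length \<phi>"
  have 33: "emits h 4 (Seq (emit 3) (emit 3)) ([3] @ [3])" for h
    by (intro emits_Seq[where i = 3 and j = 3] emits_emit) auto
  have un: "emits g 10 (for_cmd 4 5 (Seq (emit 3) (emit 3))) (concat (map (\<lambda>_. [3] @ [3]) [0..<?C]))"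
    using g length_le_N 33 by (intro emits_for[where j = 4]) auto
  have 434: "emits g 10 (Seq (emit 4) (Seq (emit 3) (emit 4))) ([4] @ [3] @ [4])"
    by (intro emits_Seq[where i = 3 and j = 4] emits_Seq[where i = 3 and j = 3] emits_emit) auto
  have row: "emits (g(4 := ?C - d, 5 := d)) 30
      (for_cmd 6 7 (Seq (emit_bit 7 1 5 t) (emit_bit 7 0 5 t)))
      (concat (map (\<lambda>e. [bit_code (slot \<phi> d t = neg_lit (slot \<phi> e 1))] @
         [bit_code (slot \<phi> d t = neg_lit (slot \<phi> e 0))]) [0..<?C]))" if "d < ?C" for d t
    using g length_le_N that
    by (intro emits_for[where j = 22] emits_Seq[where i = 21 and j = 21] emits_bit) auto
  have table: "emits g 40 (for_cmd 4 5 (Seq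
        (for_cmd 6 7 (Seq (emit_bit 7 1 5 0) (emit_bit 7 0 5 0)))
        (for_cmd 6 7 (Seq (emit_bit 7 1 5 1) (emit_bit 7 0 5 1)))))
     (concat (map (\<lambda>d. concat (map (\<lambda>e. [bit_code (slot \<phi> d 0 = neg_lit (slot \<phi> e 1))] @
         [bit_code (slot \<phi> d 0 = neg_lit (slot \<phi> e 0))]) [0..<?C])
       @ concat (map (\<lambda>e. [bit_code (slot \<phi> d 1 = neg_lit (slot \<phi> e 1))] @
         [bit_code (slot \<phi> d 1 = neg_lit (slot \<phi> e 0))]) [0..<?C])) [0..<?C]))"
    using g length_le_N by (intro emits_for[where j = 31] emits_Seq[where i = 30 and j = 30] row) auto
  have init: "emits g 11 (Seq (for_cmd V 8 (Seq (emit 3) (emit 3))) (if s = 0 then Skip else emit 3))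
     (concat (map (\<lambda>_. [3] @ [3]) [0..<c]) @ (if s = 0 then [] else [3]))"
  proof (rule emits_Seq[where i = 10 and j = 10])
    show "emits g 10 (for_cmd V 8 (Seq (emit 3) (emit 3))) (concat (map (\<lambda>_. [3] @ [3]) [0..<c]))"
      using g c V length_le_N 33 by (intro emits_for[where j = 4]) auto
    have "emits g 10 (emit 3) [3]"
      using emits_emit[of 3 g] does_mono[of 3 _ _ _ 10] unfolding emits_def by auto
    then show "emits g 10 (if s = 0 then Skip else emit 3) (if s = 0 then [] else [3])"
      using emits_Skip by auto
  qed auto
  have fin: "emits g 40 (for_cmd 4 5 (Seq (emit_bit V s 5 0) (emit_bit V s 5 1)))
      (concat (map (\<lambda>d. [bit_code (slot \<phi> d 0 = neg_lit (slot \<phi> c s))] @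
         [bit_code (slot \<phi> d 1 = neg_lit (slot \<phi> c s))]) [0..<?C]))" using g c V length_le_N
    by (intro emits_for[where j = 22] emits_Seq[where i = 21 and j = 21] emits_bit) auto
  have em: "emits g 3 (emit 0) [0]" "emits g 3 (emit 4) [4]" by (auto intro: emits_emit)
  note 1 = emits_Seq[OF em(2) un, of 50]
  note 2 = emits_Seq[OF fin 1, of 51]
  note 3 = emits_Seq[OF em(2) 2, of 52]
  note 4 = emits_Seq[OF init 3, of 53]
  note 5 = emits_Seq[OF em(2) 4, of 54]
  note 6 = emits_Seq[OF table 5, of 55]
  note 7 = emits_Seq[OF 434 6, of 56]
  note 8 = emits_Seq[OF un 7, of 57]
  note 9 = emits_Seq[OF em(1) 8, of 60]
  show ?thesis using 9 unfolding emit_query_def query_codes_def Let_def by simp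
qed

lemma input_at_query:
  assumes "s < 2"
  shows "cell_code (input_at (query_code \<phi> (2 * c + s)) p) =
    (if p < length (query_codes \<phi> c s) then query_codes \<phi> c s ! p else 1)"
  unfolding query_codes_eq[OF assms] input_at_def by (cases p) (auto simp: cell_code_def)

lemma does_fetch:
  fixes a :: "bool ast"
  assumes V: "V = 1 \<or> V = 3" "s < 2"
    and a: "pos a = 0" "vl a 8 = 0" "vl a 9 = 0" "vl a 12 = 0" "vl a 13 = 0" "vl a 14 = 0" "vl a 5 = 0"
      "vl a 7 = 0" "vl a 11 = 0" "vl a 4 = length \<phi>" "vl a 6 = length \<phi>"
    and c: "vl a V = c" "c < length \<phi>" and p: "vl a 10 = p" "p < N"
  shows "does 70 (fetch V s) a
    (setv 15 (cell_code (input_at (query_code \<phi> (2 * c + s)) p)) a)"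
proof -
  let ?q = "query_codes \<phi> c s"
  have "does 8 (for_cmd 10 8 (inc_cmd 11)) (setv 11 0 a) (setv 11 p a)"
  proof (rule does_for[where j = 3])
    fix i assume "i < p"
    then have "does 1 (inc_cmd 11) (setv 10 (p - i) (setv 8 i (setv 11 i a)))
        (setv 11 (Suc i) (setv 10 (p - i) (setv 8 i (setv 11 i a))))"
      using does_inc[of 11 "setv 10 (p - i) (setv 8 i (setv 11 i a))"] p by simp
    then show "does 3 (inc_cmd 11) (setv 10 (p - i) (setv 8 i (setv 11 i a)))
        (setv 10 (p - i) (setv 8 i (setv 11 (Suc i) a)))"
      using does_mono[of 1 _ _ _ 3] by (simp add: setv_commute[of 11])
  qed (use a p in auto)
  then have 1: "does 8 (for_cmd 10 8 (inc_cmd 11)) a (setv 11 p a)" using a by (simp add: setv_id)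
  have 2: "does 8 (inc_cmd 11) (setv 11 p a) (setv 11 (Suc p) a)"
    using does_mono[OF does_inc[of 11 "setv 11 p a"], of 8] p by simp
  let ?b = "setv 15 1 (setv 11 (Suc p) a)"
  have 3: "does 8 (assign 15 1) (setv 11 (Suc p) a) ?b" using K6 by (intro does_set_reg) auto
  have 4: "does 60 (emit_query V s) ?b (fold emitted ?q ?b)"
  proof -
    have "emits (vl a) 60 (emit_query V s) ?q" using assms by (intro emits_query) auto
    moreover have "pos ?b = 0 \<and> (\<forall>i<20. i \<noteq> 11 \<and> i \<noteq> 15 \<longrightarrow> vl ?b i = vl a i)" using a by simp
    ultimately show ?thesis unfolding emits_def by blast
  qed
  have 5: "does 60 (clear_cmd 11) (fold emitted ?q ?b) (setv 11 0 (fold emitted ?q ?b))"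
    using does_mono[OF does_clear[of 11 "fold emitted ?q ?b"], of 60] by simp
  have "setv 11 0 (fold emitted ?q ?b) =
      setv 15 (cell_code (input_at (query_code \<phi> (2 * c + s)) p)) a"
    by (rule ast_eqI) (use a in \<open>auto simp: input_at_query[OF V(2)] fold_emitted\<close>)
  then show ?thesis unfolding fetch_def
    using does_Seq[OF 1 does_Seq[OF 2 does_Seq[OF 3 does_Seq[OF 4 5, of 61], of 62], of 63], of 70]
    by simp
qed

end

section \<open>Simulating the search machine\<close>

text \<open>Keeps everything a transition receives in the range to which \<open>wf_tm\<close>
  applies; hence all states and symbols met in a run can be stored below \<open>K\<close>.\<close>

definition tm_inv :: "('i, 'o) tm \<Rightarrow> 'i list \<Rightarrow> 'o config \<Rightarrow> bool" where
  "tm_inv M w c \<longleftrightarrow> cur_state c \<in> states M \<and> input_head c \<le> length w + 1 \<and>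
     length (tapes c) = work_tapes M \<and>
     (\<forall>j<work_tapes M. \<forall>i. fst (tapes c ! j) i \<in> work_symbols M)"

lemma transition_wf:
  assumes "wf_tm M" "tm_inv M w c"
    and "transition M (cur_state c) z (map (\<lambda>tp. fst tp (snd tp)) (tapes c)) = (q, d, acts, b)"
  shows "q \<in> states M" "length acts = work_tapes M" "\<And>j. j < work_tapes M \<Longrightarrow> fst (acts ! j) \<in> work_symbols M"
proof -
  let ?ss = "map (\<lambda>tp. fst tp (snd tp)) (tapes c)"
  have "length ?ss = work_tapes M" "set ?ss \<subseteq> work_symbols M"
    using assms(2) by (auto simp: tm_inv_def in_set_conv_nth) (metis fst_conv)
  then have len: "length ?ss = work_tapes M \<and> set ?ss \<subseteq> work_symbols M" by simp
  have q: "cur_state c \<in> states M" using assms(2) by (simp add: tm_inv_def)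
  have "\<forall>q \<in> states M. \<forall>z ss. length ss = work_tapes M \<and> set ss \<subseteq> work_symbols M \<longrightarrow>
        (case transition M q z ss of (q', d, acts, b) \<Rightarrow>
           q' \<in> states M \<and> length acts = work_tapes M \<and> fst ` set acts \<subseteq> work_symbols M)"
    using assms(1) unfolding wf_tm_def by (elim conjE)
  from this[rule_format, OF q len, of z]
  have *: "q \<in> states M \<and> length acts = work_tapes M \<and> fst ` set acts \<subseteq> work_symbols M"
    by (simp add: assms(3))
  then show "q \<in> states M" "length acts = work_tapes M" by auto
  show "fst (acts ! j) \<in> work_symbols M" if "j < work_tapes M" for j
    using * that nth_mem[of j acts] by auto
qed

lemma tm_inv_step:
  assumes "wf_tm M" "tm_inv M w c"
  shows "tm_inv M w (step M w c)"
proof (cases "cur_state c \<in> halt_states M")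
  case True
  then show ?thesis using assms by (simp add: step_def)
next
  case False
  obtain q d acts b where t: "transition M (cur_state c) (input_at w (input_head c))
      (map (\<lambda>tp. fst tp (snd tp)) (tapes c)) = (q, d, acts, b)" using prod_cases4 by blast
  note wf = transition_wf[OF assms t]
  show ?thesis using False t wf assms(2) by (auto simp: step_def tm_inv_def act_on_tape_def)
qed

lemma tm_inv_run:
  assumes "wf_tm M"
  shows "tm_inv M w (run M w t)"
proof (induction t)
  case 0
  show ?case using assms by (auto simp: run_def initial_config_def tm_inv_def wf_tm_def)
next
  case (Suc t)
  then show ?case using tm_inv_step[OF assms] by (simp add: run_def)
qed

definition cell_decode :: "nat \<Rightarrow> nfa_sym input_cell" where
  "cell_decode v = (if v = 0 then LeftEnd else if v = 1 then RightEnd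
     else if v = 4 then Letter Hash else Letter (Bit (v = 3)))"

lemma cell_decode_code [simp]: "cell_decode (cell_code z) = z"
  by (auto simp: cell_decode_def cell_code_def split: input_cell.splits nfa_sym.splits)

definition dir_code :: "dir \<Rightarrow> nat" where
  "dir_code d = (case d of Stay \<Rightarrow> 0 | MoveL \<Rightarrow> 1 | MoveR \<Rightarrow> 2)"

lemma dir_code_eq [simp]: "dir_code d = 1 \<longleftrightarrow> d = MoveL" "dir_code d = 2 \<longleftrightarrow> d = MoveR"
  "dir_code d = Suc 0 \<longleftrightarrow> d = MoveL" by (cases d; simp add: dir_code_def)+

text \<open>Subtracting 2 undoes the shift of stored symbols; being truncated, it also reads an
  unvisited blank cell as 0. Of the output only the occurrence of \<open>Bot\<close> is recorded, in
  register 18.\<close>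

definition sim_act :: "(nfa_sym, out_sym) tm \<Rightarrow> (nat \<Rightarrow> nat) \<Rightarrow> bool act" where
  "sim_act M sc = (case transition M (sc 16) (cell_decode (sc 15))
       (map (\<lambda>j. sc (20 + j) - 2) [0..<work_tapes M]) of (q, d, acts, b) \<Rightarrow>
     (Stay, (\<lambda>i. if i = 16 then Some (q, Stay)
            else if i = 17 then Some (dir_code d, Stay)
            else if i = 18 \<and> b = Some Bot then Some (1, Stay)
            else if 20 \<le> i \<and> i < 20 + work_tapes M
              then Some (fst (acts ! (i - 20)) + 2, snd (acts ! (i - 20)))
            else None), None))"

text \<open>A move to the left from simulated cell 0 takes the real head onto the marker 1, and the
  second act pushes it back. The marker cannot be confused with contents, since stored symbols are
  at least 2.\<close>

definition sim_step :: "(nfa_sym, out_sym) tm \<Rightarrow> (cnf_sym, bool) cmd" where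
  "sim_step M = Seq (Prim (\<lambda>z sc. sim_act M sc))
     (Prim (\<lambda>z sc. (Stay, (\<lambda>i. if 20 \<le> i \<and> sc i = 1 then Some (1, MoveR) else None), None)))"

text \<open>Counter 10 follows the confined input head: it stays at 0 on a move to the left, and at
  the right endmarker (code 1 in register 15) on a move to the right. The length of the simulated
  input is thus never computed.\<close>

definition head_update :: "(cnf_sym, bool) cmd" where
  "head_update = If (\<lambda>z sc. sc 17 = 1) (If (nonzero 10) (dec_cmd 10) Skip)
     (If (\<lambda>z sc. sc 17 = 2 \<and> sc 15 \<noteq> 1) (inc_cmd 10) Skip)"

text \<open>Visited cells are nonblank and contiguous behind the marker, so the first blank to the
  right marks their end, and erasing back to the marker leaves a fresh tape.\<close>

definition clear_tape :: "nat \<Rightarrow> ('i, 'o) cmd" where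
  "clear_tape r = Seq (While (\<lambda>z sc. sc r \<noteq> 0) (move_on r MoveR))
     (Seq (While (\<lambda>z sc. sc r \<noteq> 1) (put_symbol r 0 MoveL)) (move_on r MoveR))"

abbreviation sim_round :: "(nfa_sym, out_sym) tm \<Rightarrow> nat \<Rightarrow> nat \<Rightarrow> (cnf_sym, bool) cmd" where
  "sim_round M V s \<equiv> Seq (fetch V s) (Seq (sim_step M) (Seq head_update
     (Seq (assign 15 0) (assign 17 0))))"

definition query_cmd :: "(nfa_sym, out_sym) tm \<Rightarrow> nat \<Rightarrow> nat \<Rightarrow> (cnf_sym, bool) cmd" where
  "query_cmd M V s =
     Seq (assign 16 (start_state M)) (Seq (assign 18 0)
    (Seq (While (\<lambda>z sc. sc 16 \<notin> halt_states M)
       (sim_round M V s))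
    (Seq (clear_cmd 10) (Seq (assign 16 0)
       (foldr (\<lambda>j c. Seq (clear_tape (20 + j)) c) [0..<work_tapes M] Skip)))))"

abbreviation blank_tape :: "(nat \<Rightarrow> nat) \<times> nat \<times> nat" where
  "blank_tape \<equiv> (\<lambda>_. 0, 0, 0)"

section \<open>Correctness of the simulation\<close>

context formula_vm
begin

lemma mtape_step:
  assumes "mt_ok (f, h, m)"
  shows "(fst (mtape (f, h, m)))(Suc h := v + 2) = fst (mtape (f(h := v), move d h, max m (Suc h)))"
    and "move d (Suc h) \<noteq> 0 \<Longrightarrow> snd (mtape (f(h := v), move d h, max m (Suc h))) = move d (Suc h)"
    and "move d (Suc h) = 0 \<Longrightarrow> snd (mtape (f(h := v), move d h, max m (Suc h))) = 1"
proof -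
  have h: "h \<le> m" using assms by (simp add: mt_ok_def)
  show "(fst (mtape (f, h, m)))(Suc h := v + 2) = fst (mtape (f(h := v), move d h, max m (Suc h)))"
  proof
    fix p
    show "((fst (mtape (f, h, m)))(Suc h := v + 2)) p = fst (mtape (f(h := v), move d h, max m (Suc h))) p"
      using h by (cases p) (auto simp: mtape_def)
  qed
  show "snd (mtape (f(h := v), move d h, max m (Suc h))) = move d (Suc h)" if "move d (Suc h) \<noteq> 0"
    using that by (cases d) (simp_all add: mtape_def)
  show "snd (mtape (f(h := v), move d h, max m (Suc h))) = 1" if "move d (Suc h) = 0"
    using that by (cases d) (simp_all add: mtape_def)
qed

lemma mtape_marker: "fst (mtape q) p = 1 \<longleftrightarrow> p = 0"
  by (cases q; cases p) (auto simp: mtape_def)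

lemma does_clear_tape:
  assumes "j < k - 20"
  shows "does 5 (clear_tape (20 + j)) a (a\<lparr>mt := (mt a)(j := blank_tape)\<rparr>)"
  unfolding does_def
proof (intro impI conjI)
  let ?r = "20 + j"
  assume ok: "ok a"
  show "ok (a\<lparr>mt := (mt a)(j := blank_tape)\<rparr>)" using ok B2 by (auto simp: ok_def mt_ok_def)
  obtain f h m where q: "mt a j = (f, h, m)" by (metis prod_cases3)
  have m: "h \<le> m" "m < B" "\<And>i. i < m \<Longrightarrow> f i + 2 < K"
    using ok assms q by (auto simp: ok_def mt_ok_def)
  have rk: "?r < k" using assms by simp
  define g where "g = fst (mtape (f, h, m))"
  have g: "g 0 = 1" "\<And>i. g (Suc i) = (if i < m then f i + 2 else 0)"
    by (simp_all add: g_def mtape_def)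
  have gK: "g i < K" for i using m(3)[of "i - 1"] K6 g by (cases i) auto
  have conc: "conc (a\<lparr>mt := (mt a)(j := p)\<rparr>) = put (conc a) ?r (mtape p)" for p
    by (auto simp: conc_def put_def fun_eq_iff)
  have start: "conc a = put (conc a) ?r (g, Suc h)"
    using conc[of "(f, h, m)"] q by (simp add: g_def mtape_def fun_upd_idem)
  have pos: "ihd (conc a) \<le> length x + 1" using ok by (simp add: ok_def)
  note hl = heads_le_conc[OF ok]
  let ?s = "\<lambda>i. put (conc a) ?r (g, Suc h + i)"
  have 1: "timed (Z ^ 3) (While (\<lambda>z sc. sc ?r \<noteq> 0) (move_on ?r MoveR)) (?s 0) (?s (m - h))"
  proof (rule takes_While[where T = 1])
    fix i assume "i < m - h"
    then show "timed 1 (move_on ?r MoveR) (?s i) (?s (Suc i))"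
      using takes_move_on[OF rk hl, of "Suc h + i" MoveR g] m pos gK by simp
    show "scan k (?s i) ?r \<noteq> 0" using \<open>i < m - h\<close> rk g(2)[of "h + i"] by simp
  next
    show "\<not> scan k (?s (m - h)) ?r \<noteq> 0" using m(1) rk g(2)[of m] by simp
    have "(m - h) * 3 + 1 \<le> Z" using m Z by auto
    then show "(m - h) * (1 + 2) + 1 \<le> Z ^ 3" using Z_power[of 1 3] by simp
  qed (use hl m in \<open>auto intro: heads_le_put\<close>)
  \<comment> \<open>Contents after \<open>i\<close> erasing steps. They start on the blank cell
    \<open>Suc m\<close>, so \<open>Suc m\<close> of them bring the head to the marker in cell
    0.\<close>
  let ?g = "\<lambda>i p. if p = 0 then 1 else if p + i \<le> Suc m then g p else 0"
  let ?t = "\<lambda>i. put (conc a) ?r (?g i, Suc m - i)"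
  have 2: "timed (Z ^ 3) (While (\<lambda>z sc. sc ?r \<noteq> 1) (put_symbol ?r 0 MoveL)) (?t 0) (?t (Suc m))"
  proof (rule takes_While[where T = 1])
    fix i assume i: "i < Suc m"
    have "?g (Suc i) = (?g i)(Suc m - i := 0)" using i by (auto simp: fun_eq_iff)
    then show "timed 1 (put_symbol ?r 0 MoveL) (?t i) (?t (Suc i))"
      using takes_put_symbol[OF rk hl, of "Suc m - i" MoveL 0 "?g (Suc i)" "?g i"] m pos K6 by simp
    show "scan k (?t i) ?r \<noteq> 1" using i rk g(2)[of "m - i"] by (simp add: Suc_diff_le)
  next
    have "Suc m * 3 + 1 \<le> Z" using m Z by auto
    then show "Suc m * (1 + 2) + 1 \<le> Z ^ 3" using Z_power[of 1 3] by simp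
  qed (use hl rk in \<open>auto intro: heads_le_put\<close>)
  let ?b = "fst (mtape blank_tape)"
  have b: "?b = ?g (Suc m)" by (auto simp: mtape_def fun_eq_iff split: nat.split)
  have "timed 1 (move_on ?r MoveR) (put (conc a) ?r (?b, 0)) (put (conc a) ?r (?b, Suc 0))"
    using takes_move_on[OF rk hl, of 0 MoveR ?b] pos K6 B2 by (simp add: mtape_def)
  then have "timed (Z ^ 3) (move_on ?r MoveR) (put (conc a) ?r (?b, 0))
      (put (conc a) ?r (?b, Suc 0))" by (rule takes_mono) (use Z_power[of 0 3] in simp)
  moreover have "mtape blank_tape = (?b, Suc 0)" by (simp add: mtape_def)
  ultimately have 3: "timed (Z ^ 3) (move_on ?r MoveR) (?t (Suc m))
      (conc (a\<lparr>mt := (mt a)(j := blank_tape)\<rparr>))" unfolding conc by (simp only: b diff_self_eq_0)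
  have "?s (m - h) = ?t 0"
  proof -
    have "g = ?g 0"
    proof
      fix p show "g p = ?g 0 p" using g by (cases p) auto
    qed
    then show ?thesis using m(1) by simp
  qed
  moreover have "?s 0 = conc a" using start by simp
  moreover have "Z ^ 3 + (Z ^ 3 + Z ^ 3 + 1) + 1 \<le> Z ^ 5"
  proof -
    have "Z ^ 3 * 5 \<le> Z ^ 3 * Z ^ 2" using Z_ge Z_power[of 1 2] by (intro mult_le_mono) auto
    moreover have "Z ^ 3 * Z ^ 2 = Z ^ 5" "1 \<le> Z ^ 3" using Z_ge by (simp_all flip: power_add)
    ultimately show ?thesis by linarith
  qed
  ultimately show "timed (Z ^ 5) (clear_tape ?r) (conc a) (conc (a\<lparr>mt := (mt a)(j := blank_tape)\<rparr>))"
    using takes_Seq[OF 1 takes_Seq[OF _ 3 order_refl]] 2 unfolding clear_tape_def by simp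
qed

lemma does_clear_tapes:
  assumes "n \<le> k - 20"
  shows "does (6 + n) (foldr (\<lambda>j c. Seq (clear_tape (20 + j)) c) [0..<n] Skip) a
    (a\<lparr>mt := (\<lambda>j. if j < n then blank_tape else mt a j)\<rparr>)"
proof -
  have "does (6 + length js) (foldr (\<lambda>j c. Seq (clear_tape (20 + j)) c) js Skip) a
      (a\<lparr>mt := (\<lambda>j. if j \<in> set js then blank_tape else mt a j)\<rparr>)"
    if "set js \<subseteq> {..<k - 20}" for js using that
  proof (induction js arbitrary: a)
    case Nil
    then show ?case using does_Skip[of _ a] by simp
  next
    case (Cons j js)
    let ?a = "a\<lparr>mt := (mt a)(j := blank_tape)\<rparr>"
    have "does 5 (clear_tape (20 + j)) a ?a" using Cons.prems by (intro does_clear_tape) auto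
    moreover have "does (6 + length js) (foldr (\<lambda>j c. Seq (clear_tape (20 + j)) c) js Skip) ?a
        (?a\<lparr>mt := (\<lambda>i. if i \<in> set js then blank_tape else mt ?a i)\<rparr>)"
      by (rule Cons.IH) (use Cons.prems in auto)
    moreover have "?a\<lparr>mt := (\<lambda>i. if i \<in> set js then blank_tape else mt ?a i)\<rparr>
        = a\<lparr>mt := (\<lambda>i. if i \<in> set (j # js) then blank_tape else mt a i)\<rparr>"
      by (auto intro!: ast_eqI)
    ultimately show ?case using does_Seq[of 5 "clear_tape (20 + j)" a ?a] by simp
  qed
  moreover have "set [0..<n] \<subseteq> {..<k - 20}" using assms by auto
  ultimately have "does (6 + length [0..<n]) (foldr (\<lambda>j c. Seq (clear_tape (20 + j)) c) [0..<n] Skip) a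
      (a\<lparr>mt := (\<lambda>j. if j \<in> set [0..<n] then blank_tape else mt a j)\<rparr>)" by blast
  then show ?thesis by simp
qed

lemma does_sim_step:
  assumes M: "wf_tm M" "k = 20 + work_tapes M" "\<And>q. q \<in> states M \<Longrightarrow> q < K"
      "\<And>v. v \<in> work_symbols M \<Longrightarrow> v + 2 < K"
    and c: "tm_inv M w c" "\<And>j. j < work_tapes M \<Longrightarrow> mt b j = (fst (tapes c ! j), snd (tapes c ! j), m j)"
      "\<And>j. j < work_tapes M \<Longrightarrow> snd (tapes c ! j) + 2 \<le> B"
      "vl b 16 = cur_state c" "vl b 15 = cell_code z"
    and t: "transition M (cur_state c) z (map (\<lambda>tp. fst tp (snd tp)) (tapes c)) = (q, d, acts, e)"
    and b': "b' = setv 16 q (setv 17 (dir_code d) (setv 18 (if e = Some Bot then 1 else vl b 18)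
      (b\<lparr>mt := (\<lambda>j. if j < work_tapes M
         then (case act_on_tape (tapes c ! j) (acts ! j) of (f, h) \<Rightarrow> (f, h, max (m j) (Suc (snd (tapes c ! j)))))
         else mt b j)\<rparr>)))"
  shows "does 5 (sim_step M) b b'"
  unfolding does_def
proof (intro impI)
  assume ok: "ok b"
  have k: "i < k \<longleftrightarrow> i < 20 + work_tapes M" "j < k - 20 \<longleftrightarrow> j < work_tapes M" for i j
    using M(2) by auto
  note wf = transition_wf[OF M(1) c(1) t]
  have mtb: "mt_ok (fst (tapes c ! j), snd (tapes c ! j), m j)" if "j < work_tapes M" for j
    proof -
    have "mt_ok (mt b j)" using ok that by (simp add: ok_def k)
    then show ?thesis using c(2)[OF that] by simp
  qed
  have len: "length (tapes c) = work_tapes M" using c(1) by (simp add: tm_inv_def)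
  have sc: "scan k (conc b) (20 + j) - 2 = fst (tapes c ! j) (snd (tapes c ! j))" if "j < work_tapes M" for j
    using mtb[OF that] c(2)[OF that] that by (simp add: scan_def conc_def mtape_def mt_ok_def k)
  have "map (\<lambda>j. scan k (conc b) (20 + j) - 2) [0..<work_tapes M] = map (\<lambda>tp. fst tp (snd tp)) (tapes c)"
    by (rule nth_equalityI) (use sc len in auto)
  then have act: "sim_act M (scan k (conc b)) = (Stay, (\<lambda>i. if i = 16 then Some (q, Stay)
            else if i = 17 then Some (dir_code d, Stay)
            else if i = 18 \<and> e = Some Bot then Some (1, Stay)
            else if 20 \<le> i \<and> i < 20 + work_tapes M
              then Some (fst (acts ! (i - 20)) + 2, snd (acts ! (i - 20)))
            else None), None)" using t c(4,5) by (simp add: sim_act_def scan_reg)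
  define s1 where "s1 = act_store K x (sim_act M (scan k (conc b))) (conc b)"
  let ?A' = "\<lambda>sc. (Stay, (\<lambda>i. if 20 \<le> i \<and> sc i = 1 then Some (1, MoveR) else None), None) :: bool act"
  have conc_tps: "tps (conc a) i = (if i < 12 then (list_tape 3 (digits (vl a i)), 1)
      else if i < 20 then (list_tape (vl a i) [], 0) else mtape (mt a (i - 20)))" for a :: "bool ast" and i
    by (simp add: conc_def)
  have s1_tps: "tps s1 i = (case (if i = 16 then Some (q, Stay)
            else if i = 17 then Some (dir_code d, Stay)
            else if i = 18 \<and> e = Some Bot then Some (1, Stay)
            else if 20 \<le> i \<and> i < 20 + work_tapes M
              then Some (fst (acts ! (i - 20)) + 2, snd (acts ! (i - 20)))
            else None) of None \<Rightarrow> tps (conc b) i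
        | Some (v, e) \<Rightarrow> act_on_tape (tps (conc b) i) (clip K v, e))" for i
    by (simp add: s1_def act act_store_def)
  have s1_rest: "ihd s1 = ihd (conc b)" "outp s1 = outp (conc b)"
    using ok by (simp_all add: s1_def act act_store_def ok_def)
  have qK: "q < K" using M(3) wf(1) by simp
  have dK: "dir_code d < K" using K6 by (cases d) (auto simp: dir_code_def)
  have pos: "pos b \<le> length x + 1" using ok by (simp add: ok_def)
  have tps1: "tps s1 (20 + j) =
      ((fst (mtape (mt b j)))(Suc (snd (tapes c ! j)) := fst (acts ! j) + 2),
       move (snd (acts ! j)) (Suc (snd (tapes c ! j))))" if j: "j < work_tapes M" for j
    using c(2)[OF j] wf(3)[OF j] M(4) j
    by (simp add: s1_tps conc_tps act_on_tape_def clip_def mtape_def)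
  have tps1': "tps s1 i = tps (conc b') i" if "i < 20 \<or> 20 + work_tapes M \<le> i" for i
    using that qK dK K6 b'
    by (auto simp: s1_tps conc_tps act_on_tape_def clip_def fun_eq_iff list_tape_def
        split: nat.split)
  have hl1: "heads_le k B s1" unfolding heads_le_def
  proof (intro allI impI)
    fix i assume i: "i < k"
    show "snd (tps s1 i) \<le> B"
    proof (cases "i < 20")
      case True
      then show ?thesis using tps1'[of i] B2 by (auto simp: conc_tps)
    next
      case False
      then obtain j where j: "i = 20 + j" "j < work_tapes M" using i k that[of "i - 20"] by auto
      then show ?thesis using tps1[OF j(2)] c(3)[OF j(2)] by (cases "snd (acts ! j)") auto
    qed
  qed
  have tps2: "tps (act_store K x (?A' (scan k s1)) s1) i = tps (conc b') i" for i
  proof (cases "i < 20 \<or> 20 + work_tapes M \<le> i")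
    case True
    then show ?thesis using tps1'[of i] by (auto simp: act_store_def scan_def k)
  next
    case False
    then obtain j where j: "i = 20 + j" "j < work_tapes M" using that[of "i - 20"] by auto
    let ?f = "fst (tapes c ! j)" and ?h = "snd (tapes c ! j)" and ?v = "fst (acts ! j)" and ?d = "snd (acts ! j)"
    let ?q = "(?f(?h := ?v), move ?d ?h, max (m j) (Suc ?h))"
    have mt: "mt b' j = ?q" using j b' by (simp add: act_on_tape_def)
    note step = mtape_step[OF mtb[OF j(2)], where v = ?v and d = ?d]
    have 1: "tps s1 i = (fst (mtape ?q), move ?d (Suc ?h))"
      using tps1[OF j(2)] step(1) c(2)[OF j(2)] j(1) by simp
    have s: "scan k s1 i = 1 \<longleftrightarrow> move ?d (Suc ?h) = 0"
      using 1 j mtape_marker[unfolded One_nat_def] by (simp add: scan_def k)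
    have m0: "fst (mtape ?q) 0 = 1" by (simp only: mtape_marker)
    have "tps (conc b') i = mtape ?q" using j mt by (simp add: conc_tps)
    also have "\<dots> = tps (act_store K x (?A' (scan k s1)) s1) i"
    proof (cases "move ?d (Suc ?h) = 0")
      case True
      then have "mtape ?q = (fst (mtape ?q), 1)" using step(3) by (metis prod.collapse)
      then show ?thesis
        using True s 1 m0 j K6 by (simp add: act_store_def act_on_tape_def clip_def fun_upd_idem)
    next
      case False
      then have "mtape ?q = (fst (mtape ?q), move ?d (Suc ?h))"
        using step(2) by (metis prod.collapse)
      then show ?thesis using False s 1 by (simp add: act_store_def)
    qed
    finally show ?thesis by simp
  qed
  have ok': "ok b'" unfolding ok_def
  proof (intro conjI allI impI)
    fix j assume "j < k - 20"
    then have j: "j < work_tapes M" by (simp add: k)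
    show "mt_ok (mt b' j)" using mtb[OF j] c(3)[OF j] wf(3)[OF j] M(4)[of "fst (acts ! j)"] b' j
      by (cases "snd (acts ! j)") (auto simp: act_on_tape_def mt_ok_def)
  qed (use ok b' in \<open>auto simp: ok_def\<close>)
  have eq: "act_store K x (?A' (scan k s1)) s1 = conc b'"
    proof -
    have "tps (act_store K x (?A' (scan k s1)) s1) = tps (conc b')" using tps2 by auto
    moreover have "ihd (act_store K x (?A' (scan k s1)) s1) = ihd (conc b')"
      "outp (act_store K x (?A' (scan k s1)) s1) = outp (conc b')"
      using pos b' by (simp_all add: act_store_def s1_rest, simp_all add: conc_def)
    ultimately show ?thesis by (simp add: store.equality)
  qed
  have "timed 1 (Prim (\<lambda>z sc. sim_act M sc)) (conc b) s1"
    using heads_le_conc[OF ok] hl1 by (intro takes_Prim) (simp_all add: s1_def)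
  moreover have "timed 1 (Prim (\<lambda>z sc. ?A' sc)) s1 (conc b')"
    using hl1 heads_le_conc[OF ok'] eq by (intro takes_Prim) simp_all
  moreover have "1 + 1 + 1 \<le> Z ^ 5" using Z_power[of 1 5] Z_ge by simp
  ultimately have "timed (Z ^ 5) (sim_step M) (conc b) (conc b')"
    unfolding sim_step_def by (rule takes_Seq)
  then show "ok b' \<and> timed (Z ^ 5) (sim_step M) (conc b) (conc b')" using ok' by simp
qed

lemma does_head_update:
  assumes "vl b 17 = dir_code d" "vl b 15 = cell_code (input_at w (vl b 10))"
    and p: "vl b 10 \<le> length w + 1" "length w + 1 \<le> N"
  shows "does 5 head_update b (setv 10 (min (length w + 1) (move d (vl b 10))) b)"
proof -
  let ?r = "min (length w + 1) (move d (vl b 10))"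
  have "cell_code (input_at w (vl b 10)) = 1 \<longleftrightarrow> length w < vl b 10"
    by (auto simp: input_at_def cell_code_def split: nfa_sym.splits)
  then have sc: "scan k (conc b) 17 = dir_code d" "scan k (conc b) 15 = Suc 0 \<longleftrightarrow> length w < vl b 10"
    using assms(1,2) by (simp_all add: scan_reg)
  show ?thesis unfolding head_update_def
  proof (rule does_If[where i = 3])
    assume "scan k (conc b) 17 = 1"
    then have d: "d = MoveL" by (simp add: sc)
    show "does 3 (If (nonzero 10) (dec_cmd 10) Skip) b (setv 10 ?r b)"
    proof (rule does_If[where i = 1])
      assume "nonzero 10 (input_at x (pos b)) (scan k (conc b))"
      then have "vl b 10 \<noteq> 0" by (simp add: cond_nonzero)
      moreover have "?r = vl b 10 - 1" using d p(1) by simp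
      ultimately show "does 1 (dec_cmd 10) b (setv 10 ?r b)" using does_dec[of 10 b] by simp
    next
      assume "\<not> nonzero 10 (input_at x (pos b)) (scan k (conc b))"
      then have "setv 10 ?r b = b" by (simp add: cond_nonzero d setv_id)
      then show "does 1 Skip b (setv 10 ?r b)" by (simp add: does_Skip)
    qed simp
  next
    assume "\<not> scan k (conc b) 17 = 1"
    then have d: "d \<noteq> MoveL" by (simp add: sc)
    show "does 3 (If (\<lambda>z sc. sc 17 = 2 \<and> sc 15 \<noteq> 1) (inc_cmd 10) Skip) b (setv 10 ?r b)"
    proof (rule does_If[where i = 1])
      assume "scan k (conc b) 17 = 2 \<and> scan k (conc b) 15 \<noteq> 1"
      then have "d = MoveR" "vl b 10 \<le> length w" by (simp_all add: sc)
      then show "does 1 (inc_cmd 10) b (setv 10 ?r b)" using does_inc[of 10 b] p(2) by simp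
    next
      assume "\<not> (scan k (conc b) 17 = 2 \<and> scan k (conc b) 15 \<noteq> 1)"
      then have "d = Stay \<or> d = MoveR \<and> vl b 10 = length w + 1"
        using d p(1) by (cases d) (simp_all add: sc)
      then have "?r = vl b 10" using p(1) by auto
      then show "does 1 Skip b (setv 10 ?r b)" by (simp add: setv_id does_Skip)
    qed simp
  qed simp
qed

lemma does_query:
  fixes a :: "bool ast"
  assumes M: "wf_tm M" "k = 20 + work_tapes M" "\<And>q. q \<in> states M \<Longrightarrow> q < K"
      "\<And>v. v \<in> work_symbols M \<Longrightarrow> v + 2 < K"
    and V: "V = 1 \<or> V = 3" "s < 2"
    and a: "pos a = 0" "vl a 8 = 0" "vl a 9 = 0" "vl a 12 = 0" "vl a 13 = 0" "vl a 14 = 0" "vl a 5 = 0"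
      "vl a 7 = 0" "vl a 10 = 0" "vl a 11 = 0" "vl a 15 = 0" "vl a 16 = 0" "vl a 17 = 0"
      "vl a 4 = length \<phi>" "vl a 6 = length \<phi>" "mt a = (\<lambda>_. blank_tape)"
    and c: "vl a V = c" "c < length \<phi>"
    and w: "w = query_code \<phi> (2 * c + s)" "length w + 2 \<le> N"
    and u: "computes M w u"
    and T: "halted_at M w T" "T \<le> Z"
    and heads: "\<And>t j. j < work_tapes M \<Longrightarrow> snd (tapes (run M w t) ! j) + 2 \<le> B"
  shows "does (90 + work_tapes M) (query_cmd M V s) a (setv 18 (if Bot \<in> set u then 1 else 0) a)"
proof -
  \<comment> \<open>The simulating loop stops at the first halting time, whereas
    \<open>computes\<close> speaks of some halting time; halted configurations persist, so the
    output is the same.\<close>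
  define t1 where "t1 = (LEAST t. halted_at M w t)"
  have t1: "halted_at M w t1" "t1 \<le> T" unfolding t1_def using T by (auto intro: LeastI Least_le)
  have running: "\<not> halted_at M w t" if "t < t1" for t
    using that not_less_Least unfolding t1_def by blast
  have stays: "run M w (t1 + t) = run M w t1" for t
  proof (induction t)
    case (Suc t)
    then show ?case using t1(1) by (simp add: run_def halted_at_def step_def)
  qed simp
  have out: "out_tape (run M w t1) = u"
  proof -
    obtain t where t: "halted_at M w t" "out_tape (run M w t) = u"
      using u by (auto simp: computes_def)
    then have "t1 \<le> t" unfolding t1_def by (simp add: Least_le)
    then show ?thesis using stays[of "t - t1"] t(2) by simp
  qed
  \<comment> \<open>The number of cells of tape \<open>j\<close> visited before time
    \<open>t\<close>. A head moves by at most one cell, so these cells form a prefix whose length is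
    the running maximum of the successors of the head positions.\<close>
  define mx where "mx = rec_nat (\<lambda>_. 0) (\<lambda>t f j. max (f j) (Suc (snd (tapes (run M w t) ! j))))"
  have mx: "mx 0 = (\<lambda>_. 0)" "mx (Suc t) j = max (mx t j) (Suc (snd (tapes (run M w t) ! j)))" for t j
    by (simp_all add: mx_def)
  define mts where "mts t j = (if j < work_tapes M
    then (fst (tapes (run M w t) ! j), snd (tapes (run M w t) ! j), mx t j) else blank_tape)" for t j
  define f where "f t = setv 16 (cur_state (run M w t)) (setv 10 (input_head (run M w t))
      (setv 18 (if Bot \<in> set (out_tape (run M w t)) then 1 else 0) (a\<lparr>mt := mts t\<rparr>)))" for t
  have inv: "tm_inv M w (run M w t)" for t by (rule tm_inv_run[OF M(1)])
  have body: "does 75 (sim_round M V s) (f t) (f (Suc t))"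
    if t: "t < t1" for t
  proof -
    let ?c = "run M w t"
    let ?z = "input_at w (input_head ?c)"
    obtain q d acts e where tr: "transition M (cur_state ?c) ?z
        (map (\<lambda>tp. fst tp (snd tp)) (tapes ?c)) = (q, d, acts, e)" using prod_cases4 by blast
    note wf = transition_wf[OF M(1) inv tr]
    have len: "length (tapes ?c) = work_tapes M" and ihd: "input_head ?c \<le> length w + 1"
      using inv[of t] by (simp_all add: tm_inv_def)
    have suc: "run M w (Suc t) = \<lparr>cur_state = q, input_head = min (length w + 1) (move d (input_head ?c)),
        tapes = map2 act_on_tape (tapes ?c) acts,
        out_tape = out_tape ?c @ (case e of None \<Rightarrow> [] | Some b \<Rightarrow> [b])\<rparr>"
      using running[OF t] tr by (simp add: run_def halted_at_def step_def)
    let ?b = "setv 15 (cell_code ?z) (f t)"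
    have 1: "does 70 (fetch V s) (f t) ?b"
    proof -
      have "input_head ?c < N" using ihd w(2) by simp
      then show ?thesis unfolding w(1) using V a c w(1) by (intro does_fetch) (auto simp: f_def)
    qed
    define b1 where "b1 = setv 16 q (setv 17 (dir_code d) (setv 18 (if e = Some Bot then 1 else vl ?b 18)
      (?b\<lparr>mt := (\<lambda>j. if j < work_tapes M
         then (case act_on_tape (tapes ?c ! j) (acts ! j) of
           (g, h) \<Rightarrow> (g, h, max (mx t j) (Suc (snd (tapes ?c ! j)))))
         else mt ?b j)\<rparr>)))"
    have 2: "does 5 (sim_step M) ?b b1"
      by (rule does_sim_step[OF M inv _ heads _ _ tr b1_def]) (auto simp: f_def mts_def)
    let ?b2 = "setv 10 (min (length w + 1) (move d (input_head ?c))) b1"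
    have b1v: "vl b1 17 = dir_code d" "vl b1 10 = input_head ?c" "vl b1 15 = cell_code ?z"
      by (simp_all add: b1_def f_def)
    have 3: "does 5 head_update b1 ?b2" using does_head_update[of b1 d w] b1v ihd w(2) by simp
    have 4: "does 5 (assign 15 0) ?b2 (setv 15 0 ?b2)" using K6 by (intro does_set_reg) auto
    have 5: "does 5 (assign 17 0) (setv 15 0 ?b2) (setv 17 0 (setv 15 0 ?b2))"
      using K6 by (intro does_set_reg) auto
    have "setv 17 0 (setv 15 0 ?b2) = f (Suc t)"
    proof (rule ast_eqI)
      have "Bot \<in> set (out_tape (run M w (Suc t))) \<longleftrightarrow> e = Some Bot \<or> Bot \<in> set (out_tape ?c)"
        by (auto simp: suc split: option.splits)
      then show "vl (setv 17 0 (setv 15 0 ?b2)) i = vl (f (Suc t)) i" for i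
        using a by (auto simp: b1_def f_def suc)
      show "mt (setv 17 0 (setv 15 0 ?b2)) = mt (f (Suc t))" using wf(2) len
        by (auto simp: b1_def f_def mts_def suc mx fun_eq_iff case_prod_beta)
    qed (simp_all add: b1_def f_def)
    then show ?thesis
      using does_Seq[OF 1 does_Seq[OF 2 does_Seq[OF 3 does_Seq[OF 4 5, of 6], of 7], of 8], of 75]
      by simp
  qed
  have loop: "does 80 (While (\<lambda>z sc. sc 16 \<notin> halt_states M) (sim_round M V s)) (f 0) (f t1)"
  proof (rule does_While[where f = f and j = 75])
    show "does 75 (sim_round M V s) (f t) (f (Suc t))"
      if "t < t1" for t using that by (rule body)
    show "scan k (conc (f t)) 16 \<notin> halt_states M" if "t < t1" for t
      using running[OF that] by (simp add: scan_reg f_def halted_at_def)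
    show "\<not> scan k (conc (f t1)) 16 \<notin> halt_states M"
      using t1(1) by (simp add: scan_reg f_def halted_at_def)
  qed (use t1(2) T(2) in auto)
  have f0: "f 0 = setv 18 0 (setv 16 (start_state M) a)"
    using a by (auto intro!: ast_eqI simp: f_def run_def initial_config_def mts_def mx fun_eq_iff)
  have start: "start_state M < K" using M(1,3) by (simp add: wf_tm_def)
  have 1: "does 80 (assign 16 (start_state M)) a (setv 16 (start_state M) a)"
    using start by (intro does_set_reg) auto
  have 2: "does 80 (assign 18 0) (setv 16 (start_state M) a) (f 0)"
    unfolding f0 using K6 by (intro does_set_reg) auto
  have 3: "does 80 (clear_cmd 10) (f t1) (setv 10 0 (f t1))"
    using does_mono[OF does_clear[of 10 "f t1"], of 80] by simp
  have 4: "does 80 (assign 16 0) (setv 10 0 (f t1)) (setv 16 0 (setv 10 0 (f t1)))"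
    using K6 by (intro does_set_reg) auto
  let ?b = "setv 16 0 (setv 10 0 (f t1))"
  have 5: "does (6 + work_tapes M) (foldr (\<lambda>j c. Seq (clear_tape (20 + j)) c) [0..<work_tapes M] Skip) ?b
    (?b\<lparr>mt := (\<lambda>j. if j < work_tapes M then blank_tape else mt ?b j)\<rparr>)"
    using M(2) by (intro does_clear_tapes) simp
  have 6: "?b\<lparr>mt := (\<lambda>j. if j < work_tapes M then blank_tape else mt ?b j)\<rparr>
      = setv 18 (if Bot \<in> set u then 1 else 0) a"
    using a out by (auto intro!: ast_eqI simp: f_def mts_def fun_eq_iff)
  note s1 = does_Seq[OF 4 5, of "81 + work_tapes M"]
  note s2 = does_Seq[OF 3 s1, of "82 + work_tapes M"]
  note s3 = does_Seq[OF loop s2, of "83 + work_tapes M"]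
  note s4 = does_Seq[OF 2 s3, of "84 + work_tapes M"]
  note s5 = does_Seq[OF 1 s4, of "90 + work_tapes M"]
  show ?thesis using s5 unfolding query_cmd_def 6 by simp
qed

end

section \<open>Satisfiability and reachability\<close>

text \<open>The implication graph: a clause with the literals \<open>neg_lit l\<close> and
  \<open>l'\<close> yields an edge from \<open>l\<close> to \<open>l'\<close>.\<close>

definition implication_edges :: "cnf \<Rightarrow> literal rel" where
  "implication_edges \<phi> = {(l, slot_of \<phi> q) |l q. q < 2 * length \<phi> \<and> mate_of \<phi> q = neg_lit l}"

abbreviation implies :: "cnf \<Rightarrow> literal \<Rightarrow> literal \<Rightarrow> bool" where
  "implies \<phi> l l' \<equiv> (l, l') \<in> (implication_edges \<phi>)\<^sup>*"

definition slot_edges :: "cnf \<Rightarrow> nat rel" where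
  "slot_edges \<phi> = {(p, q). p < 2 * length \<phi> \<and> q < 2 * length \<phi> \<and> mate_of \<phi> q = neg_lit (slot_of \<phi> p)}"

definition refuted :: "cnf \<Rightarrow> nat \<Rightarrow> bool" where
  "refuted \<phi> p \<longleftrightarrow> implies \<phi> (slot_of \<phi> p) (neg_lit (slot_of \<phi> p))"

lemma mate_slot:
  assumes "q < 2 * length \<phi>"
  obtains p where "p < 2 * length \<phi>" "slot_of \<phi> p = mate_of \<phi> q" "mate_of \<phi> p = slot_of \<phi> q"
proof (cases "even q")
  case True
  then obtain c where "q = 2 * c" by blast
  with assms that[of "2 * c + 1"] show ?thesis by (auto simp: slot_of_def mate_of_def)
next
  case False
  then obtain c where "q = 2 * c + 1" by (blast elim: oddE)
  with assms that[of "2 * c"] show ?thesis by (auto simp: slot_of_def mate_of_def)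
qed

text \<open>Contraposition: read from its other slot, the same clause yields the reversed edge
  between the negations.\<close>

lemma implication_edges_skew:
  assumes "(l, l') \<in> implication_edges \<phi>"
  shows "(neg_lit l', neg_lit l) \<in> implication_edges \<phi>"
proof -
  obtain q where q: "q < 2 * length \<phi>" "slot_of \<phi> q = l'" "mate_of \<phi> q = neg_lit l"
    using assms by (auto simp: implication_edges_def)
  obtain p where "p < 2 * length \<phi>" "slot_of \<phi> p = mate_of \<phi> q" "mate_of \<phi> p = slot_of \<phi> q"
    using mate_slot[OF q(1)] .
  then show ?thesis using q by (auto simp: implication_edges_def intro!: exI[of _ p])
qed

lemma implication_path_skew:
  "implies \<phi> l l' \<Longrightarrow> implies \<phi> (neg_lit l') (neg_lit l)"
proof (induction rule: rtrancl_induct)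
  case (step l' l'')
  then show ?case using converse_rtrancl_into_rtrancl[OF implication_edges_skew] by blast
qed simp

text \<open>Several slots may carry the same literal, but an edge depends on its source only through
  the literal, and each edge ends in a slot. So a path of literals that starts in a slot lifts to a
  path of slots.\<close>

lemma slot_path_iff:
  assumes "p < 2 * length \<phi>"
  shows "implies \<phi> (slot_of \<phi> p) l \<longleftrightarrow>
    (\<exists>q < 2 * length \<phi>. slot_of \<phi> q = l \<and> (p, q) \<in> (slot_edges \<phi>)\<^sup>*)"
proof
  assume "implies \<phi> (slot_of \<phi> p) l"
  then show "\<exists>q < 2 * length \<phi>. slot_of \<phi> q = l \<and> (p, q) \<in> (slot_edges \<phi>)\<^sup>*"
  proof (induction rule: rtrancl_induct)
    case base
    then show ?case using assms by blast
  next
    case (step l l')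
    then obtain q q' where "q < 2 * length \<phi>" "slot_of \<phi> q = l" "(p, q) \<in> (slot_edges \<phi>)\<^sup>*"
      "q' < 2 * length \<phi>" "slot_of \<phi> q' = l'" "mate_of \<phi> q' = neg_lit l"
      by (auto simp: implication_edges_def)
    moreover from this have "(q, q') \<in> slot_edges \<phi>" by (simp add: slot_edges_def)
    ultimately show ?case using rtrancl.rtrancl_into_rtrancl[of p q "slot_edges \<phi>" q'] by blast
  qed
next
  assume "\<exists>q < 2 * length \<phi>. slot_of \<phi> q = l \<and> (p, q) \<in> (slot_edges \<phi>)\<^sup>*"
  then obtain q where q: "slot_of \<phi> q = l" "(p, q) \<in> (slot_edges \<phi>)\<^sup>*" by blast
  from q(2) have "implies \<phi> (slot_of \<phi> p) (slot_of \<phi> q)"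
  proof (induction rule: rtrancl_induct)
    case (step q q')
    then have "(slot_of \<phi> q, slot_of \<phi> q') \<in> implication_edges \<phi>"
      by (auto simp: slot_edges_def implication_edges_def)
    with step show ?case by simp
  qed simp
  then show "implies \<phi> (slot_of \<phi> p) l" using q(1) by simp
qed

text \<open>A path of least length repeats no vertex, as the part between two occurrences could be
  cut out.\<close>

lemma short_path:
  assumes "finite V" "R \<subseteq> V \<times> V" "a \<in> V" "(a, b) \<in> R\<^sup>*"
  obtains i where "i < card V" "(a, b) \<in> R ^^ i"
proof -
  define i where "i = (LEAST i. (a, b) \<in> R ^^ i)"
  have i: "(a, b) \<in> R ^^ i"
    unfolding i_def using rtrancl_imp_relpow[OF assms(4)] by (metis LeastI)
  then obtain f where f: "f 0 = a" "f i = b" "\<And>j. j < i \<Longrightarrow> (f j, f (Suc j)) \<in> R"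
    by (auto simp: relpow_fun_conv)
  have path: "(f j, f (j + k)) \<in> R ^^ k" if "j + k \<le> i" for j k
    using that f(3) by (auto simp: relpow_fun_conv intro!: exI[of _ "\<lambda>m. f (j + m)"])
  have "inj_on f {..i}"
  proof (rule linorder_inj_onI)
    fix j k assume jk: "j < k" "k \<in> {..i}"
    show "f j \<noteq> f k"
    proof
      assume "f j = f k"
      then have "(f 0, f i) \<in> R ^^ (j + (i - k))"
        unfolding relpow_add using path[of 0 j] path[of k "i - k"] jk \<open>f j = f k\<close>
        by (intro relcompI[of _ "f j"]) auto
      then have "i \<le> j + (i - k)" unfolding i_def f(1,2)[unfolded i_def] by (rule Least_le)
      then show False using jk by simp
    qed
  qed auto
  moreover have "f ` {..i} \<subseteq> V"
  proof clarify
    fix j assume "j \<le> i"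
    then show "f j \<in> V"
    proof (cases j)
      case 0
      then show ?thesis using f(1) assms(3) by simp
    next
      case (Suc m)
      then have "(f m, f j) \<in> R" using f(3)[of m] \<open>j \<le> i\<close> by simp
      then show ?thesis using assms(2) by blast
    qed
  qed
  ultimately have "card {..i} \<le> card V" using assms(1) by (meson card_inj_on_le)
  then show ?thesis using that[of i] i by simp
qed

text \<open>Transitions ignore the letter, so a word matters only through its length.\<close>

lemma reachable_query:
  assumes "p < 2 * length \<phi>"
  shows "reachable (query_nfa \<phi> p) w = {q. (p, q) \<in> slot_edges \<phi> ^^ length w}"
proof (induction w rule: rev_induct)
  case Nil
  then show ?case by (simp add: reachable_def query_nfa_def)
next
  case (snoc a w)
  have bound: "q < 2 * length \<phi>" if "(p, q) \<in> slot_edges \<phi> ^^ n" for q n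
    using that assms by (cases n) (auto simp: slot_edges_def)
  have "reachable (query_nfa \<phi> p) (w @ [a]) = (\<Union>q\<in>reachable (query_nfa \<phi> p) w. delta (query_nfa \<phi> p) q a)"
    by (simp add: reachable_def)
  also have "\<dots> = {q. (p, q) \<in> slot_edges \<phi> ^^ length (w @ [a])}"
  proof (intro set_eqI iffI)
    fix q' assume "q' \<in> (\<Union>q\<in>reachable (query_nfa \<phi> p) w. delta (query_nfa \<phi> p) q a)"
    then obtain q where q: "(p, q) \<in> slot_edges \<phi> ^^ length w" "q' \<in> delta (query_nfa \<phi> p) q a"
      unfolding snoc.IH by blast
    then have "(q, q') \<in> slot_edges \<phi>"
      using bound[OF q(1)] by (simp add: query_nfa_def slot_edges_def)
    then show "q' \<in> {q. (p, q) \<in> slot_edges \<phi> ^^ length (w @ [a])}" using q(1) by auto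
  next
    fix q' assume "q' \<in> {q. (p, q) \<in> slot_edges \<phi> ^^ length (w @ [a])}"
    then obtain q where q: "(p, q) \<in> slot_edges \<phi> ^^ length w" "(q, q') \<in> slot_edges \<phi>" by auto
    then have "q' \<in> delta (query_nfa \<phi> p) q a" by (simp add: query_nfa_def slot_edges_def)
    then show "q' \<in> (\<Union>q\<in>reachable (query_nfa \<phi> p) w. delta (query_nfa \<phi> p) q a)"
      unfolding snoc.IH using q(1) by blast
  qed
  finally show ?case .
qed

text \<open>Acceptance at a prefix makes paths of every length up to
  \<open>2 * length \<phi>\<close> count, even if the automaton is stuck afterwards, and some
  shortest path is among them. The only candidate word over the single letter 0 is then a
  solution.\<close>

lemma solution_iff_refuted:
  assumes "p < 2 * length \<phi>"
  shows "(\<exists>w. is_solution (query \<phi> p) w) \<longleftrightarrow> refuted \<phi> p"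
proof -
  let ?C = "length \<phi>"
  have acc: "accepts (query_nfa \<phi> p) w \<longleftrightarrow>
      (\<exists>i\<le>length w. \<exists>q < 2 * ?C. slot_of \<phi> q = neg_lit (slot_of \<phi> p) \<and> (p, q) \<in> slot_edges \<phi> ^^ i)" for w
  proof -
    have "reachable (query_nfa \<phi> p) (take i w) = {q. (p, q) \<in> slot_edges \<phi> ^^ i}" if "i \<le> length w" for i
      using that by (simp add: reachable_query[OF assms])
    then show ?thesis by (auto simp: accepts_def query_nfa_def)
  qed
  have "(\<exists>w. is_solution (query \<phi> p) w) \<longleftrightarrow>
      (\<exists>i\<le>2 * ?C. \<exists>q < 2 * ?C. slot_of \<phi> q = neg_lit (slot_of \<phi> p) \<and> (p, q) \<in> slot_edges \<phi> ^^ i)"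
  proof
    assume "\<exists>w. is_solution (query \<phi> p) w"
    then show "\<exists>i\<le>2 * ?C. \<exists>q < 2 * ?C. slot_of \<phi> q = neg_lit (slot_of \<phi> p) \<and> (p, q) \<in> slot_edges \<phi> ^^ i"
      by (auto simp: query_def acc)
  next
    assume "\<exists>i\<le>2 * ?C. \<exists>q < 2 * ?C. slot_of \<phi> q = neg_lit (slot_of \<phi> p) \<and> (p, q) \<in> slot_edges \<phi> ^^ i"
    then have "is_solution (query \<phi> p) (replicate (2 * ?C) 0)"
      by (auto simp: query_def acc) (simp add: query_nfa_def)
    then show "\<exists>w. is_solution (query \<phi> p) w" by blast
  qed
  also have "\<dots> \<longleftrightarrow> (\<exists>q < 2 * ?C. slot_of \<phi> q = neg_lit (slot_of \<phi> p) \<and> (p, q) \<in> (slot_edges \<phi>)\<^sup>*)"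
  proof -
    have "\<exists>i\<le>2 * ?C. (p, q) \<in> slot_edges \<phi> ^^ i" if pq: "(p, q) \<in> (slot_edges \<phi>)\<^sup>*" for q
    proof -
      have "slot_edges \<phi> \<subseteq> {..<2 * ?C} \<times> {..<2 * ?C}" by (auto simp: slot_edges_def)
      then obtain i where "i < card {..<2 * ?C}" "(p, q) \<in> slot_edges \<phi> ^^ i"
        using short_path[OF _ _ _ pq, of "{..<2 * ?C}"] assms by blast
      then show ?thesis by (auto intro!: exI[of _ i])
    qed
    then show ?thesis using relpow_imp_rtrancl by blast
  qed
  also have "\<dots> \<longleftrightarrow> refuted \<phi> p" using slot_path_iff[OF assms] by (simp add: refuted_def)
  finally show ?thesis .
qed

section \<open>The 2SAT criterion\<close>

lemma lit_true_neg [simp]: "lit_true \<sigma> (neg_lit l) \<longleftrightarrow> \<not> lit_true \<sigma> l"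
  by (cases l) auto

lemma neg_lit_neq [simp]: "neg_lit l \<noteq> l"
  by (cases l) auto

lemma clause_slots:
  assumes "two_cnf \<phi>" "c < length \<phi>"
  shows "set (\<phi> ! c) = {slot \<phi> c 0, slot \<phi> c 1}"
  by (rule two_cnf_clause[OF assms]) (auto simp: slot_def)

text \<open>Truth propagates along an edge, since the clause behind it would otherwise have only
  false literals.\<close>

lemma satisfying_imp_implication:
  assumes "two_cnf \<phi>" "\<forall>C \<in> set \<phi>. \<exists>l \<in> set C. lit_true \<sigma> l"
    and "implies \<phi> l l'" "lit_true \<sigma> l"
  shows "lit_true \<sigma> l'"
  using assms(3,4)
proof (induction rule: rtrancl_induct)
  case (step l l')
  then obtain q where q: "q < 2 * length \<phi>" "slot_of \<phi> q = l'" "mate_of \<phi> q = neg_lit l"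
    by (auto simp: implication_edges_def)
  have c: "q div 2 < length \<phi>" using q(1) by simp
  have "\<exists>l \<in> {slot \<phi> (q div 2) 0, slot \<phi> (q div 2) 1}. lit_true \<sigma> l"
    unfolding clause_slots[OF assms(1) c, symmetric] using assms(2) c by simp
  moreover have "slot \<phi> (q div 2) 0 = l' \<and> slot \<phi> (q div 2) 1 = neg_lit l
      \<or> slot \<phi> (q div 2) 1 = l' \<and> slot \<phi> (q div 2) 0 = neg_lit l"
    using q(2,3) by (cases "even q") (auto simp: slot_of_def mate_of_def odd_iff_mod_2_eq_one)
  ultimately show ?case using step by auto
qed

text \<open>Undecided variables are decided one after the other, each time adding all consequences of a
  literal that does not imply its own negation; skew symmetry keeps the set consistent.\<close>

lemma consistent_closed_set:
  assumes "finite A"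
    and ok: "\<And>l. \<not> (implies \<phi> l (neg_lit l) \<and> implies \<phi> (neg_lit l) l)"
  shows "\<exists>T. implication_edges \<phi> `` T \<subseteq> T \<and> (\<forall>l. \<not> (l \<in> T \<and> neg_lit l \<in> T)) \<and>
    (\<forall>v\<in>A. Pos v \<in> T \<or> Neg v \<in> T)" using assms(1)
proof induction
  case empty
  show ?case by (rule exI[of _ "{}"]) auto
next
  case (insert v A)
  from insert.IH obtain T where "implication_edges \<phi> `` T \<subseteq> T \<and>
      (\<forall>l. \<not> (l \<in> T \<and> neg_lit l \<in> T)) \<and> (\<forall>v\<in>A. Pos v \<in> T \<or> Neg v \<in> T)" by (rule exE)
  then have T: "implication_edges \<phi> `` T \<subseteq> T" "\<And>l. \<not> (l \<in> T \<and> neg_lit l \<in> T)"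
    "\<And>v. v \<in> A \<Longrightarrow> Pos v \<in> T \<or> Neg v \<in> T" by simp_all
  show ?case
  proof (cases "Pos v \<in> T \<or> Neg v \<in> T")
    case True
    show ?thesis by (rule exI[of _ T]) (use T True in auto)
  next
    case False
    obtain l where l: "var l = v" "\<not> implies \<phi> l (neg_lit l)"
      using ok[of "Pos v"] by (metis literal.sel neg_lit.simps)
    have lT: "neg_lit l \<notin> T" using False l(1) by (cases l) auto
    let ?D = "(implication_edges \<phi>)\<^sup>* `` {l}"
    have closed: "y \<in> T" if "x \<in> T" "implies \<phi> x y" for x y
      using that(2,1) by (induction rule: rtrancl_induct) (use T(1) in blast)+
    \<comment> \<open>Contraposition turns each possible clash into a path to
      \<open>neg_lit l\<close>. Such a path cannot start in \<open>T\<close>, which is closed and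
      does not contain \<open>neg_lit l\<close>, nor in a consequence of \<open>l\<close>, by the
      choice of \<open>l\<close>.\<close>
    have skew: "implies \<phi> y (neg_lit l)" if "neg_lit y \<in> ?D" for y
      using implication_path_skew[of l "neg_lit y" \<phi>] that by simp
    have "\<not> (y \<in> T \<union> ?D \<and> neg_lit y \<in> T \<union> ?D)" for y
    proof
      assume y: "y \<in> T \<union> ?D \<and> neg_lit y \<in> T \<union> ?D"
      consider "y \<in> T" "neg_lit y \<in> ?D" | "neg_lit y \<in> T" "y \<in> ?D" | "y \<in> ?D" "neg_lit y \<in> ?D"
        using y T(2) by blast
      then show False
      proof cases
        case 1
        then show ?thesis using closed skew lT by blast
      next
        case 2
        then show ?thesis using closed skew[of "neg_lit y"] lT by simp
      next
        case 3
        then have "implies \<phi> l y" "implies \<phi> y (neg_lit l)" using skew by auto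
        then show ?thesis using l(2) rtrancl_trans by metis
      qed
    qed
    moreover have "implication_edges \<phi> `` (T \<union> ?D) \<subseteq> T \<union> ?D"
    proof
      fix y assume "y \<in> implication_edges \<phi> `` (T \<union> ?D)"
      then obtain x where "(x, y) \<in> implication_edges \<phi>" "x \<in> T \<or> implies \<phi> l x" by blast
      then show "y \<in> T \<union> ?D"
        using T(1) rtrancl.rtrancl_into_rtrancl[of l x "implication_edges \<phi>" y] by blast
    qed
    moreover have "Pos v \<in> T \<union> ?D \<or> Neg v \<in> T \<union> ?D" using l(1) by (cases l) auto
    ultimately show ?thesis using T(3) by (intro exI[of _ "T \<union> ?D"] conjI) auto
  qed
qed

text \<open>The classical criterion that no literal is equivalent to its negation. Testing slots
  suffices: if \<open>l\<close> and \<open>neg_lit l\<close> imply each other, both are ends of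
  nonempty paths, and edges end in slots.\<close>

lemma satisfiable_iff:
  assumes two: "two_cnf \<phi>"
  shows "satisfiable \<phi> \<longleftrightarrow>
    \<not> (\<exists>p < 2 * length \<phi>. \<exists>q < 2 * length \<phi>. slot_of \<phi> q = neg_lit (slot_of \<phi> p) \<and> refuted \<phi> p \<and> refuted \<phi> q)"
    (is "_ \<longleftrightarrow> \<not> ?R")
proof
  assume "satisfiable \<phi>"
  then obtain \<sigma> where \<sigma>: "\<forall>C \<in> set \<phi>. \<exists>l \<in> set C. lit_true \<sigma> l" by (auto simp: satisfiable_def)
  show "\<not> ?R"
  proof
    assume ?R
    then obtain p q where "slot_of \<phi> q = neg_lit (slot_of \<phi> p)" "refuted \<phi> p" "refuted \<phi> q"
      by blast
    then show False using satisfying_imp_implication[OF two \<sigma>] unfolding refuted_def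
      by (metis lit_true_neg neg_lit_neg_lit)
  qed
next
  assume R: "\<not> ?R"
  have occurs: "\<exists>q < 2 * length \<phi>. slot_of \<phi> q = l'" if "implies \<phi> l l'" "l \<noteq> l'" for l l'
    using that by (cases rule: rtranclE) (auto simp: implication_edges_def)
  have "\<not> (implies \<phi> l (neg_lit l) \<and> implies \<phi> (neg_lit l) l)" for l
  proof
    assume l: "implies \<phi> l (neg_lit l) \<and> implies \<phi> (neg_lit l) l"
    obtain p q where "p < 2 * length \<phi>" "slot_of \<phi> p = l" "q < 2 * length \<phi>" "slot_of \<phi> q = neg_lit l"
      using occurs[of l "neg_lit l"] occurs[of "neg_lit l" l] l by (metis neg_lit_neq)
    then show False using R l unfolding refuted_def by (metis neg_lit_neg_lit)
  qed
  from consistent_closed_set[OF _ this, of "var ` set (concat \<phi>)"]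
  obtain T where "implication_edges \<phi> `` T \<subseteq> T \<and> (\<forall>l. \<not> (l \<in> T \<and> neg_lit l \<in> T)) \<and>
      (\<forall>v\<in>var ` set (concat \<phi>). Pos v \<in> T \<or> Neg v \<in> T)" by auto
  then have T: "implication_edges \<phi> `` T \<subseteq> T" "\<And>l. \<not> (l \<in> T \<and> neg_lit l \<in> T)"
    "\<And>v. v \<in> var ` set (concat \<phi>) \<Longrightarrow> Pos v \<in> T \<or> Neg v \<in> T" by blast+
  let ?\<sigma> = "\<lambda>v. Pos v \<in> T"
  have lit: "lit_true ?\<sigma> l" if "l \<in> T" for l using that T(2)[of l] by (cases l) auto
  have "\<exists>l \<in> set C. lit_true ?\<sigma> l" if C: "C \<in> set \<phi>" for C
  proof -
    obtain c where c: "c < length \<phi>" "C = \<phi> ! c" using C by (auto simp: in_set_conv_nth)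
    let ?a = "slot \<phi> c 0" and ?b = "slot \<phi> c 1"
    note sl = clause_slots[OF two c(1)]
    have occ: "?a \<in> set (concat \<phi>)" using sl c C by auto
    have "?a \<in> T \<or> neg_lit ?a \<in> T"
    proof -
      have "Pos (var ?a) \<in> T \<or> Neg (var ?a) \<in> T" using T(3) occ by blast
      moreover obtain v where "?a = Pos v \<or> ?a = Neg v" by (cases ?a) auto
      ultimately show ?thesis by auto
    qed
    moreover have "(neg_lit ?a, ?b) \<in> implication_edges \<phi>"
      using c(1) by (auto simp: implication_edges_def slot_of_def mate_of_def intro!: exI[of _ "2 * c + 1"])
    ultimately have "?a \<in> T \<or> ?b \<in> T" using T(1) by blast
    then show ?thesis using lit sl c(2) by auto
  qed
  then show "satisfiable \<phi>" by (auto simp: satisfiable_def)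
qed

text \<open>Clauses are nonempty, so they are at most as many as the literal occurrences, of which
  every variable has at most 3. This turns bounds in the number of clauses into bounds in the number
  of variables.\<close>

lemma length_le_m_vbl:
  assumes "\<phi> \<in> two_sat3_instances"
  shows "length \<phi> \<le> 3 * m_vbl \<phi>"
proof -
  let ?ls = "concat \<phi>"
  have count: "count_list (map var ls) v = length (filter (\<lambda>l. var l = v) ls)" for ls v
    by (induction ls) auto
  have "length \<phi> = (\<Sum>C\<leftarrow>\<phi>. 1)" by (simp add: sum_list_triv)
  also have "\<dots> \<le> (\<Sum>C\<leftarrow>\<phi>. length C)"
    using assms by (intro sum_list_mono) (auto simp: two_sat3_instances_def two_cnf_def)
  also have "\<dots> = length (map var ?ls)" by (simp add: length_concat)
  also have "\<dots> = (\<Sum>v \<in> var ` set ?ls. count_list (map var ?ls) v)"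
    by (rule sum_count_set[symmetric]) auto
  also have "\<dots> \<le> (\<Sum>v \<in> var ` set ?ls. 3)"
  proof (rule sum_mono)
    fix v
    have "count_list (map var ?ls) v = length (filter (\<lambda>l. var l = v) ?ls)" by (rule count)
    then show "count_list (map var ?ls) v \<le> 3" using assms by (simp add: two_sat3_instances_def)
  qed
  also have "\<dots> = 3 * m_vbl \<phi>" by (simp add: m_vbl_def)
  finally show ?thesis .
qed

section \<open>Deciding satisfiability with a search machine\<close>

text \<open>Sets up the tape layout of \<open>initial_ast\<close>: counters and simulated tapes get
  their left markers, 3 and 1, while registers use cell 0 itself.\<close>

definition init_cmd :: "('i, 'o) cmd" where
  "init_cmd = Prim (\<lambda>z sc. (Stay, (\<lambda>i. if i < 12 then Some (3, MoveR)
     else if i < 20 then None else Some (1, MoveR)), None))"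

text \<open>Four copies of the number of clauses, since up to four loops over clauses are nested:
  two over pairs of slots and two over the transition table.\<close>

definition count_clauses :: "(cnf_sym, 'o) cmd" where
  "count_clauses = While (\<lambda>z sc. z \<noteq> RightEnd) (Seq (move_head MoveR)
     (If (\<lambda>z sc. z = Letter EndClause)
       (Seq (inc_cmd 0) (Seq (inc_cmd 2) (Seq (inc_cmd 4) (inc_cmd 6)))) Skip))"

abbreviation unless_bot :: "(cnf_sym, bool) cmd \<Rightarrow> (cnf_sym, bool) cmd" where
  "unless_bot c \<equiv> If (\<lambda>z sc. sc 18 = 1) Skip c"

text \<open>Register 14 is reset first because generating a query performs comparisons of its own.
  The second query is run only if the first one found a solution.\<close>

abbreviation run_queries :: "(nfa_sym, out_sym) tm \<Rightarrow> nat \<Rightarrow> nat \<Rightarrow> (cnf_sym, bool) cmd" where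
  "run_queries M s t \<equiv> Seq (assign 14 0) (Seq (query_cmd M 1 s)
     (unless_bot (Seq (query_cmd M 3 t) (unless_bot (assign 19 1)))))"

definition test_pair :: "(nfa_sym, out_sym) tm \<Rightarrow> nat \<Rightarrow> nat \<Rightarrow> (cnf_sym, bool) cmd" where
  "test_pair M s t = Seq (compl_cmd 1 s 3 t)
     (Seq (If (\<lambda>z sc. sc 14 = 1)
        (run_queries M s t) Skip)
      (assign 18 0))"

abbreviation test_row :: "(nfa_sym, out_sym) tm \<Rightarrow> nat \<Rightarrow> (cnf_sym, bool) cmd" where
  "test_row M s \<equiv> for_cmd 2 3 (Seq (test_pair M s 0) (test_pair M s 1))"

definition test_all :: "(nfa_sym, out_sym) tm \<Rightarrow> (cnf_sym, bool) cmd" where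
  "test_all M = for_cmd 0 1
     (Seq (test_row M 0)
          (test_row M 1))"

definition two_sat_cmd :: "(nfa_sym, out_sym) tm \<Rightarrow> (cnf_sym, bool) cmd" where
  "two_sat_cmd M = Seq init_cmd (Seq count_clauses (Seq rewind (Seq (test_all M)
     (emit_out (\<lambda>z sc. sc 19 = 0)))))"

definition initial_ast :: "'o ast" where
  "initial_ast = \<lparr>pos = 0, vl = (\<lambda>_. 0), mt = (\<lambda>_. blank_tape), wr = []\<rparr>"

text \<open>Register 19 is only ever raised, so successive tests accumulate a disjunction.\<close>

definition set_flag :: "bool \<Rightarrow> 'o ast \<Rightarrow> 'o ast" where
  "set_flag b a = setv 19 (if b then 1 else vl a 19) a"

lemma set_flag_simps [simp]:
  "pos (set_flag b a) = pos a" "mt (set_flag b a) = mt a" "wr (set_flag b a) = wr a"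
  "i \<noteq> 19 \<Longrightarrow> vl (set_flag b a) i = vl a i"
  "set_flag False a = a" "set_flag b (set_flag c a) = set_flag (b \<or> c) a"
  "r \<noteq> 19 \<Longrightarrow> set_flag b (setv r v a) = setv r v (set_flag b a)"
  by (auto simp: set_flag_def setv_id intro!: ast_eqI)

lemma count_EndClause: "length (filter (\<lambda>z. z = EndClause) (encode_cnf \<phi>)) = length \<phi>"
proof (induction \<phi>)
  case (Cons C \<phi>)
  have "filter (\<lambda>z. z = EndClause) (clause_code C) = []"
    using EndClause_notin_clause by (auto simp: filter_empty_conv)
  then show ?case using Cons by (simp add: encode_cnf_Cons)
qed (simp add: encode_cnf_def)

locale reduction_vm = formula_vm K k B x N Z \<phi>
  for K k B and x :: "cnf_sym list" and N Z and \<phi> :: cnf +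
  fixes M :: "(nfa_sym, out_sym) tm"
  assumes M: "wf_tm M" "k = 20 + work_tapes M" "\<And>q. q \<in> states M \<Longrightarrow> q < K"
      "\<And>v. v \<in> work_symbols M \<Longrightarrow> v + 2 < K"
    and answer: "p < 2 * length \<phi> \<Longrightarrow>
      \<exists>u. computes M (query_code \<phi> p) u \<and> (Bot \<in> set u \<longleftrightarrow> \<not> refuted \<phi> p)"
    and time: "p < 2 * length \<phi> \<Longrightarrow> \<exists>T\<le>Z. halted_at M (query_code \<phi> p) T"
    and heads: "p < 2 * length \<phi> \<Longrightarrow> j < work_tapes M \<Longrightarrow>
      snd (tapes (run M (query_code \<phi> p) t) ! j) + 2 \<le> B"
    and len: "p < 2 * length \<phi> \<Longrightarrow> length (query_code \<phi> p) + 2 \<le> N"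
begin

text \<open>The states in which a query may start. Counters 0 to 3 and register 19 are left open, as
  they belong to the loops over pairs and to the overall result.\<close>

definition clean :: "bool ast \<Rightarrow> bool" where
  "clean a \<longleftrightarrow> pos a = 0 \<and> (\<forall>i\<in>{5, 7, 8, 9, 10, 11, 12, 13, 14, 15, 16, 17, 18}. vl a i = 0) \<and>
     vl a 4 = length \<phi> \<and> vl a 6 = length \<phi> \<and> mt a = (\<lambda>_. blank_tape)"

lemma does_query':
  assumes "clean a" "V = 1 \<or> V = 3" "s < 2" "vl a V = c" "c < length \<phi>"
  shows "does (90 + work_tapes M) (query_cmd M V s) a
    (setv 18 (if refuted \<phi> (2 * c + s) then 0 else 1) a)"
proof -
  have p: "2 * c + s < 2 * length \<phi>" using assms by simp
  obtain u where u: "computes M (query_code \<phi> (2 * c + s)) u"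
    "Bot \<in> set u \<longleftrightarrow> \<not> refuted \<phi> (2 * c + s)" using answer[OF p] by blast
  obtain T where T: "T \<le> Z" "halted_at M (query_code \<phi> (2 * c + s)) T" using time[OF p] by blast
  have "does (90 + work_tapes M) (query_cmd M V s) a (setv 18 (if Bot \<in> set u then 1 else 0) a)"
    by (rule does_query[OF M assms(2,3) _ _ _ _ _ _ _ _ _ _ _ _ _ _ _ _ assms(4,5) refl
          len[OF p] u(1) T(2,1) heads[OF p]])
      (use assms(1) in \<open>auto simp: clean_def\<close>)
  moreover have "(if Bot \<in> set u then 1 else 0) = (if refuted \<phi> (2 * c + s) then 0 else (1 :: nat))"
    by (simp add: u(2))
  ultimately show ?thesis by (simp only:)
qed

definition conflict :: "nat \<Rightarrow> nat \<Rightarrow> nat \<Rightarrow> nat \<Rightarrow> bool" where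
  "conflict c s d t \<longleftrightarrow> slot \<phi> d t = neg_lit (slot \<phi> c s) \<and> refuted \<phi> (2 * c + s) \<and> refuted \<phi> (2 * d + t)"

lemma does_test_pair:
  assumes "clean a" "s < 2" "t < 2" "vl a 1 = c" "vl a 3 = d" "c < length \<phi>" "d < length \<phi>"
  shows "does (100 + work_tapes M) (test_pair M s t) a (set_flag (conflict c s d t) a)"
proof -
  let ?e = "work_tapes M"
  let ?R = "\<lambda>c s. refuted \<phi> (2 * c + s)"
  let ?b = "slot \<phi> d t = neg_lit (slot \<phi> c s)"
  let ?a1 = "setv 14 (if ?b then 1 else 0) a"
  \<comment> \<open>Register 18 ends up as 1 exactly if a query was run and the last one wrote
    \<open>Bot\<close>.\<close>
  let ?v = "if ?b \<and> (?R c s \<longrightarrow> \<not> ?R d t) then 1 else (0 :: nat)"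
  let ?a2 = "setv 18 ?v (set_flag (conflict c s d t) a)"
  have z: "vl a 14 = 0" "vl a 18 = 0" using assms(1) by (auto simp: clean_def)
  have 1: "does 98 (compl_cmd 1 s 3 t) a ?a1"
    using does_mono[OF does_compl[of 1 3 a c d s t], of 98] assms by (auto simp: clean_def)
  have 2: "does (98 + ?e) (If (\<lambda>z sc. sc 14 = 1)
        (run_queries M s t) Skip) ?a1 ?a2"
  proof (rule does_If[where i = "97 + ?e"])
    assume "scan k (conc ?a1) 14 = 1"
    then have b: ?b by (auto simp: scan_reg split: if_splits)
    have 3: "does 90 (assign 14 0) ?a1 a"
      using does_set_reg[of 14 "\<lambda>_ _. 0" ?a1 0 90] z K6 by (simp add: setv_id)
    let ?a3 = "setv 18 (if ?R c s then 0 else 1) a"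
    have 4: "does (90 + ?e) (query_cmd M 1 s) a ?a3" using assms by (intro does_query') auto
    have 5: "does (95 + ?e) (unless_bot (Seq (query_cmd M 3 t) (unless_bot (assign 19 1)))) ?a3 ?a2"
    proof (rule does_If[where i = "94 + ?e"])
      assume "scan k (conc ?a3) 18 = 1"
      then have "\<not> ?R c s" by (auto simp: scan_reg split: if_splits)
      then have "?a2 = ?a3" using b by (simp add: conflict_def)
      then show "does (94 + ?e) Skip ?a3 ?a2" by (simp add: does_Skip)
    next
      assume "\<not> scan k (conc ?a3) 18 = 1"
      then have R: "?R c s" by (auto simp: scan_reg split: if_splits)
      then have a3: "?a3 = a" using z by (simp add: setv_id)
      let ?a4 = "setv 18 (if ?R d t then 0 else 1) a"
      have 6: "does (90 + ?e) (query_cmd M 3 t) a ?a4" using assms by (intro does_query') auto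
      have 7: "does (90 + ?e) (unless_bot (assign 19 1)) ?a4 ?a2"
      proof (rule does_If[where i = 89])
        assume "scan k (conc ?a4) 18 = 1"
        then have "\<not> ?R d t" by (auto simp: scan_reg split: if_splits)
        then have "?a2 = ?a4" using b by (simp add: conflict_def)
        then show "does 89 Skip ?a4 ?a2" by (simp add: does_Skip)
      next
        assume "\<not> scan k (conc ?a4) 18 = 1"
        then have "?R d t" by (auto simp: scan_reg split: if_splits)
        then have "?a2 = setv 19 1 ?a4"
          using b R by (auto simp: conflict_def set_flag_def intro!: ast_eqI)
        then show "does 89 (assign 19 1) ?a4 ?a2" using K6 by (auto intro!: does_set_reg)
      qed simp
      show "does (94 + ?e) (Seq (query_cmd M 3 t) (unless_bot (assign 19 1))) ?a3 ?a2"
        unfolding a3 using does_Seq[OF 6 7, of "94 + ?e"] by simp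
    qed simp
    show "does (97 + ?e) (run_queries M s t) ?a1 ?a2"
      using does_Seq[OF 3 does_Seq[OF 4 5, of "96 + ?e"], of "97 + ?e"] by simp
  next
    assume "\<not> scan k (conc ?a1) 14 = 1"
    then have b: "\<not> ?b" by (auto simp: scan_reg split: if_splits)
    then have "?a2 = ?a1" using z by (simp add: conflict_def setv_id)
    then show "does (97 + ?e) Skip ?a1 ?a2" by (simp add: does_Skip)
  qed simp
  have 3: "does 98 (assign 18 0) ?a2 (setv 18 0 ?a2)" using K6 by (intro does_set_reg) auto
  have "setv 18 0 ?a2 = set_flag (conflict c s d t) a" using z by (simp add: setv_id)
  then show ?thesis unfolding test_pair_def
    using does_Seq[OF 1 does_Seq[OF 2 3, of "99 + ?e"], of "100 + ?e"] by simp
qed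

lemma clean_setv: "r < 4 \<Longrightarrow> clean (setv r v a) \<longleftrightarrow> clean a"
  by (auto simp: clean_def)

lemma clean_set_flag: "clean (set_flag b a) \<longleftrightarrow> clean a"
  by (auto simp: clean_def)

definition conflicts :: "nat \<Rightarrow> nat \<Rightarrow> nat \<Rightarrow> bool" where
  "conflicts c s n \<longleftrightarrow> (\<exists>d<n. conflict c s d 0 \<or> conflict c s d 1)"

lemma does_test_row:
  assumes a: "clean a" "vl a 2 = length \<phi>" "vl a 3 = 0" and "s < 2" "vl a 1 = c" "c < length \<phi>"
  shows "does (110 + work_tapes M) (test_row M s) a
    (set_flag (conflicts c s (length \<phi>)) a)"
proof -
  let ?e = "work_tapes M"
  let ?f = "\<lambda>d. set_flag (conflicts c s d) a"
  have "does (110 + ?e) (test_row M s) (?f 0) (?f (length \<phi>))"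
  proof (rule does_for[where j = "101 + ?e"])
    fix d assume d: "d < length \<phi>"
    let ?b = "setv 2 (length \<phi> - d) (setv 3 d (?f d))"
    have 1: "does (100 + ?e) (test_pair M s 0) ?b (set_flag (conflict c s d 0) ?b)"
      using assms d by (intro does_test_pair) (auto simp: clean_setv clean_set_flag)
    have 2: "does (100 + ?e) (test_pair M s 1) (set_flag (conflict c s d 0) ?b)
        (set_flag (conflict c s d 1) (set_flag (conflict c s d 0) ?b))"
      using assms d by (intro does_test_pair) (auto simp: clean_setv clean_set_flag)
    have "conflicts c s (Suc d) \<longleftrightarrow> conflict c s d 1 \<or> conflict c s d 0 \<or> conflicts c s d"
      by (auto simp: conflicts_def less_Suc_eq)
    then have "set_flag (conflict c s d 1) (set_flag (conflict c s d 0) ?b)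
        = setv 2 (length \<phi> - d) (setv 3 d (?f (Suc d)))" by simp
    then show "does (101 + ?e) (Seq (test_pair M s 0) (test_pair M s 1)) ?b
        (setv 2 (length \<phi> - d) (setv 3 d (?f (Suc d))))"
      using does_Seq[OF 1 2, of "101 + ?e"] by simp
  qed (use a length_le_N in auto)
  moreover have "?f 0 = a" by (simp add: conflicts_def)
  ultimately show ?thesis by simp
qed

lemma does_test_all:
  assumes a: "clean a" "vl a 0 = length \<phi>" "vl a 1 = 0" "vl a 2 = length \<phi>" "vl a 3 = 0"
  shows "does (120 + work_tapes M) (test_all M) a (set_flag (\<not> satisfiable \<phi>) a)"
proof -
  let ?e = "work_tapes M"
  let ?C = "length \<phi>"
  define R where "R n \<longleftrightarrow> (\<exists>c<n. conflicts c 0 ?C \<or> conflicts c 1 ?C)" for n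
  let ?f = "\<lambda>c. set_flag (R c) a"
  have "does (120 + ?e) (test_all M) (?f 0) (?f ?C)" unfolding test_all_def
  proof (rule does_for[where j = "111 + ?e"])
    fix c assume c: "c < ?C"
    let ?b = "setv 0 (?C - c) (setv 1 c (?f c))"
    have 1: "does (110 + ?e) (test_row M 0) ?b
        (set_flag (conflicts c 0 ?C) ?b)"
      using assms c by (intro does_test_row) (auto simp: clean_setv clean_set_flag)
    have 2: "does (110 + ?e) (test_row M 1)
        (set_flag (conflicts c 0 ?C) ?b) (set_flag (conflicts c 1 ?C) (set_flag (conflicts c 0 ?C) ?b))"
      using assms c by (intro does_test_row) (auto simp: clean_setv clean_set_flag)
    have "R (Suc c) \<longleftrightarrow> conflicts c 1 ?C \<or> conflicts c 0 ?C \<or> R c" by (auto simp: R_def less_Suc_eq)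
    then have "set_flag (conflicts c 1 ?C) (set_flag (conflicts c 0 ?C) ?b)
        = setv 0 (?C - c) (setv 1 c (?f (Suc c)))" by simp
    then show "does (111 + ?e) (Seq (test_row M 0)
          (test_row M 1)) ?b
        (setv 0 (?C - c) (setv 1 c (?f (Suc c))))" using does_Seq[OF 1 2, of "111 + ?e"] by simp
  qed (use a length_le_N in auto)
  moreover have "?f 0 = a" by (simp add: R_def)
  moreover have "R ?C \<longleftrightarrow> \<not> satisfiable \<phi>"
  proof -
    have double: "(\<exists>p<2 * n. P p) \<longleftrightarrow> (\<exists>c<n. P (2 * c) \<or> P (2 * c + 1))" for P and n :: nat
    proof
      assume "\<exists>p<2 * n. P p"
      then obtain p where p: "p < 2 * n" "P p" by blast
      have "p div 2 < n" using p(1) by simp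
      moreover have "p = 2 * (p div 2) \<or> p = 2 * (p div 2) + 1" by presburger
      ultimately show "\<exists>c<n. P (2 * c) \<or> P (2 * c + 1)" using p(2) by metis
    next
      assume "\<exists>c<n. P (2 * c) \<or> P (2 * c + 1)"
      then obtain c where "c < n" "P (2 * c) \<or> P (2 * c + 1)" by blast
      then show "\<exists>p<2 * n. P p"
        by (elim disjE) (rule exI[of _ "2 * c"], simp, rule exI[of _ "2 * c + 1"], simp)
    qed
    show ?thesis unfolding satisfiable_iff[OF two] double R_def conflicts_def conflict_def
      by (simp add: slot_of_def) blast
  qed
  ultimately show ?thesis by simp
qed

lemma does_count_clauses:
  "does 10 count_clauses initial_ast (setv 0 (length \<phi>) (setv 2 (length \<phi>) (setv 4 (length \<phi>)
     (setv 6 (length \<phi>) ((initial_ast :: bool ast)\<lparr>pos := length x + 1\<rparr>)))))"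
proof -
  define n where "n p = length (filter (\<lambda>z. z = EndClause) (take p x))" for p
  have nN: "n p < N" for p
  proof -
    have "n p \<le> length x" unfolding n_def by (rule order_trans[OF length_filter_le]) simp
    then show ?thesis using xN by simp
  qed
  let ?f = "\<lambda>p. setv 0 (n p) (setv 2 (n p) (setv 4 (n p) (setv 6 (n p) ((initial_ast :: bool ast)\<lparr>pos := p\<rparr>))))"
  have "does 10 count_clauses (?f 0) (?f (length x + 1))" unfolding count_clauses_def
  proof (rule does_While[where j = 8])
    fix p assume p: "p < length x + 1"
    then show "input_at x (pos (?f p)) \<noteq> RightEnd" by (auto simp: input_at_def)
    let ?a = "(?f p)\<lparr>pos := Suc p\<rparr>"
    have 1: "does 7 (move_head MoveR) (?f p) ?a" using does_move_head[of 7 MoveR "?f p"] p by simp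
    have 2: "does 7 (If (\<lambda>z sc. z = Letter EndClause)
       (Seq (inc_cmd 0) (Seq (inc_cmd 2) (Seq (inc_cmd 4) (inc_cmd 6)))) Skip) ?a (?f (Suc p))"
    proof (rule does_If[where i = 6])
      assume "input_at x (pos ?a) = Letter EndClause"
      then have "p < length x" "x ! p = EndClause" by (auto simp: input_at_def split: if_splits)
      then have n: "n (Suc p) = Suc (n p)" by (simp add: n_def take_Suc_conv_app_nth)
      let ?b = "setv 0 (Suc (n p)) ?a"
      let ?c = "setv 2 (Suc (n p)) ?b"
      let ?d = "setv 4 (Suc (n p)) ?c"
      have i: "does 2 (inc_cmd 0) ?a ?b" "does 2 (inc_cmd 2) ?b ?c" "does 2 (inc_cmd 4) ?c ?d"
        "does 2 (inc_cmd 6) ?d (setv 6 (Suc (n p)) ?d)"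
        using does_mono[OF does_inc[of 0 ?a], of 2] does_mono[OF does_inc[of 2 ?b], of 2]
          does_mono[OF does_inc[of 4 ?c], of 2] does_mono[OF does_inc[of 6 ?d], of 2] nN[of p]
        by (simp_all add: initial_ast_def)
      have eq: "setv 6 (Suc (n p)) ?d = ?f (Suc p)" unfolding n by (rule ast_eqI) auto
      have "does 6 (Seq (inc_cmd 0) (Seq (inc_cmd 2) (Seq (inc_cmd 4) (inc_cmd 6)))) ?a
          (setv 6 (Suc (n p)) ?d)"
        by (rule does_Seq[OF i(1) does_Seq[OF i(2) does_Seq[OF i(3,4), of 3], of 4]]) simp_all
      then show "does 6 (Seq (inc_cmd 0) (Seq (inc_cmd 2) (Seq (inc_cmd 4) (inc_cmd 6)))) ?a (?f (Suc p))"
        unfolding eq .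
    next
      assume "\<not> input_at x (pos ?a) = Letter EndClause"
      then have "p < length x \<Longrightarrow> x ! p \<noteq> EndClause" by (auto simp: input_at_def)
      then have "n (Suc p) = n p"
        by (cases "p < length x") (auto simp: n_def take_Suc_conv_app_nth)
      then show "does 6 Skip ?a (?f (Suc p))" by (simp add: does_Skip)
    qed simp
    show "does 8 (Seq (move_head MoveR) (If (\<lambda>z sc. z = Letter EndClause)
       (Seq (inc_cmd 0) (Seq (inc_cmd 2) (Seq (inc_cmd 4) (inc_cmd 6)))) Skip)) (?f p) (?f (Suc p))"
      using does_Seq[OF 1 2, of 8] by simp
  next
    show "\<not> input_at x (pos (?f (length x + 1))) \<noteq> RightEnd" by (simp add: input_at_def)
  qed (use xN NZ in auto)
  moreover have "n (length x + 1) = length \<phi>" by (simp add: n_def x count_EndClause)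
  moreover have "?f 0 = initial_ast" by (rule ast_eqI) (auto simp: n_def initial_ast_def)
  ultimately show ?thesis by simp
qed

text \<open>The work tapes enter the exponent because they are erased one after the other and each
  \<open>Seq\<close> costs an exponent. For a fixed \<open>M\<close> the bound is still polynomial
  in \<open>Z\<close>.\<close>

lemma two_sat_correct:
  "\<exists>t\<le>Z ^ (130 + work_tapes M). \<exists>s. exec K k B x (two_sat_cmd M) initial_store t s \<and> outp s = [satisfiable \<phi>]"
proof -
  let ?e = "work_tapes M"
  let ?a = "initial_ast :: bool ast"
  let ?b = "setv 0 (length \<phi>) (setv 2 (length \<phi>) (setv 4 (length \<phi>) (setv 6 (length \<phi>) ?a)))"
  have ok: "ok ?a" using B2 by (auto simp: ok_def initial_ast_def mt_ok_def)
  have init: "timed 1 init_cmd initial_store (conc ?a)" unfolding init_cmd_def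
  proof (rule takes_Prim)
    show "conc ?a = act_store K x (Stay, \<lambda>i. if i < 12 then Some (3, MoveR)
        else if i < 20 then None else Some (1, MoveR), None) initial_store" using K K6
      by (auto simp: conc_def initial_ast_def initial_store_def act_store_def act_on_tape_def clip_def
          mtape_def fun_eq_iff list_tape_def split: nat.split)
  qed (use heads_le_conc[OF ok] in \<open>auto simp: heads_le_def initial_store_def\<close>)
  have 1: "does (121 + ?e) count_clauses ?a (?b\<lparr>pos := length x + 1\<rparr>)"
    using does_mono[OF does_count_clauses, of "121 + ?e"] by simp
  have 2: "does (121 + ?e) rewind (?b\<lparr>pos := length x + 1\<rparr>) ?b"
  proof -
    have "?b\<lparr>pos := length x + 1, pos := 0\<rparr> = ?b" by (rule ast_eqI) (auto simp: initial_ast_def)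
    then show ?thesis
      using does_mono[OF does_rewind[of "?b\<lparr>pos := length x + 1\<rparr>"], of "121 + ?e"] by simp
  qed
  have 3: "does (121 + ?e) (test_all M) ?b (set_flag (\<not> satisfiable \<phi>) ?b)"
    using does_mono[OF does_test_all[of ?b], of "121 + ?e"] by (simp add: clean_def initial_ast_def)
  let ?c = "set_flag (\<not> satisfiable \<phi>) ?b"
  have "vl ?c 19 = (if satisfiable \<phi> then 0 else 1)" by (simp add: set_flag_def initial_ast_def)
  then have sc: "scan k (conc ?c) 19 = 0 \<longleftrightarrow> satisfiable \<phi>"
    by (simp add: scan_reg del: set_flag_simps)
  have 4: "does (121 + ?e) (emit_out (\<lambda>z sc. sc 19 = 0)) ?c (?c\<lparr>wr := [satisfiable \<phi>]\<rparr>)"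
  proof -
    have "wr ?c @ [scan k (conc ?c) 19 = 0] = [satisfiable \<phi>]"
      unfolding sc by (simp add: initial_ast_def)
    then show ?thesis using does_emit_out[of "121 + ?e" "\<lambda>z sc. sc 19 = 0" ?c] by (simp only:)
  qed
  have "does (129 + ?e) (Seq count_clauses (Seq rewind (Seq (test_all M)
     (emit_out (\<lambda>z sc. sc 19 = 0))))) ?a (?c\<lparr>wr := [satisfiable \<phi>]\<rparr>)"
    using does_Seq[OF 1 does_Seq[OF 2 does_Seq[OF 3 4, of "122 + ?e"], of "123 + ?e"], of "129 + ?e"] by simp
  then have "timed (Z ^ (129 + ?e)) (Seq count_clauses (Seq rewind (Seq (test_all M)
     (emit_out (\<lambda>z sc. sc 19 = 0))))) (conc ?a) (conc (?c\<lparr>wr := [satisfiable \<phi>]\<rparr>))"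
    using ok by (simp add: does_def)
  then have "timed (Z ^ (130 + ?e)) (two_sat_cmd M) initial_store (conc (?c\<lparr>wr := [satisfiable \<phi>]\<rparr>))"
    unfolding two_sat_cmd_def
  proof (rule takes_Seq[OF init])
    have "Z ^ (129 + ?e) * 3 \<le> Z ^ (129 + ?e) * Z" using Z_ge by (intro mult_le_mono) auto
    moreover have "1 \<le> Z ^ (129 + ?e)" using Z_ge by simp
    moreover have "Z ^ (129 + ?e) * Z = Z ^ (130 + ?e)" by (simp flip: power_Suc2)
    ultimately show "1 + Z ^ (129 + ?e) + 1 \<le> Z ^ (130 + ?e)" by linarith
  qed
  moreover have "outp (conc (?c\<lparr>wr := [satisfiable \<phi>]\<rparr>)) = [satisfiable \<phi>]"
    by (simp add: conc_def)
  ultimately show ?thesis unfolding takes_def by blast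
qed

end

section \<open>Resource bounds\<close>

lemma head_move_le:
  assumes "wf_tm M" "j < work_tapes M"
  shows "snd (tapes (run M w (Suc t)) ! j) \<le> Suc (snd (tapes (run M w t) ! j))"
proof (cases "cur_state (run M w t) \<in> halt_states M")
  case True
  then show ?thesis by (simp add: run_def step_def)
next
  case False
  let ?c = "run M w t"
  note inv = tm_inv_run[OF assms(1), of w t]
  obtain q d acts b where tr: "transition M (cur_state ?c) (input_at w (input_head ?c))
      (map (\<lambda>tp. fst tp (snd tp)) (tapes ?c)) = (q, d, acts, b)" using prod_cases4 by blast
  have "length acts = work_tapes M" "length (tapes ?c) = work_tapes M"
    using transition_wf(2)[OF assms(1) inv tr] inv by (simp_all add: tm_inv_def)
  moreover have "tapes (run M w (Suc t)) = map2 act_on_tape (tapes ?c) acts"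
    using False tr by (simp add: run_def step_def)
  moreover have "move e h \<le> Suc h" for e h by (cases e) auto
  ultimately show ?thesis using assms(2) by (simp add: act_on_tape_def)
qed

lemma head_start:
  assumes "j < work_tapes M"
  shows "snd (tapes (run M w 0) ! j) = 0"
  using assms by (simp add: run_def initial_config_def)

lemma head_le_time:
  assumes "wf_tm M" "j < work_tapes M"
  shows "snd (tapes (run M w t) ! j) \<le> t"
proof (induction t)
  case (Suc t)
  then show ?case using head_move_le[OF assms, of w t] by simp
qed (use head_start[OF assms(2), of w] in simp)

lemma visited_cells_bounded:
  assumes "wf_tm M" "halted_at M w T"
  shows "visited_cells M w \<subseteq> {..<work_tapes M} \<times> {..T}"
proof
  fix p assume "p \<in> visited_cells M w"
  then obtain j t where p: "p = (j, snd (tapes (run M w t) ! j))" "j < work_tapes M"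
    by (auto simp: visited_cells_def)
  have stays: "run M w (T + u) = run M w T" for u
  proof (induction u)
    case (Suc u)
    then show ?case using assms(2) by (simp add: run_def halted_at_def step_def)
  qed simp
  have "snd (tapes (run M w t) ! j) \<le> T"
    using head_le_time[OF assms(1) p(2), of w t] head_le_time[OF assms(1) p(2), of w T]
      stays[of "t - T"] by (cases "t \<le> T") auto
  then show "p \<in> {..<work_tapes M} \<times> {..T}" using p by simp
qed

text \<open>Serves for the instances that are too small for the asymptotic space bound.\<close>

lemma space_used_le_time:
  assumes "wf_tm M" "halted_at M w T"
  shows "space_used M w \<le> work_tapes M * (T + 1)"
proof -
  have "card (visited_cells M w) \<le> card ({..<work_tapes M} \<times> {..T})"
    using visited_cells_bounded[OF assms] by (intro card_mono) auto
  then show ?thesis by (simp add: space_used_def)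
qed

text \<open>A head starts at 0 and moves by at most one cell per step, so it has visited all cells
  to the left of its position. Space thereby bounds head positions, which is what the simulation
  needs.\<close>

lemma head_less_space_used:
  assumes "wf_tm M" "halted_at M w T" "j < work_tapes M"
  shows "snd (tapes (run M w t) ! j) < space_used M w"
proof -
  let ?h = "\<lambda>t. snd (tapes (run M w t) ! j)"
  have "\<exists>u. ?h u = i" if "i \<le> ?h t" for i using that
  proof (induction t)
    case 0
    then have "i = ?h 0" using head_start[OF assms(3), of w] by simp
    then show ?case by blast
  next
    case (Suc t)
    then show ?case
      using head_move_le[OF assms(1,3), of w t] by (cases "i \<le> ?h t") (auto simp: le_Suc_eq)
  qed
  then have "{j} \<times> {..?h t} \<subseteq> visited_cells M w"
    using assms(3) by (fastforce simp: visited_cells_def)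
  then have "card ({j} \<times> {..?h t}) \<le> card (visited_cells M w)"
    using visited_cells_bounded[OF assms(1,2)] finite_subset by (intro card_mono) blast+
  then show ?thesis by (simp add: space_used_def)
qed

section \<open>Queries as instances and elementary estimates\<close>

lemma query_instance: "p < 2 * length \<phi> \<Longrightarrow> query \<phi> p \<in> search_1nfa_instances"
  by (auto simp: search_1nfa_instances_def query_def query_nfa_def wf_nfa_def)

lemma m_nfa_query: "m_nfa (query \<phi> p) = 4 * (length \<phi>)\<^sup>2"
  by (simp add: query_def query_nfa_def power2_eq_square)

lemma length_encode_query:
  assumes "p < 2 * length \<phi>"
  shows "length (query_code \<phi> p) \<le> 4 * (length \<phi>)\<^sup>2 + 8 * length \<phi> + 6"
proof -
  \<comment> \<open>The table has \<open>4 * C^2\<close> bits for \<open>C\<close> clauses; states,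
    final bits and word length take \<open>2 * C\<close> symbols each, the initial state
    \<open>p\<close>, the letter 1 and the separators 5.\<close>
  have "length (query_code \<phi> p) = 4 * (length \<phi>)\<^sup>2 + 6 * length \<phi> + p + 6"
    by (simp add: query_def query_nfa_def unary_def length_concat o_def sum_list_triv power2_eq_square)
  then show ?thesis using assms by simp
qed

lemma Bot_notin_encode_word: "Bot \<notin> set (encode_word w)"
  by (auto simp: encode_word_def)

lemma poly_nat_mono: "m \<le> n \<Longrightarrow> poly (p :: nat poly) m \<le> poly p n"
  by (induction p) (auto intro!: add_mono mult_mono)

lemma length_digits_le: "real (length (digits n)) \<le> log 2 (real n + 1)"
proof -
  have "real (2 ^ length (digits n)) \<le> real (n + 1)"
    using two_power_length_digits of_nat_le_iff by blast
  then show ?thesis by (simp add: le_log_iff powr_realpow add.commute)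
qed

lemma log2_le: "log 2 (real n + 1) \<le> real n"
proof -
  have "n + 1 \<le> 2 ^ n" using less_exp[of n] by (simp only: Suc_le_eq Suc_eq_plus1[symmetric])
  then have "real (n + 1) \<le> real (2 ^ n)" unfolding of_nat_le_iff .
  then show ?thesis by (simp add: log_le_iff powr_realpow add.commute)
qed

lemma one_le_real_square: "0 < n \<Longrightarrow> 1 \<le> real (4 * n\<^sup>2)"
proof -
  assume "0 < n"
  then have "1 \<le> 4 * n\<^sup>2" by (simp add: Suc_le_eq)
  then have "real 1 \<le> real (4 * n\<^sup>2)" by (rule of_nat_mono)
  then show ?thesis by (simp only: of_nat_1)
qed

text \<open>Makes the asymptotic bound uniform over all queries. Those below the threshold have
  bounded length, hence bounded running time and space; as their size parameter is at least 1, this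
  is absorbed into the constant.\<close>

lemma query_space_bound:
  fixes M :: "(nfa_sym, out_sym) tm"
  assumes "wf_tm M" and p: "\<forall>x \<in> encode_search ` search_1nfa_instances. \<exists>t\<le>poly p (length x). halted_at M x t"
    and space: "(\<lambda>y. real (space_used M (encode_search y))) \<in> O[m_nfa_at_top](\<lambda>y. real (m_nfa y) powr e)"
    and e: "0 \<le> e"
  obtains c :: real where "0 \<le> c" "\<And>\<phi> q. q < 2 * length \<phi> \<Longrightarrow>
    real (space_used M (query_code \<phi> q)) \<le> c * real (4 * (length \<phi>)\<^sup>2) powr e"
proof -
  obtain c where c: "c > 0" "\<forall>\<^sub>F y in m_nfa_at_top.
      norm (real (space_used M (encode_search y))) \<le> c * norm (real (m_nfa y) powr e)"
    using space by (elim landau_o.bigE)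
  from c(2) obtain N0 where "\<forall>y. N0 \<le> m_nfa y \<longrightarrow> y \<in> search_1nfa_instances \<longrightarrow>
      norm (real (space_used M (encode_search y))) \<le> c * norm (real (m_nfa y) powr e)"
    unfolding m_nfa_at_top_def eventually_inf_principal eventually_filtercomap_at_top_linorder by (rule exE)
  then have N0: "real (space_used M (encode_search y)) \<le> c * (real (m_nfa y) powr e)"
    if "N0 \<le> m_nfa y" "y \<in> search_1nfa_instances" for y
    using that by (simp del: encode_search.simps m_nfa.simps split_paired_All)
  \<comment> \<open>Below the threshold, \<open>4 * C^2 \<le> N0\<close> and
    \<open>C \<le> C^2\<close> bound the query length \<open>4 * C^2 + 8 * C + 6\<close> by
    \<open>3 * N0 + 6\<close>.\<close>
  define d where "d = real (work_tapes M * (poly p (3 * N0 + 6) + 1))"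
  show ?thesis
  proof (rule that[of "c + d"])
    show "0 \<le> c + d" using c(1) by (simp add: d_def)
    fix \<phi> :: cnf and q assume q: "q < 2 * length \<phi>"
    let ?y = "query \<phi> q"
    let ?m = "real (4 * (length \<phi>)\<^sup>2)"
    have "0 < length \<phi>" using q by linarith
    then have "1 \<le> ?m powr e" by (intro ge_one_powr_ge_zero one_le_real_square e)
    moreover have "0 \<le> d" unfolding d_def by (rule of_nat_0_le_iff)
    ultimately have d: "d \<le> d * ?m powr e" using mult_left_mono[of 1 "?m powr e" d] by simp
    have "real (space_used M (encode_search ?y)) \<le> c * ?m powr e + d * ?m powr e"
    proof (cases "N0 \<le> m_nfa ?y")
      case True
      then show ?thesis
        using N0[OF True query_instance[OF q]] by (simp add: m_nfa_query d_def add_increasing2)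
    next
      case False
      then have "4 * (length \<phi>)\<^sup>2 \<le> N0" by (simp add: m_nfa_query)
      moreover have "length \<phi> \<le> (length \<phi>)\<^sup>2" unfolding power2_eq_square by (rule le_square)
      ultimately have len: "length (encode_search ?y) \<le> 3 * N0 + 6"
        using length_encode_query[OF q] by linarith
      obtain t where t: "t \<le> poly p (length (encode_search ?y))" "halted_at M (encode_search ?y) t"
        using p query_instance[OF q] by blast
      have "space_used M (encode_search ?y) \<le> work_tapes M * (t + 1)"
        by (rule space_used_le_time[OF assms(1) t(2)])
      also have "\<dots> \<le> work_tapes M * (poly p (3 * N0 + 6) + 1)"
        using t(1) poly_nat_mono[OF len, of p] by (intro mult_le_mono) auto
      finally have "real (space_used M (encode_search ?y)) \<le> d" unfolding d_def of_nat_le_iff .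
      then show ?thesis using d c(1) by (simp add: add_increasing)
    qed
    then show "real (space_used M (encode_search ?y)) \<le> (c + d) * ?m powr e"
      by (simp add: distrib_right)
  qed
qed

section \<open>Parameters of the reduction and the contradiction\<close>

theorem theorem6:
  assumes "LSH_2SAT3"
  shows "\<forall>\<epsilon> :: real. 0 < \<epsilon> \<and> \<epsilon> < 1 / 2 \<longrightarrow>
    \<not> (\<exists>M :: (nfa_sym, out_sym) tm.
         wf_tm M \<and> solves_search_1nfa M \<and>
         poly_time_on M (encode_search ` search_1nfa_instances) \<and>
         (\<lambda>y. real (space_used M (encode_search y)))
           \<in> O[m_nfa_at_top](\<lambda>y. real (m_nfa y) powr (1 / 2 - \<epsilon>)))"
proof (intro allI impI notI, elim exE conjE)
  fix \<epsilon> :: real and M :: "(nfa_sym, out_sym) tm"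
  assume \<epsilon>: "0 < \<epsilon>" "\<epsilon> < 1 / 2" and wf: "wf_tm M" and solves: "solves_search_1nfa M"
    and ptime: "poly_time_on M (encode_search ` search_1nfa_instances)"
    and space: "(\<lambda>y. real (space_used M (encode_search y)))
           \<in> O[m_nfa_at_top](\<lambda>y. real (m_nfa y) powr (1 / 2 - \<epsilon>))"
  define e where "e = 1 / 2 - \<epsilon>"
  \<comment> \<open>The power \<open>e\<close> of the query size \<open>4 * C^2\<close> is the power
    \<open>2 * e\<close> of \<open>2 * C\<close>; this is the exponent at which the hypothesis on
    2SAT is refuted.\<close>
  define \<delta> where "\<delta> = 2 * e"
  have e: "0 < e" "e \<le> 1" and \<delta>: "0 < \<delta>" "\<delta> < 1" using \<epsilon> by (auto simp: e_def \<delta>_def)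
  obtain p where p: "\<forall>x \<in> encode_search ` search_1nfa_instances. \<exists>t\<le>poly p (length x). halted_at M x t"
    using ptime by (auto simp: poly_time_on_def)
  obtain c where c: "0 \<le> c" "\<And>\<phi> q. q < 2 * length \<phi> \<Longrightarrow>
    real (space_used M (query_code \<phi> q)) \<le> c * real (4 * (length \<phi>)\<^sup>2) powr e"
    using query_space_bound[OF wf p space[folded e_def]] e by (metis less_eq_real_def)
  let ?c = "nat \<lceil>c\<rceil>"
  obtain K where K: "6 < K" "\<And>q. q \<in> states M \<Longrightarrow> q < K" "\<And>v. v \<in> work_symbols M \<Longrightarrow> v + 2 < K"
  proof -
    have "finite (insert 6 (states M \<union> (\<lambda>v. v + 2) ` work_symbols M))"
      using wf by (simp add: wf_tm_def)
    then obtain K where "\<forall>n\<in>insert 6 (states M \<union> (\<lambda>v. v + 2) ` work_symbols M). n < K"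
      using finite_nat_set_iff_bounded by blast
    then show ?thesis using that by auto
  qed
  define k where "k = 20 + work_tapes M"
  define M' where "M' = compile K k (two_sat_cmd M)"
  \<comment> \<open>Large enough for positions in the formula, of length \<open>n\<close>, and in
    every query, of length at most \<open>4 * C^2 + 8 * C + 6\<close> with
    \<open>C \<le> n\<close>.\<close>
  define N where "N n = 4 * n\<^sup>2 + 8 * n + 20" for n :: nat
  define S where "S C = nat \<lfloor>c * real (4 * C\<^sup>2) powr e\<rfloor>" for C :: nat
  define L where "L n = nat \<lfloor>log 2 (real (N n) + 1)\<rfloor>" for n
  \<comment> \<open>\<open>L\<close> is room for the digits of a counter and \<open>S\<close> for a
    simulated tape; the constant covers markers and a head just beyond the used cells.\<close>
  define B where "B n C = L n + S C + 4" for n C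
  \<comment> \<open>The time bound must be a polynomial in \<open>n\<close>, so \<open>L\<close> and
    \<open>S\<close> are replaced by the crude bounds \<open>N n\<close> and
    \<open>4 * ?c * n^2\<close>; the latter holds because \<open>e \<le> 1\<close>.\<close>
  define Z where "Z n = 6 * (N n + 4 * ?c * n\<^sup>2 + 5) + 20 + N n + poly p (N n)" for n
  have red: "reduction_vm K k (B (length (encode_cnf \<phi>)) (length \<phi>)) (encode_cnf \<phi>)
      (N (length (encode_cnf \<phi>))) (Z (length (encode_cnf \<phi>))) \<phi> M" if \<phi>: "\<phi> \<in> two_sat3_instances" for \<phi>
  proof -
    let ?n = "length (encode_cnf \<phi>)" and ?C = "length \<phi>"
    have Cn: "?C \<le> ?n" by (rule length_le_encode_cnf)
    have len: "length (query_code \<phi> q) + 2 \<le> N ?n" if "q < 2 * ?C" for q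
    proof -
      have "?C\<^sup>2 \<le> ?n\<^sup>2" using Cn by simp
      then show ?thesis using length_encode_query[OF that] Cn unfolding N_def by linarith
    qed
    have SC: "S ?C \<le> 4 * ?c * ?n\<^sup>2"
    proof (cases "?C = 0")
      case True
      then show ?thesis by (simp add: S_def)
    next
      case False
      then have "1 \<le> real (4 * ?C\<^sup>2)" by (intro one_le_real_square) simp
      then have "real (4 * ?C\<^sup>2) powr e \<le> real (4 * ?C\<^sup>2) powr 1"
        using e by (intro powr_mono) auto
      also have "\<dots> \<le> real (4 * ?n\<^sup>2)" using Cn by simp
      finally have "c * real (4 * ?C\<^sup>2) powr e \<le> real ?c * real (4 * ?n\<^sup>2)"
        using c(1) by (intro mult_mono) (auto simp: real_nat_ceiling_ge)
      also have "\<dots> = real (4 * ?c * ?n\<^sup>2)"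
        by (simp only: of_nat_mult[symmetric] mult.assoc mult.left_commute)
      finally show ?thesis unfolding S_def by linarith
    qed
    have LN: "L ?n \<le> N ?n" unfolding L_def using log2_le[of "N ?n"] by linarith
    have time: "\<exists>t\<le>poly p (N ?n). halted_at M (query_code \<phi> q) t" if q: "q < 2 * ?C" for q
    proof -
      obtain t where "t \<le> poly p (length (query_code \<phi> q))" "halted_at M (query_code \<phi> q) t"
        using p query_instance[OF q] by blast
      moreover have "length (query_code \<phi> q) \<le> N ?n" using len[OF q] by simp
      ultimately show ?thesis using poly_nat_mono le_trans by blast
    qed
    show ?thesis
    proof unfold_locales
      show "length (digits i) + 2 \<le> B ?n ?C" if "i \<le> N ?n" for i
      proof -
        have "real (length (digits i)) \<le> log 2 (real (N ?n) + 1)"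
          using length_digits_le[of i] that by (smt (verit) log_mono of_nat_0_le_iff of_nat_mono)
        then have "length (digits i) \<le> L ?n" unfolding L_def by linarith
        then show ?thesis by (simp add: B_def)
      qed
      show "6 * B ?n ?C + 20 \<le> Z ?n"
      proof -
        have "6 * (l + s + 4) + 20 \<le> 6 * (m + s' + 5) + 20 + m + y" if "s \<le> s'" "l \<le> m" for l s m s' y :: nat
          using that by simp
        from this[OF SC LN] show ?thesis unfolding B_def Z_def .
      qed
      show "two_cnf \<phi>" using \<phi> by (simp add: two_sat3_instances_def)
      show "\<exists>u. computes M (query_code \<phi> q) u \<and> (Bot \<in> set u \<longleftrightarrow> \<not> refuted \<phi> q)"
        if q: "q < 2 * ?C" for q
      proof (cases "refuted \<phi> q")
        case True
        then have "\<exists>w. is_solution (query \<phi> q) w" using solution_iff_refuted[OF q] by simp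
        then obtain w where "computes M (query_code \<phi> q) (encode_word w)"
          using solves query_instance[OF q] unfolding solves_search_1nfa_def by (metis (full_types))
        then show ?thesis using True Bot_notin_encode_word by blast
      next
        case False
        then have "\<not> (\<exists>w. is_solution (query \<phi> q) w)" using solution_iff_refuted[OF q] by simp
        then have "computes M (query_code \<phi> q) [Bot]"
          using solves query_instance[OF q] unfolding solves_search_1nfa_def by (metis (full_types))
        then show ?thesis using False by (intro exI[of _ "[Bot]"]) simp
      qed
      show "\<exists>T\<le>Z ?n. halted_at M (query_code \<phi> q) T" if "q < 2 * ?C" for q
        using time[OF that] unfolding Z_def by (meson le_trans le_add2)
      show "snd (tapes (run M (query_code \<phi> q) t) ! j) + 2 \<le> B ?n ?C"
        if q: "q < 2 * ?C" and j: "j < work_tapes M" for q j t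
      proof -
        obtain T where "halted_at M (query_code \<phi> q) T" using time[OF q] by blast
        then have "snd (tapes (run M (query_code \<phi> q) t) ! j) < space_used M (query_code \<phi> q)"
          using head_less_space_used[OF wf _ j] by blast
        moreover have "space_used M (query_code \<phi> q) \<le> S ?C"
          using c(2)[OF q] unfolding S_def by linarith
        ultimately show ?thesis by (simp add: B_def)
      qed
    qed (use K wf len in \<open>auto simp: k_def N_def Z_def\<close>)
  qed
  have correct: "\<exists>t\<le>Z (length (encode_cnf \<phi>)) ^ (130 + work_tapes M).
      halted_at M' (encode_cnf \<phi>) t \<and> out_tape (run M' (encode_cnf \<phi>) t) = [satisfiable \<phi>]"
    and spc: "space_used M' (encode_cnf \<phi>) \<le> k * (B (length (encode_cnf \<phi>)) (length \<phi>) + 1)"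
    if "\<phi> \<in> two_sat3_instances" for \<phi>
  proof -
    interpret reduction_vm K k "B (length (encode_cnf \<phi>)) (length \<phi>)" "encode_cnf \<phi>"
      "N (length (encode_cnf \<phi>))" "Z (length (encode_cnf \<phi>))" \<phi> M by (rule red[OF that])
    obtain t s where t: "t \<le> Z (length (encode_cnf \<phi>)) ^ (130 + work_tapes M)"
      "exec K k (B (length (encode_cnf \<phi>)) (length \<phi>)) (encode_cnf \<phi>) (two_sat_cmd M) initial_store t s"
      "outp s = [satisfiable \<phi>]" using two_sat_correct by blast
    note cc = compile_correct[OF t(2), folded M'_def]
    show "\<exists>t\<le>Z (length (encode_cnf \<phi>)) ^ (130 + work_tapes M).
        halted_at M' (encode_cnf \<phi>) t \<and> out_tape (run M' (encode_cnf \<phi>) t) = [satisfiable \<phi>]"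
      using cc t by auto
    show "space_used M' (encode_cnf \<phi>) \<le> k * (B (length (encode_cnf \<phi>)) (length \<phi>) + 1)"
      by (rule cc(3))
  qed
  \<comment> \<open>From the space \<open>k * (L + S + 5)\<close> with
    \<open>L \<le> 6 + 2 * log 2 n\<close> and \<open>S \<le> 6 * c * m powr \<delta>\<close>. The
    factor \<open>m powr \<delta>\<close> can be pulled out of all summands because it is at least
    1.\<close>
  define f where "f n = poly [:real k * (11 + 6 * c), 2 * real k:] (log 2 (real n))" for n
  have "polylogarithmic f" unfolding polylogarithmic_def f_def by blast
  moreover have "wf_tm M'" unfolding M'_def using K(1) by (intro wf_compile) simp
  moreover have "solves_2SAT3 M'" unfolding solves_2SAT3_def computes_def using correct by blast
  moreover have "poly_time_on M' (encode_cnf ` two_sat3_instances)"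
  proof -
    let ?N = "[:20, 8, 4:] :: nat poly"
    let ?Z = "smult 6 (?N + [:5, 0, 4 * ?c:]) + [:20:] + ?N + pcompose p ?N"
    have N: "poly ?N n = N n" for n by (simp add: N_def power2_eq_square algebra_simps)
    then have "poly ?Z n = Z n" for n
      by (simp add: Z_def poly_pcompose N power2_eq_square algebra_simps del: poly_pCons)
        (simp add: N_def power2_eq_square algebra_simps)
    then have "poly (?Z ^ (130 + work_tapes M)) n = Z n ^ (130 + work_tapes M)" for n
      by (simp only: poly_power)
    then show ?thesis
      unfolding poly_time_on_def using correct by (intro exI[of _ "?Z ^ (130 + work_tapes M)"]) force
  qed
  moreover have "real (space_used M' (encode_cnf \<phi>)) \<le> real (m_vbl \<phi>) powr \<delta> * f (length (encode_cnf \<phi>))"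
    if \<phi>: "\<phi> \<in> two_sat3_instances" for \<phi>
  proof -
    let ?n = "length (encode_cnf \<phi>)" and ?C = "length \<phi>" and ?m = "m_vbl \<phi>"
    \<comment> \<open>Instances have a clause and hence a variable, which keeps powers of
      \<open>m\<close> at least 1 and logarithms of \<open>n\<close> nonnegative.\<close>
    have C1: "1 \<le> ?C" using \<phi> by (cases \<phi>) (auto simp: two_sat3_instances_def two_cnf_def)
    then have n1: "1 \<le> real ?n" using length_le_encode_cnf[of \<phi>] by simp
    have m1: "1 \<le> ?m" using C1 length_le_m_vbl[OF \<phi>] by simp
    then have md: "1 \<le> real ?m powr \<delta>" using \<delta> by (intro ge_one_powr_ge_zero) auto
    have S: "real (S ?C) \<le> 6 * c * real ?m powr \<delta>"
    proof -
      have "real (4 * ?C\<^sup>2) powr e = (2 * real ?C) powr \<delta>"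
        unfolding \<delta>_def by (simp add: powr_powr[symmetric] powr_numeral power_mult_distrib C1)
      \<comment> \<open>At most three clauses per variable give \<open>2 * C \<le> 6 * m\<close>;
        the factor 6 then leaves the power as at most 6, since \<open>\<delta> < 1\<close>.\<close>
      also have "\<dots> \<le> (6 * real ?m) powr \<delta>"
        using length_le_m_vbl[OF \<phi>] \<delta> by (intro powr_mono2) auto
      also have "\<dots> = 6 powr \<delta> * real ?m powr \<delta>" by (simp add: powr_mult)
      also have "\<dots> \<le> 6 * real ?m powr \<delta>"
        using \<delta> powr_mono[of \<delta> 1 6] by (intro mult_right_mono) auto
      finally have "c * real (4 * ?C\<^sup>2) powr e \<le> c * (6 * real ?m powr \<delta>)"
        using c(1) by (rule mult_left_mono)
      moreover have "real (S ?C) \<le> c * real (4 * ?C\<^sup>2) powr e" unfolding S_def using c(1) by simp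
      ultimately show ?thesis by simp
    qed
    have L: "real (L ?n) \<le> 6 + 2 * log 2 ?n"
    proof -
      have "real ?n \<le> (real ?n)\<^sup>2" using n1 by (rule self_le_power) simp
      \<comment> \<open>For \<open>n \<ge> 1\<close> the coefficients add up to
        \<open>4 + 8 + 21\<close>; 64 is taken as a power of 2 above this sum, with logarithm
        6.\<close>
      then have "real (N ?n) + 1 \<le> 64 * (real ?n)\<^sup>2"
      proof -
        have "real (N ?n) + 1 = 4 * (real ?n)\<^sup>2 + 8 * real ?n + 21" by (simp add: N_def)
        then show ?thesis using n1 \<open>real ?n \<le> (real ?n)\<^sup>2\<close> by linarith
      qed
      then have "log 2 (real (N ?n) + 1) \<le> log 2 (64 * (real ?n)\<^sup>2)"
        using n1 by (intro log_mono) auto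
      also have "\<dots> = 6 + 2 * log 2 ?n"
      proof -
        have "log 2 (64 * y\<^sup>2) = 6 + 2 * log 2 y" if "0 < y" for y :: real
          using that log_pow_cancel[of 2 6] by (simp add: log_mult log_nat_power)
        from this[of "real ?n"] show ?thesis using n1 by linarith
      qed
      finally have "log 2 (real (N ?n) + 1) \<le> 6 + 2 * log 2 ?n" .
      moreover have "0 \<le> log 2 (real (N ?n) + 1)" by simp
      ultimately show ?thesis unfolding L_def by linarith
    qed
    have "0 \<le> log 2 (real ?n)" using log_mono[of 2 1 "real ?n"] n1 by simp
    have "real (space_used M' (encode_cnf \<phi>)) \<le> real (k * (B ?n ?C + 1))"
      using spc[OF \<phi>] of_nat_le_iff by blast
    also have "\<dots> = real k * (real (L ?n) + real (S ?C) + 5)" by (simp add: B_def)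
    also have "\<dots> \<le> real k * (11 + 2 * log 2 ?n + 6 * c * real ?m powr \<delta>)"
      using L S by (intro mult_left_mono) auto
    also have "\<dots> \<le> real k * (real ?m powr \<delta> * (11 + 2 * log 2 ?n) + 6 * c * real ?m powr \<delta>)"
      using md \<open>0 \<le> log 2 (real ?n)\<close> mult_right_mono[of 1 "real ?m powr \<delta>" "11 + 2 * log 2 ?n"]
      by (intro mult_left_mono add_right_mono) auto
    also have "\<dots> = real ?m powr \<delta> * f ?n" by (simp add: f_def algebra_simps)
    finally show ?thesis .
  qed
  ultimately show False using assms \<delta> unfolding LSH_2SAT3_def by blast
qed

end
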